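(* Let $E$ be a graph and let $R$ be a unital commutative ring. If $R$ is an integral domain, then the set of prime graded basic ideals of $L_R(E)$ is $$\left\{I(\Omega(M),B_{\Omega(M)}),\ I(\Omega(v),B_{\Omega(v)}\setminus\{v\}) : M\in M(E),\ v\in BV(E)\right\}.$$
   Context: A graph $E=(E^0,E^1,r,s)$ consists of countable sets $E^0$ (vertices) and $E^1$ (edges) and range and source maps $r,s:E^1\to E^0$. A path of length $n\ge 1$ is $\alpha=e_1\cdots e_n$ with $r(e_i)=s(e_{i+1})$; $s(\alpha)=s(e_1)$, $r(\alpha)=r(e_n)$; vertices are paths of length $0$. Write $v\ge w$ if there is a path from $v$ to $w$. For a unital commutative ring $R$, $L_R(E)$ is the universal $R$-algebra generated by pairwise orthogonal idempotents $\{v:v\in E^0\}$ and elements $\{e,e^*:e\in E^1\}$ subject to: $s(e)e=er(e)=e$; $r(e)e^*=e^*s(e)=e^*$; $e^*f=\delta_{e,f}r(e)$; and $v=\sum_{s(e)=v}ee^*$ whenever $0<|s^{-1}(v)|<\infty$. For a path $\alpha=e_1\cdots e_n$, $\alpha^*:=e_n^*\cdots e_1^*$, and $v^*:=v$. $L_R(E)$ is $\mathbb Z$-graded with $L_R(E)_k=\mathrm{span}_R\{\alpha\beta^*: r(\alpha)=r(\beta),\ |\alpha|-|\beta|=k\}$; a (two-sided) ideal $I$ is graded if $I=\bigoplus_k (I\cap L_R(E)_k)$. $X\subseteq E^0$ is hereditary if $s(e)\in X$ implies $r(e)\in X$, and saturated if every $v$ with $0<|s^{-1}(v)|<\infty$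 and $r(s^{-1}(v))\subseteq X$ lies in $X$. For $H$ saturated hereditary, $B_H:=\{v\in E^0\setminus H: |s^{-1}(v)|=\infty,\ 0<|s^{-1}(v)\cap r^{-1}(E^0\setminus H)|<\infty\}$ and, for $v\in B_H$, $v^H:=v-\sum_{s(e)=v,\,r(e)\notin H}ee^*$. For $S\subseteq B_H$, $I(H,S)$ is the ideal of $L_R(E)$ generated by $\{v:v\in H\}\cup\{v^H:v\in S\}$. An ideal $I$ of $L_R(E)$ is basic if $\lambda x\in I$ with $\lambda\in R\setminus\{0\}$ implies $x\in I$, whenever either $x\in E^0$ or $x=v-\sum_{i=1}^n e_ie_i^*$ with $v\in E^0$ and distinct edges $e_1,\dots,e_n\in s^{-1}(v)$. A proper ideal $I$ of a ring $A$ is prime if $J_1J_2\subseteq I$ for ideals $J_1,J_2$ of $A$ implies $J_1\subseteq I$ or $J_2\subseteq I$. $M(E)$ is the set of maximal tails: nonempty $M\subseteq E^0$ such that (MT1) if $v\in E^0$, $w\in M$, $v\ge w$, then $v\in M$; (MT2) if $v\in M$ with $0<|s^{-1}(v)|<\infty$, there is $e\in E^1$ with $s(e)=v$ and $r(e)\in M$; (MT3) for all $v,w\in M$ there is $y\in M$ with $v\ge y$ and $w\ge y$. For nonempty $X\subseteq E^0$, $\Omega(X):=\{w\in E^0\setminus X: w\not\ge v \text{ for every } v\in X\}$, and $\Omega(v):=\Omega(\{v\})$. If $M$ is a maximal tail, or if $v$ is an infinite emitter, then $\Omega(M)$, respectively $\Omega(v)$, is hereditary and saturated. The set of breaking vertices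 is $BV(E):=\{v\in E^0:|s^{-1}(v)|=\infty,\ 0<|s^{-1}(v)\setminus r^{-1}(\Omega(v))|<\infty\}$, i.e. the infinite emitters $v$ with $v\in B_{\Omega(v)}$. *)

theory Defs
  imports
    "HOL-Library.Countable_Set"
    "HOL-Library.Poly_Mapping"
    "HOL-Algebra.Ideal_Product"
    "HOL-Algebra.QuotRing"
    "HOL-Algebra.Module"
    "Graph_Theory.Arc_Walk"
begin

section \<open>Ideals of rings without unit\<close>

text \<open>
  The locales for rings and ideals in the library demand a multiplicative unit, which a Leavitt
  path algebra does not have when the graph has infinitely many vertices.  We use the records of
  the library, but the notions below never refer to the field \<open>one\<close>.
\<close>

definition rng_ideal :: "'a set \<Rightarrow> ('a, 'm) ring_scheme \<Rightarrow> bool" where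
  "rng_ideal I A \<longleftrightarrow> additive_subgroup I A \<and>
     (\<forall>x\<in>I. \<forall>a\<in>carrier A. a \<otimes>\<^bsub>A\<^esub> x \<in> I \<and> x \<otimes>\<^bsub>A\<^esub> a \<in> I)"

definition rng_genideal :: "('a, 'm) ring_scheme \<Rightarrow> 'a set \<Rightarrow> 'a set" where
  "rng_genideal A X = \<Inter>{I. rng_ideal I A \<and> X \<subseteq> I}"

definition rng_prime_ideal :: "'a set \<Rightarrow> ('a, 'm) ring_scheme \<Rightarrow> bool" where
  "rng_prime_ideal I A \<longleftrightarrow> rng_ideal I A \<and> I \<noteq> carrier A \<and>
     (\<forall>J1 J2. rng_ideal J1 A \<longrightarrow> rng_ideal J2 A \<longrightarrow> ideal_prod A J1 J2 \<subseteq> I \<longrightarrow>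
        J1 \<subseteq> I \<or> J2 \<subseteq> I)"

text \<open>
  Internal direct sum: summation is a bijection from the external direct sum of the family
  \<open>C\<close> onto \<open>I\<close>.
\<close>

definition is_internal_direct_sum ::
    "('a, 'm) ring_scheme \<Rightarrow> 'a set \<Rightarrow> ('k \<Rightarrow> 'a set) \<Rightarrow> bool" where
  "is_internal_direct_sum A I C \<longleftrightarrow>
     bij_betw (\<lambda>f. \<Oplus>\<^bsub>A\<^esub>k\<in>{k. f k \<noteq> \<zero>\<^bsub>A\<^esub>}. f k)
       {f. (\<forall>k. f k \<in> C k) \<and> finite {k. f k \<noteq> \<zero>\<^bsub>A\<^esub>}} I"


section \<open>Free algebras\<close>

datatype ('v, 'e) gen = Vertex 'v | Edge 'e | Ghost 'e

text \<open>
  Words under concatenation; a copy of the list type, so that the type-class instance stays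
  local to words.
\<close>

datatype ('v, 'e) gword = GWord (letters: "('v, 'e) gen list")

instantiation gword :: (type, type) monoid_add
begin

definition zero_gword :: "('v, 'e) gword" where
  "zero_gword = GWord []"

definition plus_gword :: "('v, 'e) gword \<Rightarrow> ('v, 'e) gword \<Rightarrow> ('v, 'e) gword" where
  "plus_gword u w = GWord (letters u @ letters w)"

instance
  by standard (auto simp: zero_gword_def plus_gword_def)

end

text \<open>
  Finitely supported functions on words, with the convolution product of
  \<open>Poly_Mapping\<close>: noncommutative polynomials in the generators.
\<close>

type_synonym ('v, 'e, 'r) ncpoly = "('v, 'e) gword \<Rightarrow>\<^sub>0 'r"

definition gen_elem :: "('v, 'e) gen \<Rightarrow> ('v, 'e, 'r::comm_ring_1) ncpoly" where
  "gen_elem g = Poly_Mapping.single (GWord [g]) 1"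

abbreviation vert :: "'v \<Rightarrow> ('v, 'e, 'r::comm_ring_1) ncpoly" where
  "vert v \<equiv> gen_elem (Vertex v)"

abbreviation edge :: "'e \<Rightarrow> ('v, 'e, 'r::comm_ring_1) ncpoly" where
  "edge e \<equiv> gen_elem (Edge e)"

abbreviation ghost :: "'e \<Rightarrow> ('v, 'e, 'r::comm_ring_1) ncpoly" where
  "ghost e \<equiv> gen_elem (Ghost e)"

definition scale :: "'r::comm_ring_1 \<Rightarrow> ('v, 'e, 'r) ncpoly \<Rightarrow> ('v, 'e, 'r) ncpoly" where
  "scale c p = Poly_Mapping.map (\<lambda>x. c * x) p"

definition gens :: "('v, 'e) pre_digraph \<Rightarrow> ('v, 'e) gen set" where
  "gens E = Vertex ` verts E \<union> Edge ` arcs E \<union> Ghost ` arcs E"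

text \<open>
  The free (non-unital) algebra on the generators of \<open>E\<close>: the empty word is not admitted, so
  the field \<open>one\<close> is a dummy lying outside of the carrier.
\<close>

definition free_alg ::
    "('v, 'e) pre_digraph \<Rightarrow> ('r::comm_ring_1, ('v, 'e, 'r) ncpoly) module" where
  "free_alg E =
     \<lparr>carrier = {p. \<forall>w\<in>Poly_Mapping.keys p. letters w \<noteq> [] \<and> set (letters w) \<subseteq> gens E},
      mult = (*), one = 1, zero = 0, add = (+), smult = scale\<rparr>"


section \<open>Leavitt path algebras\<close>

text \<open>
  A graph is a \<open>pre_digraph\<close> with \<open>E\<^sup>0 = verts E\<close>, \<open>E\<^sup>1 = arcs E\<close>, \<open>s = tail E\<close> and
  \<open>r = head E\<close>, so \<open>s\<inverse>(v) = out_arcs E v\<close>, and \<open>v \<ge> w\<close> is reachability \<open>v \<rightarrow>\<^sup>*\<^bsub>E\<^esub> w\<close>.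
\<close>

definition vert_minus ::
    "'v \<Rightarrow> 'e set \<Rightarrow> ('v, 'e, 'r::comm_ring_1) ncpoly" where
  "vert_minus v F = vert v - (\<Sum>e\<in>F. edge e * ghost e)"

definition regular_vertex :: "('v, 'e) pre_digraph \<Rightarrow> 'v \<Rightarrow> bool" where
  "regular_vertex E v \<longleftrightarrow> v \<in> verts E \<and> finite (out_arcs E v) \<and> out_arcs E v \<noteq> {}"

definition infinite_emitter :: "('v, 'e) pre_digraph \<Rightarrow> 'v \<Rightarrow> bool" where
  "infinite_emitter E v \<longleftrightarrow> v \<in> verts E \<and> infinite (out_arcs E v)"

definition relators :: "('v, 'e) pre_digraph \<Rightarrow> ('v, 'e, 'r::comm_ring_1) ncpoly set" where
  "relators E =
     {vert v * vert w - (if v = w then vert v else 0) | v w. v \<in> verts E \<and> w \<in> verts E} \<union>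
     {vert (tail E e) * edge e - edge e | e. e \<in> arcs E} \<union>
     {edge e * vert (head E e) - edge e | e. e \<in> arcs E} \<union>
     {vert (head E e) * ghost e - ghost e | e. e \<in> arcs E} \<union>
     {ghost e * vert (tail E e) - ghost e | e. e \<in> arcs E} \<union>
     {ghost e * edge f - (if e = f then vert (head E e) else 0) | e f.
        e \<in> arcs E \<and> f \<in> arcs E} \<union>
     {vert_minus v (out_arcs E v) | v. regular_vertex E v}"

text \<open>
  The algebra ideal generated by the relators.  Closure under scalars has to be required: the
  free algebra has no unit through which scalars could be absorbed.
\<close>

definition rel_ideal :: "('v, 'e) pre_digraph \<Rightarrow> ('v, 'e, 'r::comm_ring_1) ncpoly set" where
  "rel_ideal E = \<Inter>{I. rng_ideal I (free_alg E) \<and> (\<forall>c. \<forall>x\<in>I. scale c x \<in> I) \<and> relators E \<subseteq> I}"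

type_synonym ('v, 'e, 'r) lpa_elem = "('v, 'e, 'r) ncpoly set"

definition lpa_cls ::
    "('v, 'e) pre_digraph \<Rightarrow> ('v, 'e, 'r::comm_ring_1) ncpoly \<Rightarrow> ('v, 'e, 'r) lpa_elem" where
  "lpa_cls E p = rel_ideal E +>\<^bsub>free_alg E\<^esub> p"

text \<open>
  \<open>L\<^sub>R(E)\<close> is the quotient of the free algebra by the ideal of relations, with the scalar action
  on cosets; the coefficient ring \<open>R\<close> is the type \<open>'r\<close>.
\<close>

definition lpa ::
    "('v, 'e) pre_digraph \<Rightarrow> ('r::comm_ring_1, ('v, 'e, 'r) lpa_elem) module" where
  "lpa E = ring.extend (free_alg E Quot rel_ideal E)
     \<lparr>smult = (\<lambda>c X. \<Union>p\<in>X. lpa_cls E (scale c p))\<rparr>"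

text \<open>
  A path is given by its source \<open>u\<close> and its list \<open>p\<close> of edges, as in \<open>awalk\<close>; the paths of
  length 0 are the vertices.
\<close>

definition path_elem :: "'v \<Rightarrow> 'e awalk \<Rightarrow> ('v, 'e, 'r::comm_ring_1) ncpoly" where
  "path_elem u p = (if p = [] then vert u else prod_list (map edge p))"

definition path_star :: "'v \<Rightarrow> 'e awalk \<Rightarrow> ('v, 'e, 'r::comm_ring_1) ncpoly" where
  "path_star u p = (if p = [] then vert u else prod_list (map ghost (rev p)))"

definition deg_monomials ::
    "('v, 'e) pre_digraph \<Rightarrow> int \<Rightarrow> ('v, 'e, 'r::comm_ring_1) ncpoly set" where
  "deg_monomials E k =
     {path_elem u p * path_star u' q | u p u' q w.
        pre_digraph.awalk E u p w \<and> pre_digraph.awalk E u' q w \<and>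
        int (length p) - int (length q) = k}"

definition lpa_component ::
    "('v, 'e) pre_digraph \<Rightarrow> int \<Rightarrow> ('v, 'e, 'r::comm_ring_1) lpa_elem set" where
  "lpa_component E k =
     {lpa_cls E (\<Sum>m\<in>T. scale (c m) m) | c T. finite T \<and> T \<subseteq> deg_monomials E k}"

definition graded_ideal ::
    "('v, 'e) pre_digraph \<Rightarrow> ('v, 'e, 'r::comm_ring_1) lpa_elem set \<Rightarrow> bool" where
  "graded_ideal E I \<longleftrightarrow> rng_ideal I (lpa E) \<and>
     is_internal_direct_sum (lpa E) I (\<lambda>k. I \<inter> lpa_component E k)"

definition basic_ideal ::
    "('v, 'e) pre_digraph \<Rightarrow> ('v, 'e, 'r::comm_ring_1) lpa_elem set \<Rightarrow> bool" where
  "basic_ideal E I \<longleftrightarrow> rng_ideal I (lpa E) \<and>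
     (\<forall>x \<in> {lpa_cls E (vert v) | v. v \<in> verts E} \<union>
           {lpa_cls E (vert_minus v F) | v F.
              v \<in> verts E \<and> F \<subseteq> out_arcs E v \<and> finite F \<and> F \<noteq> {}}.
        \<forall>c::'r. c \<noteq> 0 \<longrightarrow> c \<odot>\<^bsub>lpa E\<^esub> x \<in> I \<longrightarrow> x \<in> I)"


section \<open>The ideals attached to sets of vertices\<close>

definition breaking :: "('v, 'e) pre_digraph \<Rightarrow> 'v set \<Rightarrow> 'v set" where
  "breaking E H = {v \<in> verts E - H. infinite_emitter E v \<and>
     finite {e \<in> out_arcs E v. head E e \<notin> H} \<and> {e \<in> out_arcs E v. head E e \<notin> H} \<noteq> {}}"

definition ideal_HS ::
    "('v, 'e) pre_digraph \<Rightarrow> 'v set \<Rightarrow> 'v set \<Rightarrow> ('v, 'e, 'r::comm_ring_1) lpa_elem set" where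
  "ideal_HS E H S = rng_genideal (lpa E)
     ({lpa_cls E (vert v) | v. v \<in> H} \<union>
      {lpa_cls E (vert_minus v {e \<in> out_arcs E v. head E e \<notin> H}) | v. v \<in> S})"

definition maximal_tails :: "('v, 'e) pre_digraph \<Rightarrow> 'v set set" where
  "maximal_tails E = {M. M \<noteq> {} \<and> M \<subseteq> verts E \<and>
     (\<forall>v\<in>verts E. \<forall>w\<in>M. v \<rightarrow>\<^sup>*\<^bsub>E\<^esub> w \<longrightarrow> v \<in> M) \<and>
     (\<forall>v\<in>M. regular_vertex E v \<longrightarrow> (\<exists>e\<in>arcs E. tail E e = v \<and> head E e \<in> M)) \<and>
     (\<forall>v\<in>M. \<forall>w\<in>M. \<exists>y\<in>M. v \<rightarrow>\<^sup>*\<^bsub>E\<^esub> y \<and> w \<rightarrow>\<^sup>*\<^bsub>E\<^esub> y)}"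

definition Omega :: "('v, 'e) pre_digraph \<Rightarrow> 'v set \<Rightarrow> 'v set" where
  "Omega E X = {w \<in> verts E - X. \<forall>v\<in>X. \<not> w \<rightarrow>\<^sup>*\<^bsub>E\<^esub> v}"

definition BV :: "('v, 'e) pre_digraph \<Rightarrow> 'v set" where
  "BV E = {v \<in> verts E. infinite_emitter E v \<and>
     finite {e \<in> out_arcs E v. head E e \<notin> Omega E {v}} \<and>
     {e \<in> out_arcs E v. head E e \<notin> Omega E {v}} \<noteq> {}}"

end

theory Submission
  imports Defs
begin

text \<open>
  An ideal of \<open>L\<^sub>R(E)\<close> is the same thing as an ideal of polynomials that contains the relators
  (\<open>full_ideal\<close>), and the whole proof takes place among these: graded means closed under taking
  homogeneous parts, and equations of the algebra become congruences modulo the ideal.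

  The heart of the matter is \<open>homogeneous_reducible\<close>: for any ideal \<open>J\<close>, a homogeneous \<open>x \<notin> J\<close> can
  be multiplied from both sides so that it becomes, modulo \<open>J\<close>, some
  \<open>c (u - \<Sum>\<^bsub>e\<in>F\<^esub> e e\<^sup>*)\<close> that still lies outside of \<open>J\<close>.  These are exactly the elements about which
  the definition of a basic ideal speaks.  A further multiplication (\<open>vert_minus_compresses\<close>) turns
  \<open>u - \<Sum> e e\<^sup>*\<close> into a vertex outside of \<open>H\<close> or into a gap projection \<open>w\<^sup>H\<close> with \<open>w \<notin> S\<close>, if \<open>J\<close>
  contains the generators of \<open>I(H,S)\<close>.  Applied to \<open>J = I(H,S)\<close>, where \<open>H\<close> and \<open>S\<close> are read off
  from a graded basic ideal \<open>I\<close>, this gives \<open>I = I(H,S)\<close> (\<open>graded_basic_eq_hs_ideal\<close>).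

  If moreover \<open>I\<close> is prime, then \<open>v L w\<close> is not contained in \<open>I\<close> for vertices \<open>v, w \<notin> H\<close>, so some
  \<open>v \<alpha> \<beta>\<^sup>* w\<close> is not in \<open>I\<close> and the range of \<open>\<alpha>\<close> lies below \<open>v\<close> and \<open>w\<close>: the complement of \<open>H\<close> is a
  maximal tail.  For a gap projection \<open>v\<^sup>H \<notin> I\<close> the product \<open>v\<^sup>H \<alpha>\<close> lies in \<open>I\<close> unless \<open>\<alpha> = v\<close>; so
  every vertex outside of \<open>H\<close> connects to \<open>v\<close>, and there is no second such gap (\<open>prime_gap\<close>).
  Hence either \<open>S = B\<^sub>H\<close>, or \<open>S = B\<^sub>H - {v}\<close> and \<open>H = \<Omega>(v)\<close>.

  For the converse one has to know that \<open>I(H,S)\<close> is not too large: no nonzero multiple of a vertex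
  outside of \<open>H\<close> or of a gap projection \<open>w\<^sup>H\<close>, \<open>w \<notin> S\<close>, lies in it.  This is seen in a
  representation of \<open>L\<^sub>R(E)\<close> by operators on functions that annihilates \<open>I(H,S)\<close>
  (\<open>hs_ideal_representation\<close>).  By the reduction above, \<open>I(H,S)\<close> is then basic.  It is graded because
  it has homogeneous generators.  Primeness of a graded ideal can be tested on homogeneous elements
  (\<open>prime_if_graded_prime\<close>); in both families any two of these are compressed to nonzero multiples
  of the same idempotent, namely a vertex below the two vertices in the tail \<open>M\<close>, or the gap
  projection \<open>v\<^sup>H\<close>, whose product does not vanish over an integral domain.
\<close>

section \<open>Noncommutative polynomials and their ideals\<close>

text \<open>
  The free unital algebra on the generators.  The carrier of \<open>free_alg E\<close> is its augmentation
  ideal; multiplying by elements of the unital algebra takes care of scalars at the same time.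
\<close>

definition uni_alg :: "('v, 'e) pre_digraph \<Rightarrow> ('v, 'e, 'r::comm_ring_1) ncpoly set" where
  "uni_alg E = {p. \<forall>w\<in>Poly_Mapping.keys p. set (letters w) \<subseteq> gens E}"

abbreviation aug :: "('v, 'e) pre_digraph \<Rightarrow> ('v, 'e, 'r::comm_ring_1) ncpoly set" where
  "aug E \<equiv> carrier (free_alg E)"

definition const :: "'r::comm_ring_1 \<Rightarrow> ('v, 'e, 'r) ncpoly" where
  "const c = Poly_Mapping.single 0 c"

lemma scale_conv_const: "scale c p = const c * p"
  by (simp add: scale_def const_def mult_map_scale_conv_mult)

lemma const_simps: "const 0 = 0" "const 1 = 1" "const (c + d) = const c + const d"
  "const (- c) = - const c" "const (c * d) = const c * const d"
  by (simp_all add: const_def single_add single_uminus mult_single)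

lemma poly_mapping_sum_single:
  "(p :: 'a \<Rightarrow>\<^sub>0 'b::comm_monoid_add) = (\<Sum>w\<in>Poly_Mapping.keys p. Poly_Mapping.single w (Poly_Mapping.lookup p w))"
  by (rule poly_mapping_eqI)
    (auto simp: lookup_sum lookup_single when_def sum.delta in_keys_iff)

text \<open>
  Induction over the terms of a polynomial, with all of its words in a given set \<open>K\<close>.
\<close>

lemma poly_mapping_add_induct [consumes 1, case_names zero add]:
  fixes p :: "'a \<Rightarrow>\<^sub>0 'b::comm_monoid_add"
  assumes "Poly_Mapping.keys p \<subseteq> K"
    and "P 0"
    and "\<And>p w c. P p \<Longrightarrow> w \<in> K \<Longrightarrow> P (p + Poly_Mapping.single w c)"
  shows "P p"
proof -
  have "P (\<Sum>w\<in>A. Poly_Mapping.single w (Poly_Mapping.lookup p w))"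
    if "finite A" "A \<subseteq> K" for A
    using that
    by (induction A rule: finite_induct) (use assms in \<open>auto simp: add.commute[of "Poly_Mapping.single _ _"]\<close>)
  from this[OF finite_keys assms(1)] show ?thesis
    using poly_mapping_sum_single[of p] by simp
qed

lemmas poly_mapping_additive_induct [case_names zero add] =
  poly_mapping_add_induct[OF subset_UNIV]

lemma const_commute: "const c * p = p * const c"
proof (induction p rule: poly_mapping_additive_induct)
  case (add p w d)
  then show ?case by (simp add: distrib_left distrib_right const_def mult_single mult.commute)
qed auto

lemma keys_mult_letters:
  "w \<in> Poly_Mapping.keys (p * q) \<Longrightarrow>
     \<exists>u\<in>Poly_Mapping.keys p. \<exists>v\<in>Poly_Mapping.keys q. w = u + v"
  using keys_mult[of p q] by blast

lemma letters_plus [simp]: "letters (u + v) = letters u @ letters v"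
  by (simp add: plus_gword_def)

lemma letters_zero [simp]: "letters 0 = []"
  by (simp add: zero_gword_def)

lemma aug_iff: "p \<in> aug E \<longleftrightarrow>
    (\<forall>w\<in>Poly_Mapping.keys p. letters w \<noteq> [] \<and> set (letters w) \<subseteq> gens E)"
  by (simp add: free_alg_def)

lemma uni_alg_0 [simp]: "0 \<in> uni_alg E" by (simp add: uni_alg_def)
lemma uni_alg_1 [simp]: "1 \<in> uni_alg E" by (simp add: uni_alg_def)
lemma uni_alg_const [simp]: "const c \<in> uni_alg E" by (simp add: uni_alg_def const_def)

lemma uni_alg_add [intro, simp]: "p \<in> uni_alg E \<Longrightarrow> q \<in> uni_alg E \<Longrightarrow> p + q \<in> uni_alg E"
  using keys_add[of p q] by (auto simp: uni_alg_def)

lemma keys_uminus: "Poly_Mapping.keys (- p) = Poly_Mapping.keys (p :: 'a \<Rightarrow>\<^sub>0 'b::ab_group_add)"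
  by (auto simp: in_keys_iff)

lemma uni_alg_uminus [intro, simp]: "p \<in> uni_alg E \<Longrightarrow> - p \<in> uni_alg E"
  by (simp add: uni_alg_def keys_uminus)

lemma uni_alg_diff [intro, simp]: "p \<in> uni_alg E \<Longrightarrow> q \<in> uni_alg E \<Longrightarrow> p - q \<in> uni_alg E"
  using uni_alg_add[of p E "- q"] by auto

lemma uni_alg_mult [intro, simp]: "p \<in> uni_alg E \<Longrightarrow> q \<in> uni_alg E \<Longrightarrow> p * q \<in> uni_alg E"
  by (fastforce simp: uni_alg_def dest!: keys_mult_letters)

lemma uni_alg_sum [intro, simp]: "(\<And>i. i \<in> A \<Longrightarrow> f i \<in> uni_alg E) \<Longrightarrow> sum f A \<in> uni_alg E"
  by (induction A rule: infinite_finite_induct) auto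

lemma aug_uni [intro, simp]: "p \<in> aug E \<Longrightarrow> p \<in> uni_alg E"
  by (auto simp: aug_iff uni_alg_def)

lemma aug_0 [simp]: "0 \<in> aug E" by (simp add: aug_iff)

lemma aug_add [intro, simp]: "p \<in> aug E \<Longrightarrow> q \<in> aug E \<Longrightarrow> p + q \<in> aug E"
  using keys_add[of p q] by (auto simp: aug_iff)

lemma aug_mult_left [intro]: "p \<in> uni_alg E \<Longrightarrow> q \<in> aug E \<Longrightarrow> p * q \<in> aug E"
  by (fastforce simp: uni_alg_def aug_iff dest!: keys_mult_letters)

lemma aug_mult_right [intro]: "p \<in> aug E \<Longrightarrow> q \<in> uni_alg E \<Longrightarrow> p * q \<in> aug E"
  by (fastforce simp: uni_alg_def aug_iff dest!: keys_mult_letters)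

lemma aug_mult [simp]: "p \<in> aug E \<Longrightarrow> q \<in> aug E \<Longrightarrow> p * q \<in> aug E"
  by (simp add: aug_mult_left)

lemma aug_uminus [intro, simp]: "p \<in> aug E \<Longrightarrow> - p \<in> aug E"
  by (simp add: aug_iff keys_uminus)

lemma aug_diff [intro, simp]: "p \<in> aug E \<Longrightarrow> q \<in> aug E \<Longrightarrow> p - q \<in> aug E"
  using aug_add[of p E "- q"] by auto

lemma aug_sum [intro, simp]: "(\<And>i. i \<in> A \<Longrightarrow> f i \<in> aug E) \<Longrightarrow> sum f A \<in> aug E"
  by (induction A rule: infinite_finite_induct) auto

lemma aug_scale [intro, simp]: "p \<in> aug E \<Longrightarrow> scale c p \<in> aug E"
  by (auto simp: scale_conv_const)

lemma gen_elem_aug: "g \<in> gens E \<Longrightarrow> gen_elem g \<in> aug E"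
  by (auto simp: gen_elem_def aug_iff)

lemma gens_iff [simp]: "Vertex v \<in> gens E \<longleftrightarrow> v \<in> verts E" "Edge e \<in> gens E \<longleftrightarrow> e \<in> arcs E"
  "Ghost e \<in> gens E \<longleftrightarrow> e \<in> arcs E"
  by (auto simp: gens_def)

lemma vert_aug [simp]: "v \<in> verts E \<Longrightarrow> vert v \<in> aug E"
  and edge_aug [simp]: "e \<in> arcs E \<Longrightarrow> edge e \<in> aug E"
  and ghost_aug [simp]: "e \<in> arcs E \<Longrightarrow> ghost e \<in> aug E"
  by (auto intro!: gen_elem_aug)

lemma vert_minus_aug [simp]: "v \<in> verts E \<Longrightarrow> F \<subseteq> arcs E \<Longrightarrow> vert_minus v F \<in> aug E"
  by (auto simp: vert_minus_def subset_iff)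

text \<open>
  Ideals of the unital free algebra that lie in the augmentation ideal.
\<close>

definition uideal :: "('v, 'e) pre_digraph \<Rightarrow> ('v, 'e, 'r::comm_ring_1) ncpoly set \<Rightarrow> bool" where
  "uideal E I \<longleftrightarrow> I \<subseteq> aug E \<and> 0 \<in> I \<and> (\<forall>x\<in>I. \<forall>y\<in>I. x + y \<in> I) \<and>
     (\<forall>x\<in>I. \<forall>a\<in>uni_alg E. a * x \<in> I \<and> x * a \<in> I)"

lemma uidealI:
  assumes "I \<subseteq> aug E" "0 \<in> I" "\<And>x y. x \<in> I \<Longrightarrow> y \<in> I \<Longrightarrow> x + y \<in> I"
    "\<And>x a. x \<in> I \<Longrightarrow> a \<in> uni_alg E \<Longrightarrow> a * x \<in> I"
    "\<And>x a. x \<in> I \<Longrightarrow> a \<in> uni_alg E \<Longrightarrow> x * a \<in> I"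
  shows "uideal E (I :: ('v, 'e, 'r::comm_ring_1) ncpoly set)"
  using assms by (auto simp: uideal_def)

context
  fixes E :: "('v, 'e) pre_digraph" and I :: "('v, 'e, 'r::comm_ring_1) ncpoly set"
  assumes I: "uideal E I"
begin

lemma uideal_aug: "x \<in> I \<Longrightarrow> x \<in> aug E" and uideal_0: "0 \<in> I"
  and uideal_add: "x \<in> I \<Longrightarrow> y \<in> I \<Longrightarrow> x + y \<in> I"
  and uideal_mult_left: "x \<in> I \<Longrightarrow> a \<in> uni_alg E \<Longrightarrow> a * x \<in> I"
  and uideal_mult_right: "x \<in> I \<Longrightarrow> a \<in> uni_alg E \<Longrightarrow> x * a \<in> I"
  using I by (auto simp: uideal_def)

lemma uideal_uminus: "x \<in> I \<Longrightarrow> - x \<in> I"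
  using uideal_mult_left[of x "const (- 1)"] by (simp add: const_simps)

lemma uideal_diff: "x \<in> I \<Longrightarrow> y \<in> I \<Longrightarrow> x - y \<in> I"
  using uideal_add[of x "- y"] uideal_uminus by auto

lemma uideal_sum: "(\<And>i. i \<in> A \<Longrightarrow> f i \<in> I) \<Longrightarrow> sum f A \<in> I"
  by (induction A rule: infinite_finite_induct) (auto simp: uideal_0 uideal_add)

lemma uideal_scale: "x \<in> I \<Longrightarrow> scale c x \<in> I"
  by (simp add: scale_conv_const uideal_mult_left)

lemma uideal_cong: "x - y \<in> I \<Longrightarrow> x \<in> I \<longleftrightarrow> y \<in> I"
  using uideal_add[of "x - y" y] uideal_diff[of x "x - y"] by auto

lemma uideal_cong_trans: "x - y \<in> I \<Longrightarrow> y - z \<in> I \<Longrightarrow> x - z \<in> I"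
  using uideal_add[of "x - y" "y - z"] by simp

lemma uideal_cong_sym: "x - y \<in> I \<Longrightarrow> y - x \<in> I"
  using uideal_uminus[of "x - y"] by simp

lemma uideal_cong_mult: "x - x' \<in> I \<Longrightarrow> y - y' \<in> I \<Longrightarrow> x' \<in> uni_alg E \<Longrightarrow> y \<in> uni_alg E
    \<Longrightarrow> x * y - x' * y' \<in> I"
  using uideal_add[of "(x - x') * y" "x' * (y - y')"]
    uideal_mult_left[of "y - y'" x'] uideal_mult_right[of "x - x'" y]
  by (simp add: algebra_simps)

end

definition ugen :: "('v, 'e) pre_digraph \<Rightarrow> ('v, 'e, 'r::comm_ring_1) ncpoly set
    \<Rightarrow> ('v, 'e, 'r) ncpoly set" where
  "ugen E X = \<Inter>{I. uideal E I \<and> X \<subseteq> I}"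

lemma uideal_aug_self: "uideal E (aug E)"
  by (auto intro!: uidealI)

lemma uideal_ugen:
  assumes "X \<subseteq> aug E"
  shows "uideal E (ugen E X)"
  unfolding ugen_def
  using assms uideal_aug_self[of E]
  by (intro uidealI)
    (auto simp: uideal_0 uideal_add uideal_mult_left uideal_mult_right uideal_aug)

lemma ugen_superset: "X \<subseteq> ugen E X" by (auto simp: ugen_def)

lemma ugen_subset: "uideal E I \<Longrightarrow> X \<subseteq> I \<Longrightarrow> ugen E X \<subseteq> I" by (auto simp: ugen_def)

section \<open>The grading\<close>

fun gdeg :: "('v, 'e) gen \<Rightarrow> int" where
  "gdeg (Vertex v) = 0" | "gdeg (Edge e) = 1" | "gdeg (Ghost e) = -1"

definition wdeg :: "('v, 'e) gword \<Rightarrow> int" where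
  "wdeg w = sum_list (map gdeg (letters w))"

lemma wdeg_plus [simp]: "wdeg (u + v) = wdeg u + wdeg v" by (simp add: wdeg_def)

definition hom_deg :: "int \<Rightarrow> ('v, 'e, 'r::comm_ring_1) ncpoly \<Rightarrow> bool" where
  "hom_deg k p \<longleftrightarrow> (\<forall>w\<in>Poly_Mapping.keys p. wdeg w = k)"

definition deg_le :: "int \<Rightarrow> ('v, 'e, 'r::comm_ring_1) ncpoly \<Rightarrow> bool" where
  "deg_le k p \<longleftrightarrow> (\<forall>w\<in>Poly_Mapping.keys p. wdeg w \<le> k)"

definition hpart :: "int \<Rightarrow> ('v, 'e, 'r::comm_ring_1) ncpoly \<Rightarrow> ('v, 'e, 'r) ncpoly" where
  "hpart k p = Poly_Mapping.mapp (\<lambda>w c. c when wdeg w = k) p"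

lemma lookup_hpart: "Poly_Mapping.lookup (hpart k p) w = (Poly_Mapping.lookup p w when wdeg w = k)"
  by (simp add: hpart_def lookup_mapp when_def in_keys_iff)

lemma hpart_0 [simp]: "hpart k 0 = 0"
  and hpart_add: "hpart k (p + q) = hpart k p + hpart k q"
  and hpart_diff: "hpart k (p - q) = hpart k p - hpart k q"
  and hpart_single: "hpart k (Poly_Mapping.single w c) = (if wdeg w = k then Poly_Mapping.single w c else 0)"
  by (auto intro!: poly_mapping_eqI simp: lookup_hpart lookup_add lookup_minus lookup_single when_def)

lemma hpart_sum: "hpart k (sum f A) = (\<Sum>i\<in>A. hpart k (f i))"
  by (induction A rule: infinite_finite_induct) (auto simp: hpart_add)

lemma keys_hpart: "Poly_Mapping.keys (hpart k p) = {w \<in> Poly_Mapping.keys p. wdeg w = k}"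
  by (auto simp: in_keys_iff lookup_hpart)

lemma hom_deg_hpart [simp]: "hom_deg k (hpart k p)"
  by (auto simp: hom_deg_def keys_hpart)

lemma hpart_hom_deg: "hom_deg k p \<Longrightarrow> hpart j p = (if j = k then p else 0)"
  by (auto intro!: poly_mapping_eqI simp: lookup_hpart hom_deg_def when_def in_keys_iff)

lemma hpart_aug [simp]: "p \<in> aug E \<Longrightarrow> hpart k p \<in> aug E"
  by (auto simp: aug_iff keys_hpart)

lemma sum_hpart:
  assumes "finite A" "wdeg ` Poly_Mapping.keys p \<subseteq> A"
  shows "(\<Sum>k\<in>A. hpart k p) = p"
  using assms by (intro poly_mapping_eqI)
    (force simp: lookup_sum lookup_hpart when_def in_keys_iff)

lemma hom_deg_add: "hom_deg k p \<Longrightarrow> hom_deg k q \<Longrightarrow> hom_deg k (p + q)"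
  and hom_deg_diff: "hom_deg k p \<Longrightarrow> hom_deg k q \<Longrightarrow> hom_deg k (p - q)"
  using keys_add[of p q] keys_diff[of p q] by (force simp: hom_deg_def)+

lemma hom_deg_0 [simp]: "hom_deg k 0"
  by (simp add: hom_deg_def)

lemma hom_deg_sum: "(\<And>i. i \<in> A \<Longrightarrow> hom_deg k (f i)) \<Longrightarrow> hom_deg k (sum f A)"
  by (induction A rule: infinite_finite_induct) (auto intro: hom_deg_add)

lemma hom_deg_mult: "hom_deg k p \<Longrightarrow> hom_deg j q \<Longrightarrow> hom_deg (k + j) (p * q)"
  by (auto simp: hom_deg_def dest!: keys_mult_letters)

lemma hom_deg_gens [simp]: "hom_deg 0 (vert v)" "hom_deg 1 (edge e)" "hom_deg (-1) (ghost e)"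
  "hom_deg 0 (const c)"
  by (auto simp: hom_deg_def gen_elem_def wdeg_def const_def)

lemma hpart_mult_single:
  "hpart k (Poly_Mapping.single w c * p) = Poly_Mapping.single w c * hpart (k - wdeg w) p"
proof (induction p rule: poly_mapping_additive_induct)
  case (add p v d)
  then show ?case by (auto simp: distrib_left hpart_add mult_single hpart_single)
qed auto

lemma hpart_single_mult:
  "hpart k (p * Poly_Mapping.single w c) = hpart (k - wdeg w) p * Poly_Mapping.single w c"
proof (induction p rule: poly_mapping_additive_induct)
  case (add p v d)
  then show ?case by (auto simp: distrib_right hpart_add mult_single hpart_single)
qed auto

text \<open>
  The top component of a product is the product of the top components; this is how the ordering
  of the integers enters the proof that primeness can be tested on homogeneous elements.
\<close>

lemma hpart_mult_top:
  assumes "deg_le m p" "deg_le n q"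
  shows "hpart (m + n) (p * q) = hpart m p * hpart n q"
proof -
  have *: "hpart (m + n) (Poly_Mapping.single w c * q) = hpart m (Poly_Mapping.single w c) * hpart n q"
    if "wdeg w \<le> m" for w c
  proof (cases "wdeg w = m")
    case False
    then have "hpart (m + n - wdeg w) q = 0"
      using assms(2) that by (intro poly_mapping_eqI) (force simp: lookup_hpart when_def deg_le_def in_keys_iff)
    then show ?thesis using False by (simp add: hpart_mult_single hpart_single)
  qed (simp add: hpart_mult_single hpart_single)
  have "Poly_Mapping.keys p \<subseteq> {w. wdeg w \<le> m}"
    using assms(1) by (auto simp: deg_le_def)
  then show ?thesis
  proof (induction p rule: poly_mapping_add_induct)
    case (add p w c)
    then show ?case by (simp add: distrib_right hpart_add *)
  qed auto
qed

lemma single_uni_alg: "set (letters w) \<subseteq> gens E \<Longrightarrow> Poly_Mapping.single w c \<in> uni_alg E"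
  by (simp add: uni_alg_def)

text \<open>
  For ideals this is homogeneity, formulated without direct sums.
\<close>

definition hpart_closed :: "('v, 'e, 'r::comm_ring_1) ncpoly set \<Rightarrow> bool" where
  "hpart_closed I \<longleftrightarrow> (\<forall>p\<in>I. \<forall>k. hpart k p \<in> I)"

text \<open>
  Those elements of the generated ideal all of whose homogeneous parts belong to it form an ideal,
  because a product with a single word shifts the degree.
\<close>

lemma hpart_closed_ugen:
  assumes X: "X \<subseteq> aug E" and hom: "\<And>x. x \<in> X \<Longrightarrow> \<exists>k. hom_deg k x"
  shows "hpart_closed (ugen E X)"
proof -
  let ?I = "ugen E X"
  let ?K = "{x \<in> ?I. \<forall>k. hpart k x \<in> ?I}"
  note I = uideal_ugen[OF X]
  have "uideal E ?K"
  proof (rule uidealI)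
    fix x a :: "('a, 'b, 'c) ncpoly" assume x: "x \<in> ?K" and a: "a \<in> uni_alg E"
    have "Poly_Mapping.keys a \<subseteq> {w. set (letters w) \<subseteq> gens E}"
      using a by (auto simp: uni_alg_def)
    then have "hpart k (a * x) \<in> ?I \<and> hpart k (x * a) \<in> ?I" for k
    proof (induction a rule: poly_mapping_add_induct)
      case (add p w c)
      then show ?case using x
        by (auto simp: distrib_left distrib_right hpart_add hpart_mult_single hpart_single_mult
            intro!: uideal_add[OF I] intro: uideal_mult_left[OF I] uideal_mult_right[OF I] single_uni_alg)
    qed (auto simp: uideal_0[OF I])
    then show "a * x \<in> ?K" "x * a \<in> ?K"
      using x a by (auto intro: uideal_mult_left[OF I] uideal_mult_right[OF I])
  qed (auto simp: hpart_add uideal_0[OF I] uideal_aug[OF I] intro: uideal_add[OF I])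
  moreover have "X \<subseteq> ?K"
    using hom ugen_superset[of X E] by (fastforce simp: hpart_hom_deg uideal_0[OF I])
  ultimately have "?I \<subseteq> ?K" by (rule ugen_subset)
  then show ?thesis by (auto simp: hpart_closed_def)
qed

section \<open>Ideals of the Leavitt path algebra as ideals of polynomials\<close>

lemma free_alg_sel [simp]:
  "mult (free_alg E) = (*)" "zero (free_alg E) = 0" "add (free_alg E) = (+)"
  by (simp_all add: free_alg_def)

lemma abelian_group_free_alg: "abelian_group (free_alg E :: ('r::comm_ring_1, ('v, 'e, 'r) ncpoly) module)"
proof (rule abelian_groupI)
  fix x :: "('v, 'e, 'r) ncpoly" assume "x \<in> aug E"
  then show "\<exists>y\<in>aug E. y \<oplus>\<^bsub>free_alg E\<^esub> x = \<zero>\<^bsub>free_alg E\<^esub>"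
    by (intro bexI[of _ "- x"]) auto
qed (auto simp: algebra_simps)

lemma a_inv_free_alg: "x \<in> aug E \<Longrightarrow> \<ominus>\<^bsub>free_alg E\<^esub> x = - x"
  by (rule abelian_group.minus_equality[OF abelian_group_free_alg]) auto

lemma additive_subgroup_iff:
  "additive_subgroup I A \<longleftrightarrow> I \<subseteq> carrier A \<and> \<zero>\<^bsub>A\<^esub> \<in> I \<and> (\<forall>x\<in>I. \<forall>y\<in>I. x \<oplus>\<^bsub>A\<^esub> y \<in> I) \<and>
     (\<forall>x\<in>I. \<ominus>\<^bsub>A\<^esub> x \<in> I)"
  by (auto simp: additive_subgroup_def subgroup_def a_inv_def)

text \<open>
  A polynomial in the unital algebra differs by a constant from one in the augmentation ideal, so
  closure under scalars is all that an ideal of \<open>free_alg E\<close> lacks.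
\<close>

lemma uideal_iff_rng_ideal:
  "uideal E I \<longleftrightarrow> rng_ideal I (free_alg E) \<and> (\<forall>c. \<forall>x\<in>I. scale c x \<in> I)"
proof
  assume I: "uideal E I"
  show "rng_ideal I (free_alg E) \<and> (\<forall>c. \<forall>x\<in>I. scale c x \<in> I)"
    using uideal_aug[OF I]
    by (auto simp: rng_ideal_def additive_subgroup_iff a_inv_free_alg uideal_0[OF I] uideal_scale[OF I]
        intro: uideal_add[OF I] uideal_uminus[OF I] uideal_mult_left[OF I] uideal_mult_right[OF I])
next
  assume I: "rng_ideal I (free_alg E) \<and> (\<forall>c. \<forall>x\<in>I. scale c x \<in> I)"
  then have add: "x + y \<in> I" if "x \<in> I" "y \<in> I" for x y
    using that by (auto simp: rng_ideal_def additive_subgroup_iff)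
  have 0: "0 \<in> I" and aug: "I \<subseteq> aug E" and mult: "x \<in> I \<Longrightarrow> a \<in> aug E \<Longrightarrow> a * x \<in> I \<and> x * a \<in> I"
    and scale: "x \<in> I \<Longrightarrow> const c * x \<in> I" for x a c
    using I by (auto simp: rng_ideal_def additive_subgroup_iff scale_conv_const)
  have "a * x \<in> I \<and> x * a \<in> I" if x: "x \<in> I" and a: "a \<in> uni_alg E" for x a
  proof -
    have "Poly_Mapping.keys a \<subseteq> {w. set (letters w) \<subseteq> gens E}"
      using a by (auto simp: uni_alg_def)
    then show ?thesis
    proof (induction a rule: poly_mapping_add_induct)
      case (add p w c)
      have "Poly_Mapping.single w c * x \<in> I \<and> x * Poly_Mapping.single w c \<in> I"
      proof (cases "letters w = []")
        case True
        then have "w = 0" by (cases w) (simp add: zero_gword_def)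
        then have "Poly_Mapping.single w c = const c" by (simp add: const_def)
        then show ?thesis using scale[OF x] by (metis const_commute)
      next
        case False
        then have "Poly_Mapping.single w c \<in> aug E" using add by (auto simp: aug_iff)
        then show ?thesis using mult[OF x] by auto
      qed
      then show ?case
        using add by (auto simp: distrib_left distrib_right intro: \<open>\<And>x y. x \<in> I \<Longrightarrow> y \<in> I \<Longrightarrow> x + y \<in> I\<close>)
    qed (auto simp: 0)
  qed
  then show "uideal E I" using 0 aug add by (auto intro!: uidealI)
qed

lemma rel_ideal_eq_ugen: "rel_ideal E = ugen E (relators E)"
  unfolding rel_ideal_def ugen_def by (auto simp: uideal_iff_rng_ideal)

text \<open>
  The parameter \<open>R\<close> fixes the coefficient ring, so that all polynomials that are compared in the
  locale have coefficients in the same ring.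
\<close>

locale leavitt = wf_digraph E for E :: "('v, 'e) pre_digraph" +
  fixes R :: "'r::comm_ring_1 itself"
begin

lemma relators_aug: "relators E \<subseteq> aug E"
  by (auto simp: relators_def regular_vertex_def intro!: vert_minus_aug)

lemma uideal_rel: "uideal E (rel_ideal E)"
  by (simp add: rel_ideal_eq_ugen uideal_ugen relators_aug)

lemma relators_rel: "x \<in> relators E \<Longrightarrow> x \<in> rel_ideal E"
  using ugen_superset by (auto simp: rel_ideal_eq_ugen)

lemma mem_lpa_cls: "y \<in> lpa_cls E p \<longleftrightarrow> y - p \<in> rel_ideal E"
  by (auto simp: lpa_cls_def a_r_coset_def r_coset_def intro: bexI[of _ "y - p"])

lemma lpa_cls_self: "p \<in> lpa_cls E p"
  by (simp add: mem_lpa_cls uideal_0[OF uideal_rel])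

lemma lpa_cls_eq_iff: "lpa_cls E p = lpa_cls E q \<longleftrightarrow> p - q \<in> rel_ideal E"
proof
  assume "lpa_cls E p = lpa_cls E q"
  moreover have "p \<in> lpa_cls E p" by (simp add: mem_lpa_cls uideal_0[OF uideal_rel])
  ultimately show "p - q \<in> rel_ideal E" by (simp add: mem_lpa_cls)
next
  assume pq: "p - q \<in> rel_ideal E"
  then show "lpa_cls E p = lpa_cls E q"
    using uideal_cong_trans[OF uideal_rel _ pq] uideal_cong_trans[OF uideal_rel _ uideal_cong_sym[OF uideal_rel pq]]
    by (auto simp: mem_lpa_cls)
qed

lemma carrier_lpa: "carrier (lpa E) = lpa_cls E ` aug E"
  by (auto simp: lpa_def ring.defs FactRing_def A_RCOSETS_def RCOSETS_def lpa_cls_def a_r_coset_def)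

lemma lpa_cls_carrier [simp]: "p \<in> aug E \<Longrightarrow> lpa_cls E p \<in> carrier (lpa E)"
  by (simp add: carrier_lpa)

lemma zero_lpa: "zero (lpa E) = lpa_cls E 0"
  by (auto simp: lpa_def ring.defs FactRing_def mem_lpa_cls)

lemma add_lpa [simp]: "lpa_cls E p \<oplus>\<^bsub>lpa E\<^esub> lpa_cls E q = lpa_cls E (p + q)"
proof -
  have "lpa_cls E p \<oplus>\<^bsub>lpa E\<^esub> lpa_cls E q = (\<Union>x\<in>lpa_cls E p. \<Union>y\<in>lpa_cls E q. {x + y})"
    by (simp add: lpa_def ring.defs FactRing_def set_add_def set_mult_def)
  also have "\<dots> = lpa_cls E (p + q)"
  proof (rule Set.set_eqI)
    fix z show "z \<in> (\<Union>x\<in>lpa_cls E p. \<Union>y\<in>lpa_cls E q. {x + y}) \<longleftrightarrow> z \<in> lpa_cls E (p + q)"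
    proof
      assume "z \<in> (\<Union>x\<in>lpa_cls E p. \<Union>y\<in>lpa_cls E q. {x + y})"
      then obtain x y where "x - p \<in> rel_ideal E" "y - q \<in> rel_ideal E" "z = x + y"
        by (auto simp: mem_lpa_cls)
      then show "z \<in> lpa_cls E (p + q)"
        using uideal_add[OF uideal_rel, of "x - p" "y - q"] by (simp add: mem_lpa_cls algebra_simps)
    next
      assume "z \<in> lpa_cls E (p + q)"
      then have "z - q \<in> lpa_cls E p" "q \<in> lpa_cls E q"
        by (simp_all add: mem_lpa_cls algebra_simps uideal_0[OF uideal_rel])
      then show "z \<in> (\<Union>x\<in>lpa_cls E p. \<Union>y\<in>lpa_cls E q. {x + y})"
        by (intro UN_I[of "z - q"] UN_I[of q]) auto
    qed
  qed
  finally show ?thesis .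
qed

lemma mult_lpa [simp]:
  assumes "p \<in> aug E" "q \<in> aug E"
  shows "lpa_cls E p \<otimes>\<^bsub>lpa E\<^esub> lpa_cls E q = lpa_cls E (p * q)"
proof -
  have "lpa_cls E p \<otimes>\<^bsub>lpa E\<^esub> lpa_cls E q = (\<Union>x\<in>lpa_cls E p. \<Union>y\<in>lpa_cls E q. lpa_cls E (x * y))"
    by (simp add: lpa_def ring.defs FactRing_def rcoset_mult_def lpa_cls_def)
  also have "\<dots> = (\<Union>x\<in>lpa_cls E p. \<Union>y\<in>lpa_cls E q. lpa_cls E (p * q))"
  proof (intro SUP_cong refl)
    fix x y assume "x \<in> lpa_cls E p" "y \<in> lpa_cls E q"
    then have xy: "x - p \<in> rel_ideal E" "y - q \<in> rel_ideal E" by (auto simp: mem_lpa_cls)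
    then have "y \<in> aug E" using assms uideal_aug[OF uideal_rel] aug_add[of "y - q" E q] by auto
    then show "lpa_cls E (x * y) = lpa_cls E (p * q)"
      unfolding lpa_cls_eq_iff using xy assms by (auto intro: uideal_cong_mult[OF uideal_rel])
  qed
  also have "\<dots> = lpa_cls E (p * q)"
    using lpa_cls_self[of p] lpa_cls_self[of q] by auto
  finally show ?thesis .
qed

lemma smult_lpa [simp]:
  "c \<odot>\<^bsub>lpa E\<^esub> lpa_cls E p = lpa_cls E (scale c p)"
proof -
  have "c \<odot>\<^bsub>lpa E\<^esub> lpa_cls E p = (\<Union>x\<in>lpa_cls E p. lpa_cls E (scale c x))"
    by (simp add: lpa_def ring.defs)
  also have "\<dots> = (\<Union>x\<in>lpa_cls E p. lpa_cls E (scale c p))"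
  proof (intro SUP_cong refl)
    fix x assume "x \<in> lpa_cls E p"
    then show "lpa_cls E (scale c x) = lpa_cls E (scale c p)"
      using uideal_scale[OF uideal_rel, of "x - p" c]
      by (simp add: mem_lpa_cls lpa_cls_eq_iff scale_conv_const algebra_simps)
  qed
  also have "\<dots> = lpa_cls E (scale c p)"
    using lpa_cls_self[of p] by auto
  finally show ?thesis .
qed

lemma abelian_group_lpa: "abelian_group (lpa E :: ('r::comm_ring_1, ('v, 'e, 'r) lpa_elem) module)"
proof (rule abelian_groupI)
  fix X :: "('v, 'e, 'r) lpa_elem" assume "X \<in> carrier (lpa E)"
  then obtain x where "x \<in> aug E" "X = lpa_cls E x" by (auto simp: carrier_lpa)
  then show "\<exists>Y\<in>carrier (lpa E). Y \<oplus>\<^bsub>lpa E\<^esub> X = \<zero>\<^bsub>lpa E\<^esub>"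
    by (intro bexI[of _ "lpa_cls E (- x)"]) (auto simp: zero_lpa)
qed (auto simp: carrier_lpa zero_lpa algebra_simps)

lemma a_inv_lpa: "(x :: ('v, 'e, 'r) ncpoly) \<in> aug E \<Longrightarrow> \<ominus>\<^bsub>lpa E\<^esub> lpa_cls E x = lpa_cls E (- x)"
  by (rule abelian_group.minus_equality[OF abelian_group_lpa]) (auto simp: zero_lpa)

lemma finsum_lpa:
  fixes q :: "'k \<Rightarrow> ('v, 'e, 'r::comm_ring_1) ncpoly"
  assumes "\<And>k. k \<in> A \<Longrightarrow> q k \<in> aug E" "finite A"
  shows "(\<Oplus>\<^bsub>lpa E\<^esub>k\<in>A. lpa_cls E (q k)) = lpa_cls E (\<Sum>k\<in>A. q k)"
proof -
  interpret abelian_group "lpa E :: ('r, ('v, 'e, 'r) lpa_elem) module"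
    by (rule abelian_group_lpa)
  show ?thesis using assms(2,1)
    by (induction A rule: finite_induct) (auto simp: zero_lpa)
qed

definition lift_ideal :: "('v, 'e, 'r::comm_ring_1) lpa_elem set \<Rightarrow> ('v, 'e, 'r) ncpoly set" where
  "lift_ideal I = {p \<in> aug E. lpa_cls E p \<in> I}"

definition full_ideal :: "('v, 'e, 'r::comm_ring_1) ncpoly set \<Rightarrow> bool" where
  "full_ideal J \<longleftrightarrow> uideal E J \<and> rel_ideal E \<subseteq> J"

lemma full_idealD: "full_ideal J \<Longrightarrow> uideal E J" "full_ideal J \<Longrightarrow> x \<in> rel_ideal E \<Longrightarrow> x \<in> J"
  by (auto simp: full_ideal_def)

fun gsrc :: "('v, 'e) gen \<Rightarrow> 'v" where
  "gsrc (Vertex v) = v" | "gsrc (Edge e) = tail E e" | "gsrc (Ghost e) = head E e"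

lemma gsrc_verts: "g \<in> gens E \<Longrightarrow> gsrc g \<in> verts E"
  by (cases g) auto

lemma vert_mult_rel:
  "v \<in> verts E \<Longrightarrow> w \<in> verts E \<Longrightarrow> vert v * vert w - (if v = w then vert v else 0) \<in> rel_ideal E"
  and tail_edge_rel: "e \<in> arcs E \<Longrightarrow> vert (tail E e) * edge e - edge e \<in> rel_ideal E"
  and edge_head_rel: "e \<in> arcs E \<Longrightarrow> edge e * vert (head E e) - edge e \<in> rel_ideal E"
  and head_ghost_rel: "e \<in> arcs E \<Longrightarrow> vert (head E e) * ghost e - ghost e \<in> rel_ideal E"
  and ghost_tail_rel: "e \<in> arcs E \<Longrightarrow> ghost e * vert (tail E e) - ghost e \<in> rel_ideal E"
  and ghost_edge_rel: "e \<in> arcs E \<Longrightarrow> f \<in> arcs E \<Longrightarrow>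
    ghost e * edge f - (if e = f then vert (head E e) else 0) \<in> rel_ideal E"
  and regular_rel: "regular_vertex E v \<Longrightarrow> vert_minus v (out_arcs E v) \<in> rel_ideal E"
  by (rule relators_rel, unfold relators_def, blast)+

lemma vert_gen_rel:
  assumes "g \<in> gens E" "v \<in> verts E"
  shows "vert v * gen_elem g - (if v = gsrc g then gen_elem g else 0) \<in> rel_ideal E"
proof -
  note R = uideal_rel
  have src: "vert (gsrc g) * gen_elem g - gen_elem g \<in> rel_ideal E"
    using assms(1) vert_mult_rel[of "gsrc g" "gsrc g"] tail_edge_rel head_ghost_rel
    by (cases g) auto
  show ?thesis
  proof (cases "v = gsrc g")
    case False
    have "vert v * (vert (gsrc g) * gen_elem g - gen_elem g) \<in> rel_ideal E"
      using src assms by (intro uideal_mult_left[OF R]) auto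
    moreover have "(vert v * vert (gsrc g) - 0) * gen_elem g \<in> rel_ideal E"
      using vert_mult_rel[of v "gsrc g"] False assms gsrc_verts
      by (intro uideal_mult_right[OF R]) (auto intro: gen_elem_aug)
    ultimately show ?thesis
      using False uideal_diff[OF R, of "vert v * vert (gsrc g) * gen_elem g"
          "vert v * (vert (gsrc g) * gen_elem g - gen_elem g)"]
      by (simp add: algebra_simps)
  qed (use src in simp)
qed

lemma single_Cons:
  "Poly_Mapping.single (GWord (g # w)) c = gen_elem g * Poly_Mapping.single (GWord w) c"
  by (simp add: gen_elem_def mult_single plus_gword_def)

text \<open>
  The sum of the sources of all first letters of \<open>p\<close> acts as a left unit on \<open>p\<close>.  Through it the ideals
  of the ring \<open>lpa E\<close> are closed under scalars.
\<close>

lemma local_unit: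
  fixes p :: "('v, 'e, 'r::comm_ring_1) ncpoly"
  assumes "p \<in> aug E"
  shows "\<exists>u\<in>aug E. u * p - p \<in> rel_ideal E"
proof -
  note R = uideal_rel
  define V where "V = (\<lambda>w. gsrc (hd (letters w))) ` Poly_Mapping.keys p"
  have V: "finite V" by (simp add: V_def)
  have VE: "V \<subseteq> verts E"
    using assms by (force simp: V_def aug_iff intro!: gsrc_verts)
  define u :: "('v, 'e, 'r) ncpoly" where "u = (\<Sum>v\<in>V. vert v)"
  have u: "u \<in> aug E" unfolding u_def using VE by (intro aug_sum) auto
  have *: "u * Poly_Mapping.single w c - Poly_Mapping.single w c \<in> rel_ideal E"
    if w: "letters w \<noteq> []" "set (letters w) \<subseteq> gens E" "gsrc (hd (letters w)) \<in> V" for w c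
  proof -
    obtain g w' where gw: "w = GWord (g # w')"
      using w(1) by (cases w; cases "letters w") auto
    let ?t = "Poly_Mapping.single (GWord w') c"
    have g: "g \<in> gens E" "gsrc g \<in> V" using w gw by auto
    have t: "?t \<in> uni_alg E" using w gw by (auto intro!: single_uni_alg)
    have "(\<Sum>v\<in>V. (vert v * gen_elem g - (if v = gsrc g then gen_elem g else 0)) * ?t) \<in> rel_ideal E"
      using VE g t by (intro uideal_sum[OF R] uideal_mult_right[OF R] vert_gen_rel) auto
    also have "(\<Sum>v\<in>V. (vert v * gen_elem g - (if v = gsrc g then gen_elem g else 0)) * ?t) =
        u * Poly_Mapping.single w c - Poly_Mapping.single w c"
      using g V by (simp add: gw single_Cons u_def sum_distrib_right sum_subtractf left_diff_distrib
          mult.assoc if_distribR if_distrib[of "\<lambda>x. x * _"] sum.delta cong: if_cong)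
    finally show ?thesis .
  qed
  have "Poly_Mapping.keys p \<subseteq> {w. letters w \<noteq> [] \<and> set (letters w) \<subseteq> gens E \<and> gsrc (hd (letters w)) \<in> V}"
    using assms by (auto simp: aug_iff V_def)
  then have "u * p - p \<in> rel_ideal E"
  proof (induction p rule: poly_mapping_add_induct)
    case (add p w c)
    then have "(u * p - p) + (u * Poly_Mapping.single w c - Poly_Mapping.single w c) \<in> rel_ideal E"
      using * by (intro uideal_add[OF R]) auto
    then show ?case by (simp add: algebra_simps)
  qed (auto simp: uideal_0[OF R])
  then show ?thesis using u by blast
qed

lemma rng_ideal_closed:
  assumes I: "rng_ideal I (lpa E)"
  shows "lpa_cls E 0 \<in> I" "X \<in> I \<Longrightarrow> Y \<in> I \<Longrightarrow> X \<oplus>\<^bsub>lpa E\<^esub> Y \<in> I" "X \<in> I \<Longrightarrow> X \<in> carrier (lpa E)"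
    "X \<in> I \<Longrightarrow> A \<in> carrier (lpa E) \<Longrightarrow> A \<otimes>\<^bsub>lpa E\<^esub> X \<in> I"
    "X \<in> I \<Longrightarrow> A \<in> carrier (lpa E) \<Longrightarrow> X \<otimes>\<^bsub>lpa E\<^esub> A \<in> I"
    "X \<in> I \<Longrightarrow> \<ominus>\<^bsub>lpa E\<^esub> X \<in> I"
  using I by (auto simp: rng_ideal_def additive_subgroup_iff zero_lpa)

text \<open>
  Closure under scalars comes from local units: \<open>c p\<close> is congruent to \<open>(c u) p\<close> for a local unit \<open>u\<close> of \<open>p\<close>.
\<close>

lemma full_lift_ideal:
  fixes I :: "('v, 'e, 'r::comm_ring_1) lpa_elem set"
  assumes I: "rng_ideal I (lpa E)"
  shows "full_ideal (lift_ideal I)"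
proof -
  note R = uideal_rel
  have rel: "rel_ideal E \<subseteq> lift_ideal I"
  proof
    fix x :: "('v, 'e, 'r) ncpoly" assume x: "x \<in> rel_ideal E"
    then have "lpa_cls E x = lpa_cls E 0" by (simp add: lpa_cls_eq_iff)
    then show "x \<in> lift_ideal I" using rng_ideal_closed(1)[OF I] x uideal_aug[OF R]
      by (auto simp: lift_ideal_def)
  qed
  have mult: "a * x \<in> lift_ideal I \<and> x * a \<in> lift_ideal I" if "x \<in> lift_ideal I" "a \<in> aug E" for a x
    using that rng_ideal_closed(4,5)[OF I, of "lpa_cls E x" "lpa_cls E a"] by (auto simp: lift_ideal_def)
  have add: "x + y \<in> lift_ideal I" if "x \<in> lift_ideal I" "y \<in> lift_ideal I" for x y
    using that rng_ideal_closed(2)[OF I, of "lpa_cls E x" "lpa_cls E y"] by (auto simp: lift_ideal_def)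
  have min: "- x \<in> lift_ideal I" if "x \<in> lift_ideal I" for x
    using that rng_ideal_closed(6)[OF I, of "lpa_cls E x"] by (auto simp: lift_ideal_def a_inv_lpa)
  have "scale c x \<in> lift_ideal I" if x: "x \<in> lift_ideal I" for c x
  proof -
    have "x \<in> aug E" using x by (simp add: lift_ideal_def)
    then obtain u where u: "u \<in> aug E" "u * x - x \<in> rel_ideal E" using local_unit by blast
    have "scale c u * x - scale c (u * x - x) \<in> lift_ideal I"
      using mult[OF x, of "scale c u"] u(1) uideal_scale[OF R u(2), of c] rel
        add[of "scale c u * x" "- scale c (u * x - x)"] min[of "scale c (u * x - x)"]
      by auto
    then show ?thesis by (simp add: scale_conv_const algebra_simps)
  qed
  moreover have "rng_ideal (lift_ideal I) (free_alg E)"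
    using rel uideal_0[OF R] mult add min
    by (auto simp: rng_ideal_def additive_subgroup_iff a_inv_free_alg) (auto simp: lift_ideal_def a_inv_free_alg)
  ultimately show ?thesis using rel by (simp add: full_ideal_def uideal_iff_rng_ideal)
qed

lemma image_lift_ideal: "rng_ideal I (lpa E) \<Longrightarrow> lpa_cls E ` lift_ideal I = I"
  using rng_ideal_closed(3)[of I] by (auto simp: lift_ideal_def carrier_lpa)

lemma lift_ideal_image: 
  assumes J: "full_ideal J"
  shows "lift_ideal (lpa_cls E ` J) = J"
proof -
  note J' = full_idealD(1)[OF J]
  show ?thesis
  proof
    show "lift_ideal (lpa_cls E ` J) \<subseteq> J"
      using uideal_cong[OF J'] full_idealD(2)[OF J] unfolding lift_ideal_def lpa_cls_eq_iff image_iff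
      by blast
    show "J \<subseteq> lift_ideal (lpa_cls E ` J)"
      using uideal_aug[OF J'] by (auto simp: lift_ideal_def)
  qed
qed

lemma rng_ideal_image:
  fixes J :: "('v, 'e, 'r::comm_ring_1) ncpoly set"
  assumes J: "full_ideal J"
  shows "rng_ideal (lpa_cls E ` J) (lpa E)"
proof -
  note J' = full_idealD(1)[OF J]
  show ?thesis
    unfolding rng_ideal_def additive_subgroup_iff carrier_lpa zero_lpa ball_simps
  proof (intro conjI ballI)
    fix x a :: "('v, 'e, 'r) ncpoly" assume x: "x \<in> J"
    then show "\<ominus>\<^bsub>lpa E\<^esub> lpa_cls E x \<in> lpa_cls E ` J"
      by (simp add: a_inv_lpa uideal_aug[OF J'] uideal_uminus[OF J'])
    assume a: "a \<in> aug E"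
    show "lpa_cls E a \<otimes>\<^bsub>lpa E\<^esub> lpa_cls E x \<in> lpa_cls E ` J"
      "lpa_cls E x \<otimes>\<^bsub>lpa E\<^esub> lpa_cls E a \<in> lpa_cls E ` J"
      using x a by (simp_all add: uideal_aug[OF J'] uideal_mult_left[OF J'] uideal_mult_right[OF J'])
  qed (use uideal_aug[OF J'] uideal_0[OF J'] uideal_add[OF J'] in auto)
qed

lemma lift_ideal_mono_iff:
  assumes "rng_ideal I (lpa E)" "rng_ideal J (lpa E)"
  shows "lift_ideal I \<subseteq> lift_ideal J \<longleftrightarrow> I \<subseteq> J"
proof
  assume "lift_ideal I \<subseteq> lift_ideal J"
  then have "lpa_cls E ` lift_ideal I \<subseteq> lpa_cls E ` lift_ideal J" by blast
  then show "I \<subseteq> J" by (simp add: image_lift_ideal assms)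
qed (auto simp: lift_ideal_def)

lemma lift_rng_genideal:
  assumes X: "X \<subseteq> aug E"
  shows "rng_ideal (rng_genideal (lpa E) (lpa_cls E ` X)) (lpa E)"
    and "lift_ideal (rng_genideal (lpa E) (lpa_cls E ` X)) = ugen E (relators E \<union> X)"
proof -
  let ?J = "ugen E (relators E \<union> X)"
  have J: "full_ideal ?J"
    using X relators_aug uideal_ugen[of "relators E \<union> X" E]
    by (auto simp: full_ideal_def rel_ideal_eq_ugen) (auto simp: ugen_def)
  have "rng_genideal (lpa E) (lpa_cls E ` X) = lpa_cls E ` ?J"
  proof
    show "rng_genideal (lpa E) (lpa_cls E ` X) \<subseteq> lpa_cls E ` ?J"
      unfolding rng_genideal_def using rng_ideal_image[OF J] ugen_superset[of "relators E \<union> X" E]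
      by (intro Inter_lower) auto
    show "lpa_cls E ` ?J \<subseteq> rng_genideal (lpa E) (lpa_cls E ` X)"
      unfolding rng_genideal_def
    proof (rule Inter_greatest)
      fix I assume "I \<in> {I. rng_ideal I (lpa E) \<and> lpa_cls E ` X \<subseteq> I}"
      then have I: "rng_ideal I (lpa E)" and XI: "lpa_cls E ` X \<subseteq> I" by auto
      have "relators E \<subseteq> lift_ideal I"
        using full_lift_ideal[OF I] relators_rel unfolding full_ideal_def by blast
      then have "?J \<subseteq> lift_ideal I"
        using full_lift_ideal[OF I] XI X
        by (intro ugen_subset) (auto simp: full_ideal_def, auto simp: lift_ideal_def)
      then show "lpa_cls E ` ?J \<subseteq> I" by (auto simp: lift_ideal_def)
    qed
  qed
  then show "rng_ideal (rng_genideal (lpa E) (lpa_cls E ` X)) (lpa E)"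
    and "lift_ideal (rng_genideal (lpa E) (lpa_cls E ` X)) = ?J"
    using rng_ideal_image[OF J] lift_ideal_image[OF J] by auto
qed

text \<open>
  The product of two ideals is generated additively by products, so it is enough to test these.
\<close>

lemma rng_prime_ideal_iff:
  fixes I :: "('v, 'e, 'r::comm_ring_1) lpa_elem set"
  assumes I: "rng_ideal I (lpa E)"
  shows "rng_prime_ideal I (lpa E) \<longleftrightarrow> lift_ideal I \<noteq> aug E \<and>
     (\<forall>J1 J2. full_ideal J1 \<longrightarrow> full_ideal J2 \<longrightarrow> (\<forall>x\<in>J1. \<forall>y\<in>J2. x * y \<in> lift_ideal I) \<longrightarrow>
        J1 \<subseteq> lift_ideal I \<or> J2 \<subseteq> lift_ideal I)" (is "_ \<longleftrightarrow> ?R1 \<and> ?R2")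
proof -
  have 1: "I \<noteq> carrier (lpa E) \<longleftrightarrow> ?R1"
  proof
    assume "I \<noteq> carrier (lpa E)"
    then show ?R1 using image_lift_ideal[OF I] carrier_lpa by metis
  next
    assume R: ?R1
    then obtain p where p: "p \<in> aug E" "p \<notin> lift_ideal I" by (auto simp: lift_ideal_def)
    then have "lpa_cls E p \<notin> I" "lpa_cls E p \<in> carrier (lpa E)"
      by (simp_all add: lift_ideal_def)
    then show "I \<noteq> carrier (lpa E)" by blast
  qed
  have 2: "ideal_prod (lpa E) J1 J2 \<subseteq> I \<longleftrightarrow> (\<forall>x\<in>lift_ideal J1. \<forall>y\<in>lift_ideal J2. x * y \<in> lift_ideal I)"
    if J: "rng_ideal J1 (lpa E)" "rng_ideal J2 (lpa E)" for J1 J2 :: "('v, 'e, 'r) lpa_elem set"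
  proof
    assume *: "ideal_prod (lpa E) J1 J2 \<subseteq> I"
    show "\<forall>x\<in>lift_ideal J1. \<forall>y\<in>lift_ideal J2. x * y \<in> lift_ideal I"
    proof (intro ballI)
      fix x y assume "x \<in> lift_ideal J1" "y \<in> lift_ideal J2"
      then show "x * y \<in> lift_ideal I"
        using ideal_prod.prod[of "lpa_cls E x" J1 "lpa_cls E y" J2 "lpa E"] * by (auto simp: lift_ideal_def)
    qed
  next
    assume *: "\<forall>x\<in>lift_ideal J1. \<forall>y\<in>lift_ideal J2. x * y \<in> lift_ideal I"
    have "s \<in> I" if "s \<in> ideal_prod (lpa E) J1 J2" for s
        using that
    proof induction
      case (prod i j)
      then have "i \<in> lpa_cls E ` lift_ideal J1" "j \<in> lpa_cls E ` lift_ideal J2"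
        by (simp_all add: image_lift_ideal J)
      then obtain x y where "x \<in> lift_ideal J1" "y \<in> lift_ideal J2" "i = lpa_cls E x" "j = lpa_cls E y"
        by blast
      then show ?case using * by (auto simp: lift_ideal_def)
    qed (rule rng_ideal_closed(2)[OF I])
    then show "ideal_prod (lpa E) J1 J2 \<subseteq> I" by auto
  qed
  show ?thesis
  proof
    assume P: "rng_prime_ideal I (lpa E)"
    have ?R2
    proof (intro allI impI)
      fix J1 J2 :: "('v, 'e, 'r) ncpoly set"
      assume J: "full_ideal J1" "full_ideal J2" and *: "\<forall>x\<in>J1. \<forall>y\<in>J2. x * y \<in> lift_ideal I"
      have "ideal_prod (lpa E) (lpa_cls E ` J1) (lpa_cls E ` J2) \<subseteq> I"
        using * J by (subst 2) (auto intro: rng_ideal_image simp: lift_ideal_image)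
      then have "lpa_cls E ` J1 \<subseteq> I \<or> lpa_cls E ` J2 \<subseteq> I"
        using P J rng_ideal_image unfolding rng_prime_ideal_def by blast
      then show "J1 \<subseteq> lift_ideal I \<or> J2 \<subseteq> lift_ideal I"
        using uideal_aug[OF full_idealD(1)[OF J(1)]] uideal_aug[OF full_idealD(1)[OF J(2)]]
        by (auto simp: lift_ideal_def)
    qed
    then show "?R1 \<and> ?R2" using P 1 by (auto simp: rng_prime_ideal_def)
  next
    assume R: "?R1 \<and> ?R2"
    show "rng_prime_ideal I (lpa E)"
      unfolding rng_prime_ideal_def
    proof (intro conjI allI impI)
      fix J1 J2 assume J: "rng_ideal J1 (lpa E)" "rng_ideal J2 (lpa E)"
        and sub: "ideal_prod (lpa E) J1 J2 \<subseteq> I"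
      then have "lift_ideal J1 \<subseteq> lift_ideal I \<or> lift_ideal J2 \<subseteq> lift_ideal I"
        using R full_lift_ideal unfolding 2[OF J] by blast
      then show "J1 \<subseteq> I \<or> J2 \<subseteq> I" using lift_ideal_mono_iff J I by blast
    qed (use I 1 R in auto)
  qed
qed

end

section \<open>Spanning by monomials\<close>

context leavitt
begin

definition eqv :: "('v, 'e, 'r::comm_ring_1) ncpoly \<Rightarrow> ('v, 'e, 'r) ncpoly \<Rightarrow> bool"  (infix \<open>\<approx>\<close> 50)
  where "x \<approx> y \<longleftrightarrow> x - y \<in> rel_ideal E"

lemma eqv_refl [simp]: "x \<approx> x" and eqv_sym: "x \<approx> y \<Longrightarrow> y \<approx> x"
  and eqv_trans [trans]: "x \<approx> y \<Longrightarrow> y \<approx> z \<Longrightarrow> x \<approx> z"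
  and eqv_add: "x \<approx> y \<Longrightarrow> x' \<approx> y' \<Longrightarrow> x + x' \<approx> y + y'"
  and eqv_diff: "x \<approx> y \<Longrightarrow> x' \<approx> y' \<Longrightarrow> x - x' \<approx> y - y'"
  and eqv_mult_left: "x \<approx> y \<Longrightarrow> a \<in> uni_alg E \<Longrightarrow> a * x \<approx> a * y"
  and eqv_mult_right: "x \<approx> y \<Longrightarrow> a \<in> uni_alg E \<Longrightarrow> x * a \<approx> y * a"
  and eqv_0_iff: "x \<approx> 0 \<longleftrightarrow> x \<in> rel_ideal E"
proof -
  note R = uideal_rel
  show "x \<approx> x" "x \<approx> 0 \<longleftrightarrow> x \<in> rel_ideal E" by (simp_all add: eqv_def uideal_0[OF R])
  show "x \<approx> y \<Longrightarrow> y \<approx> x" unfolding eqv_def by (rule uideal_cong_sym[OF R])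
  show "x \<approx> y \<Longrightarrow> y \<approx> z \<Longrightarrow> x \<approx> z" unfolding eqv_def by (rule uideal_cong_trans[OF R])
  show "x \<approx> y \<Longrightarrow> x' \<approx> y' \<Longrightarrow> x + x' \<approx> y + y'"
    unfolding eqv_def add_diff_add by (rule uideal_add[OF R])
  show "x \<approx> y \<Longrightarrow> x' \<approx> y' \<Longrightarrow> x - x' \<approx> y - y'"
    using uideal_diff[OF R, of "x - y" "x' - y'"] by (simp add: eqv_def algebra_simps)
  show "x \<approx> y \<Longrightarrow> a \<in> uni_alg E \<Longrightarrow> a * x \<approx> a * y"
    unfolding eqv_def right_diff_distrib[symmetric] by (rule uideal_mult_left[OF R])
  show "x \<approx> y \<Longrightarrow> a \<in> uni_alg E \<Longrightarrow> x * a \<approx> y * a"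
    unfolding eqv_def left_diff_distrib[symmetric] by (rule uideal_mult_right[OF R])
qed

lemma eqv_eq_trans [trans]: "x \<approx> y \<Longrightarrow> y = z \<Longrightarrow> x \<approx> z" "x = y \<Longrightarrow> y \<approx> z \<Longrightarrow> x \<approx> z"
  by auto

lemma eqv_mult: "x \<approx> x' \<Longrightarrow> y \<approx> y' \<Longrightarrow> x' \<in> uni_alg E \<Longrightarrow> y \<in> uni_alg E \<Longrightarrow> x * y \<approx> x' * y'"
  unfolding eqv_def by (rule uideal_cong_mult[OF uideal_rel])

lemma eqv_sum: "(\<And>i. i \<in> A \<Longrightarrow> f i \<approx> g i) \<Longrightarrow> sum f A \<approx> sum g A"
  by (induction A rule: infinite_finite_induct) (auto intro: eqv_add)

lemma eqv_full_ideal: "full_ideal J \<Longrightarrow> x \<approx> y \<Longrightarrow> x \<in> J \<longleftrightarrow> y \<in> J"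
  using uideal_cong[OF full_idealD(1), of J x y] full_idealD(2)[of J "x - y"] by (auto simp: eqv_def)

lemma eqv_full_ideal_diff: "full_ideal J \<Longrightarrow> x \<approx> y \<Longrightarrow> x - y \<in> J"
  using full_idealD(2) by (auto simp: eqv_def)

lemma vert_vert: "v \<in> verts E \<Longrightarrow> w \<in> verts E \<Longrightarrow> vert v * vert w \<approx> (if v = w then vert v else 0)"
  and edge_head: "e \<in> arcs E \<Longrightarrow> edge e * vert (head E e) \<approx> edge e"
  and head_ghost: "e \<in> arcs E \<Longrightarrow> vert (head E e) * ghost e \<approx> ghost e"
  and ghost_tail: "e \<in> arcs E \<Longrightarrow> ghost e * vert (tail E e) \<approx> ghost e"
  and ghost_edge: "e \<in> arcs E \<Longrightarrow> f \<in> arcs E \<Longrightarrow>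
    ghost e * edge f \<approx> (if e = f then vert (head E e) else 0)"
  by (simp_all only: eqv_def vert_mult_rel edge_head_rel tail_edge_rel head_ghost_rel ghost_tail_rel ghost_edge_rel)

lemma vert_gen: "g \<in> gens E \<Longrightarrow> v \<in> verts E \<Longrightarrow> vert v * gen_elem g \<approx> (if v = gsrc g then gen_elem g else 0)"
  by (simp only: eqv_def vert_gen_rel)

fun grng :: "('v, 'e) gen \<Rightarrow> 'v" where
  "grng (Vertex v) = v" | "grng (Edge e) = head E e" | "grng (Ghost e) = tail E e"

lemma gen_vert:
  assumes "g \<in> gens E" "v \<in> verts E"
  shows "gen_elem g * vert v \<approx> (if v = grng g then gen_elem g else 0)"
proof -
  have g: "grng g \<in> verts E" "gen_elem g \<in> uni_alg E"
    using assms by (cases g; auto intro: aug_uni gen_elem_aug)+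
  have "gen_elem g * vert (grng g) \<approx> gen_elem g"
    using assms(1) vert_vert[of "grng g" "grng g"] by (cases g) (auto simp: edge_head ghost_tail)
  then have "gen_elem g * vert v \<approx> gen_elem g * vert (grng g) * vert v"
    using assms by (auto intro!: eqv_mult_right[OF eqv_sym])
  also have "\<dots> \<approx> gen_elem g * (if grng g = v then vert (grng g) else 0)"
    unfolding mult.assoc using assms g by (intro eqv_mult_left vert_vert) auto
  also have "\<dots> \<approx> (if v = grng g then gen_elem g else 0)"
    using \<open>gen_elem g * vert (grng g) \<approx> gen_elem g\<close> by auto
  finally show ?thesis .
qed

lemmas vert_edge = vert_gen[of "Edge _", simplified]
  and vert_ghost = vert_gen[of "Ghost _", simplified]
  and edge_vert = gen_vert[of "Edge _", simplified]
  and ghost_vert = gen_vert[of "Ghost _", simplified]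

lemma head_tail_verts [simp]: "e \<in> arcs E \<Longrightarrow> head E e \<in> verts E" "e \<in> arcs E \<Longrightarrow> tail E e \<in> verts E"
  by auto

subsection \<open>Paths\<close>

lemma prod_edges_uni: "set p \<subseteq> arcs E \<Longrightarrow> prod_list (map edge p) \<in> (uni_alg E :: ('v, 'e, 'r) ncpoly set)"
  and prod_ghosts_uni: "set p \<subseteq> arcs E \<Longrightarrow> prod_list (map ghost p) \<in> (uni_alg E :: ('v, 'e, 'r) ncpoly set)"
  by (induction p) auto

lemma path_elem_Cons: "path_elem u (e # p) = edge e * prod_list (map edge p)"
  and path_star_Cons: "path_star u (e # p) = prod_list (map ghost (rev p)) * ghost e"
  and path_Nil [simp]: "path_elem u [] = vert u" "path_star u [] = vert u"
  by (simp_all add: path_elem_def path_star_def)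

lemma path_aug:
  assumes "awalk u p w"
  shows "path_elem u p \<in> (aug E :: ('v, 'e, 'r) ncpoly set)" "path_star u p \<in> (aug E :: ('v, 'e, 'r) ncpoly set)"
  using assms by (cases p;
    auto simp: path_elem_Cons path_star_Cons awalk_def
      intro!: aug_mult_right[OF _ prod_edges_uni] aug_mult_left[OF prod_ghosts_uni])+

lemma path_elem_eqv_Cons:
  assumes "awalk u (e # p) w"
  shows "path_elem u (e # p) \<approx> edge e * path_elem (head E e) p"
  using assms by (cases p) (auto simp: path_elem_Cons awalk_def intro: eqv_sym edge_head)

lemma path_star_eqv_Cons:
  assumes "awalk u (e # p) w"
  shows "path_star u (e # p) \<approx> path_star (head E e) p * ghost e"
  using assms by (cases p) (auto simp: path_star_Cons awalk_def intro: eqv_sym head_ghost)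

lemma awalk_ConsD: "awalk u (e # p) w \<Longrightarrow> e \<in> arcs E \<and> tail E e = u \<and> awalk (head E e) p w"
  by (auto simp: awalk_def)

lemma awalk_end_verts: "awalk u p w \<Longrightarrow> u \<in> verts E" "awalk u p w \<Longrightarrow> w \<in> verts E"
  by auto

lemma vert_path_elem:
  assumes "awalk u p w" "v \<in> verts E"
  shows "vert v * path_elem u p \<approx> (if v = u then path_elem u p else 0)"
proof (cases p)
  case Nil
  then show ?thesis using assms vert_vert[of v u] awalk_end_verts[OF assms(1)] by auto
next
  case (Cons e q)
  then have "vert v * edge e \<approx> (if v = u then edge e else 0)" 
    using assms vert_edge[of e v] awalk_ConsD[of u e q w] by auto
  from eqv_mult_right[OF this prod_edges_uni[of q]] show ?thesis
    using Cons assms by (auto simp: path_elem_Cons mult.assoc awalk_def)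
qed

lemma path_star_vert:
  assumes "awalk u p w" "v \<in> verts E"
  shows "path_star u p * vert v \<approx> (if v = u then path_star u p else 0)"
proof (cases p)
  case Nil
  then show ?thesis using assms vert_vert[of u v] awalk_end_verts[OF assms(1)] by auto
next
  case (Cons e q)
  then have "ghost e * vert v \<approx> (if v = u then ghost e else 0)"
    using assms ghost_vert[of e v] awalk_ConsD[of u e q w] by auto
  from eqv_mult_left[OF this prod_ghosts_uni[of "rev q"]] show ?thesis
    using Cons assms by (auto simp: path_star_Cons mult.assoc awalk_def)
qed

lemma path_elem_vert:
  assumes "awalk u p w"
  shows "path_elem u p * vert w \<approx> path_elem u p"
  using assms
proof (induction p arbitrary: u)
  case Nil
  then show ?case using vert_vert[of u u] by (auto simp: awalk_def)
next
  case (Cons e p)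
  have e: "e \<in> arcs E" "awalk (head E e) p w" "w \<in> verts E"
    using awalk_ConsD[OF Cons.prems] awalk_end_verts[OF Cons.prems] by auto
  have "path_elem u (e # p) * vert w \<approx> edge e * path_elem (head E e) p * vert w"
    using path_elem_eqv_Cons[OF Cons.prems] e by (auto intro!: eqv_mult_right)
  also have "\<dots> \<approx> edge e * path_elem (head E e) p"
    unfolding mult.assoc using Cons.IH e by (auto intro!: eqv_mult_left)
  also have "\<dots> \<approx> path_elem u (e # p)" by (rule eqv_sym[OF path_elem_eqv_Cons[OF Cons.prems]])
  finally show ?case .
qed

lemma vert_path_star:
  assumes "awalk u p w"
  shows "vert w * path_star u p \<approx> path_star u p"
  using assms
proof (induction p arbitrary: u)
  case Nil
  then show ?case using vert_vert[of u u] by (auto simp: awalk_def)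
next
  case (Cons e p)
  have e: "e \<in> arcs E" "awalk (head E e) p w" "w \<in> verts E"
    using awalk_ConsD[OF Cons.prems] awalk_end_verts[OF Cons.prems] by auto
  have "vert w * path_star u (e # p) \<approx> vert w * (path_star (head E e) p * ghost e)"
    using path_star_eqv_Cons[OF Cons.prems] e by (auto intro!: eqv_mult_left)
  also have "\<dots> \<approx> path_star (head E e) p * ghost e"
    unfolding mult.assoc[symmetric] using Cons.IH e by (auto intro!: eqv_mult_right)
  also have "\<dots> \<approx> path_star u (e # p)" by (rule eqv_sym[OF path_star_eqv_Cons[OF Cons.prems]])
  finally show ?case .
qed

lemma ghost_path_elem:
  assumes "awalk u (a # p) w" "e \<in> arcs E"
  shows "ghost e * path_elem u (a # p) \<approx> (if e = a then path_elem (head E a) p else 0)"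
proof -
  note a = awalk_ConsD[OF assms(1)]
  have "ghost e * path_elem u (a # p) \<approx> ghost e * (edge a * path_elem (head E a) p)"
    using path_elem_eqv_Cons[OF assms(1)] assms by (auto intro!: eqv_mult_left)
  also have "\<dots> \<approx> (if e = a then vert (head E e) else 0) * path_elem (head E a) p"
    unfolding mult.assoc[symmetric] using a assms path_aug[of "head E a" p w] by (intro eqv_mult_right ghost_edge) auto
  also have "\<dots> \<approx> (if e = a then path_elem (head E a) p else 0)"
    using vert_path_elem[of "head E a" p w "head E a"] a by auto
  finally show ?thesis .
qed

lemma path_star_edge:
  assumes "awalk u (a # p) w" "e \<in> arcs E"
  shows "path_star u (a # p) * edge e \<approx> (if e = a then path_star (head E a) p else 0)"
proof -
  note a = awalk_ConsD[OF assms(1)]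
  have "path_star u (a # p) * edge e \<approx> path_star (head E a) p * ghost a * edge e"
    using path_star_eqv_Cons[OF assms(1)] assms by (auto intro!: eqv_mult_right)
  also have "\<dots> \<approx> path_star (head E a) p * (if a = e then vert (head E a) else 0)"
    unfolding mult.assoc using a assms path_aug[of "head E a" p w] by (intro eqv_mult_left ghost_edge) auto
  also have "\<dots> \<approx> (if e = a then path_star (head E a) p else 0)"
    using path_star_vert[of "head E a" p w "head E a"] a by auto
  finally show ?thesis .
qed

lemma path_star_path_elem:
  assumes "awalk u p w"
  shows "path_star u p * path_elem u p \<approx> vert w"
  using assms
proof (induction p arbitrary: u)
  case Nil
  then show ?case using vert_vert[of u u] by (auto simp: awalk_def)
next
  case (Cons e p)
  have e: "e \<in> arcs E" "awalk (head E e) p w" "w \<in> verts E"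
    using awalk_ConsD[OF Cons.prems] awalk_end_verts[OF Cons.prems] by auto
  have "path_star u (e # p) * path_elem u (e # p) \<approx>
      path_star (head E e) p * ghost e * path_elem u (e # p)"
    using path_star_eqv_Cons[OF Cons.prems] path_aug[OF Cons.prems] by (auto intro!: eqv_mult_right)
  also have "\<dots> \<approx> path_star (head E e) p * path_elem (head E e) p"
    unfolding mult.assoc using ghost_path_elem[OF Cons.prems e(1)] path_aug[OF e(2)]
    by (auto intro!: eqv_mult_left)
  also have "\<dots> \<approx> vert w" by (rule Cons.IH[OF e(2)])
  finally show ?case .
qed

lemma ghost_path_star:
  assumes "awalk u p w" "e \<in> arcs E" "tail E e = w"
  shows "ghost e * path_star u p \<approx> path_star u (p @ [e])"
proof (cases p)
  case Nil
  then show ?thesis using assms ghost_tail[of e] by (auto simp: path_star_def awalk_def)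
qed (simp add: path_star_def)

lemma awalk_snoc: "awalk u p w \<Longrightarrow> e \<in> arcs E \<Longrightarrow> tail E e = w \<Longrightarrow> awalk u (p @ [e]) (head E e)"
  by (auto intro!: awalk_appendI[of u p w] simp: awalk_def)

subsection \<open>Reduction of words\<close>

lemma deg_monomials_aug: "deg_monomials E k \<subseteq> (aug E :: ('v, 'e, 'r) ncpoly set)"
  by (auto simp: deg_monomials_def path_aug)

lemma vert_deg_monomials:
  assumes "v \<in> verts E" shows "vert v * vert v \<in> deg_monomials E 0"
proof -
  have "awalk v [] v" using assms by (simp add: awalk_def)
  then show ?thesis unfolding deg_monomials_def
    by (intro CollectI exI[of _ v] exI[of _ "[]"]) auto
qed

text \<open>
  A monomial is \<open>\<alpha> \<beta>\<^sup>*\<close>.  A vertex or an edge on the left either extends \<open>\<alpha>\<close> or kills it; a ghost edge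
  \<open>e\<^sup>*\<close> cancels the first edge of \<open>\<alpha>\<close>, and if \<open>\<alpha>\<close> is a vertex it extends \<open>\<beta>\<close> at its end.
\<close>

lemma gen_mult_monomial:
  assumes g: "g \<in> gens E" and m: "m \<in> deg_monomials E k"
  shows "gen_elem g * m \<approx> 0 \<or> (\<exists>m'\<in>deg_monomials E (gdeg g + k). gen_elem g * m \<approx> m')"
proof -
  from m obtain u p u' q w where m_def: "m = path_elem u p * path_star u' q"
    and p: "awalk u p w" and q: "awalk u' q w" and k: "k = int (length p) - int (length q)"
    by (auto simp: deg_monomials_def)
  note aug = path_aug[OF p] path_aug[OF q] gen_elem_aug[OF g]
  have verts: "u \<in> verts E" "w \<in> verts E" using p by auto
  have right: "gen_elem g * m \<approx> y * path_star u' q" if "gen_elem g * path_elem u p \<approx> y" for y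
    using eqv_mult_right[OF that, of "path_star u' q"] aug by (auto simp: m_def mult.assoc)
  have zero: "gen_elem g * m \<approx> 0" if "gen_elem g * path_elem u p \<approx> 0"
    using right[OF that] by simp
  have mon: "path_elem u1 p1 * path_star u1' q1 \<in> deg_monomials E j"
    if "awalk u1 p1 w1" "awalk u1' q1 w1" "j = int (length p1) - int (length q1)" for u1 p1 u1' q1 w1 j
    unfolding deg_monomials_def mem_Collect_eq
    by (intro exI[of _ u1] exI[of _ p1] exI[of _ u1'] exI[of _ q1] exI[of _ w1]) (simp add: that)
  show ?thesis
  proof (cases g)
    case (Vertex v)
    then have "gen_elem g * path_elem u p \<approx> (if v = u then path_elem u p else 0)"
      using vert_path_elem[OF p] g by auto
    then show ?thesis using right zero m Vertex by (cases "v = u") (auto simp: m_def)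
  next
    case (Edge e)
    show ?thesis
    proof (cases "head E e = u")
      case True
      then have ep: "awalk (tail E e) (e # p) w" using p g Edge by (auto simp: awalk_def)
      have "gen_elem g * path_elem u p \<approx> path_elem (tail E e) (e # p)"
        using eqv_sym[OF path_elem_eqv_Cons[OF ep]] True Edge by simp
      from right[OF this] mon[OF ep q, of "1 + k"] show ?thesis using k Edge by auto
    next
      case False
      have "gen_elem g * path_elem u p \<approx> edge e * (vert u * path_elem u p)"
        unfolding Edge using vert_path_elem[OF p verts(1)] g Edge by (auto intro!: eqv_mult_left[OF eqv_sym])
      also have "\<dots> \<approx> 0 * path_elem u p"
        unfolding mult.assoc[symmetric]
        using edge_vert[of e u] g Edge verts aug False by (intro eqv_mult_right) auto
      finally show ?thesis using zero by simp
    qed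
  next
    case (Ghost e)
    have e: "e \<in> arcs E" using g Ghost by auto
    show ?thesis
    proof (cases p)
      case (Cons a p')
      have "gen_elem g * path_elem u p \<approx> (if e = a then path_elem (head E a) p' else 0)"
        using ghost_path_elem[of u a p' w e] p e Cons Ghost by auto
      moreover have "awalk (head E a) p' w" using p Cons awalk_ConsD by auto
      ultimately show ?thesis
        using right zero mon[OF \<open>awalk (head E a) p' w\<close> q] k Ghost Cons by (cases "e = a") auto
    next
      case Nil
      then have uw: "u = w" using p by (auto simp: awalk_def)
      show ?thesis
      proof (cases "tail E e = w")
        case False
        then show ?thesis using zero ghost_vert[of e u] e verts Nil Ghost uw by auto
      next
        case True
        let ?q = "q @ [e]"
        have q': "awalk u' ?q (head E e)" by (rule awalk_snoc[OF q e True])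
        have "gen_elem g * path_elem u p \<approx> ghost e"
          using ghost_vert[of e u] e verts Nil Ghost uw True by auto
        then have "gen_elem g * m \<approx> ghost e * path_star u' q" by (rule right)
        also have "\<dots> \<approx> path_star u' ?q" by (rule ghost_path_star[OF q e True])
        also have "\<dots> \<approx> path_elem (head E e) [] * path_star u' ?q"
          using vert_path_star[OF q'] by (auto intro: eqv_sym)
        finally show ?thesis using mon[OF _ q', of "head E e" "[]"] e k Nil Ghost
          by (auto simp: awalk_def)
      qed
    qed
  qed
qed

lemma word_eqv_monomial:
  assumes "w \<noteq> []" "set w \<subseteq> gens E"
  shows "Poly_Mapping.single (GWord w) 1 \<approx> 0 \<or>
    (\<exists>m\<in>deg_monomials E (wdeg (GWord w)). Poly_Mapping.single (GWord w) 1 \<approx> m)"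
  using assms
proof (induction w rule: list_nonempty_induct)
  case (single g)
  have v: "grng g \<in> verts E" using single by (cases g) auto
  have g: "gen_elem g \<in> uni_alg E" using single by (auto intro: gen_elem_aug)
  have "gen_elem g \<approx> gen_elem g * vert (grng g)"
    using gen_vert[of g "grng g"] single v by (auto intro: eqv_sym)
  also have "\<dots> \<approx> gen_elem g * (vert (grng g) * vert (grng g))"
    using vert_vert[OF v v] g by (auto intro!: eqv_mult_left[OF eqv_sym])
  finally have eq: "gen_elem g \<approx> gen_elem g * (vert (grng g) * vert (grng g))" .
  then show ?case
    using gen_mult_monomial[OF _ vert_deg_monomials[OF v], of g] single eqv_trans[OF eq]
    by (fastforce simp: gen_elem_def wdeg_def)
next
  case (cons g w)
  let ?w = "Poly_Mapping.single (GWord w) 1 :: ('v, 'e, 'r) ncpoly"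
  have g: "gen_elem g \<in> uni_alg E" "g \<in> gens E" using cons by (auto intro: gen_elem_aug)
  have eq: "Poly_Mapping.single (GWord (g # w)) 1 = gen_elem g * ?w" by (rule single_Cons)
  have d: "wdeg (GWord (g # w)) = gdeg g + wdeg (GWord w)" by (simp add: wdeg_def)
  from cons consider "?w \<approx> 0" | m where "m \<in> deg_monomials E (wdeg (GWord w))" "?w \<approx> m" by auto
  then show ?case
  proof cases
    case 1
    then show ?thesis using eqv_mult_left[OF 1 g(1)] by (simp add: eq)
  next
    case 2
    then show ?thesis unfolding eq d
      using gen_mult_monomial[OF g(2) 2(1)] eqv_trans[OF eqv_mult_left[OF 2(2) g(1)]] by blast
  qed
qed

text \<open>
  The span of \<open>B\<close> in the Leavitt path algebra, pulled back to polynomials.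
\<close>

inductive_set lspan :: "('v, 'e, 'r::comm_ring_1) ncpoly set \<Rightarrow> ('v, 'e, 'r) ncpoly set"
  for B where
  zero: "x \<in> rel_ideal E \<Longrightarrow> x \<in> lspan B"
| step: "b \<in> B \<Longrightarrow> x \<in> lspan B \<Longrightarrow> const c * b + x \<in> lspan B"

lemma lspan_add: "x \<in> lspan B \<Longrightarrow> y \<in> lspan B \<Longrightarrow> x + y \<in> lspan B"
proof (induction x rule: lspan.induct)
  case (zero x)
  from zero(2,1) show ?case
  proof (induction y rule: lspan.induct)
    case (step b y c)
    then have "const c * b + (x + y) \<in> lspan B" by (intro lspan.step)
    then show ?case by (simp add: algebra_simps)
  qed (auto intro!: lspan.zero uideal_add[OF uideal_rel])
next
  case (step b x c)
  then have "const c * b + (x + y) \<in> lspan B" by (intro lspan.step)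
  then show ?case by (simp add: algebra_simps)
qed

lemma lspan_eqv: "x \<in> lspan B \<Longrightarrow> y \<approx> x \<Longrightarrow> y \<in> lspan B"
  using lspan_add[OF lspan.zero[of "y - x" B], of x] by (simp add: eqv_def)

lemma lspan_0: "0 \<in> lspan B" by (intro lspan.zero uideal_0[OF uideal_rel])

lemma lspan_base: "b \<in> B \<Longrightarrow> const c * b \<in> lspan B"
  using lspan.step[OF _ lspan_0, of b B c] by simp

lemma lspan_map:
  assumes "x \<in> lspan B" and lin: "\<And>x y. f (x + y) = f x + f y" "\<And>c x. f (const c * x) = const c * f x"
    and rel: "\<And>x. x \<in> rel_ideal E \<Longrightarrow> f x \<in> rel_ideal E" and B: "\<And>b. b \<in> B \<Longrightarrow> f b \<in> lspan B'"
  shows "f x \<in> lspan B'"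
proof -
  have scale: "const c * y \<in> lspan B'" if "y \<in> lspan B'" for c y
    using that
  proof (induction y rule: lspan.induct)
    case (step b y d)
    then have "const (c * d) * b + const c * y \<in> lspan B'" by (intro lspan.step)
    then show ?case by (simp add: const_simps algebra_simps)
  qed (auto intro!: lspan.zero uideal_mult_left[OF uideal_rel])
  show ?thesis using assms(1)
    by (induction x rule: lspan.induct) (auto simp: lin intro: lspan.zero rel lspan_add scale B)
qed

lemma hom_deg_lspan:
  assumes "p \<in> aug E" "hom_deg k p"
  shows "p \<in> lspan (deg_monomials E k)"
proof -
  have "Poly_Mapping.keys p \<subseteq> {w. letters w \<noteq> [] \<and> set (letters w) \<subseteq> gens E \<and> wdeg w = k}"
    using assms by (auto simp: aug_iff hom_deg_def)
  then show ?thesis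
  proof (induction p rule: poly_mapping_add_induct)
    case (add p w c)
    let ?w = "Poly_Mapping.single w 1 :: ('v, 'e, 'r) ncpoly"
    have w: "Poly_Mapping.single w c = const c * ?w" by (simp add: const_def mult_single)
    from add(2) word_eqv_monomial[of "letters w"]
    consider "?w \<approx> 0" | m where "m \<in> deg_monomials E k" "?w \<approx> m" by auto
    then have "Poly_Mapping.single w c \<in> lspan (deg_monomials E k)"
    proof cases
      case 1
      then show ?thesis unfolding w
        using lspan_eqv[OF lspan_0 eqv_mult_left[OF 1, of "const c", simplified]] by simp
    next
      case 2
      then show ?thesis unfolding w
        by (intro lspan_eqv[OF lspan_base[OF 2(1)] eqv_mult_left[OF 2(2)]]) auto
    qed
    with add(1) show ?case by (rule lspan_add)
  qed (rule lspan_0)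
qed

lemma hom_deg_prod_list: "(\<And>x. x \<in> set xs \<Longrightarrow> hom_deg k (f x)) \<Longrightarrow> hom_deg (int (length xs) * k) (prod_list (map f xs))"
proof (induction xs)
  case Nil
  then show ?case by (simp add: hom_deg_def wdeg_def)
next
  case (Cons x xs)
  then have "hom_deg (k + int (length xs) * k) (f x * prod_list (map f xs))"
    by (intro hom_deg_mult) auto
  then show ?case by (simp add: algebra_simps)
qed

lemma hom_deg_path: "hom_deg (int (length p)) (path_elem u p)" "hom_deg (- int (length p)) (path_star u p)"
  using hom_deg_prod_list[of p 1 edge] hom_deg_prod_list[of "rev p" "-1" ghost]
  by (auto simp: path_elem_def path_star_def)

lemma hom_deg_monomial: "m \<in> deg_monomials E k \<Longrightarrow> hom_deg k m"
  unfolding deg_monomials_def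
  by (elim CollectE exE conjE) (use hom_deg_mult[OF hom_deg_path] in auto)

lemma lspan_mono: "B \<subseteq> B' \<Longrightarrow> lspan B \<subseteq> lspan B'"
proof
  fix x assume "B \<subseteq> B'" "x \<in> lspan B" 
  from this(2,1) show "x \<in> lspan B'"
    by (induction x rule: lspan.induct) (auto intro: lspan.intros)
qed

lemma hom_deg_vert_minus: "hom_deg 0 (vert_minus v F)"
  using hom_deg_mult[of 1 "edge e" "-1" "ghost e" for e]
  by (auto simp: vert_minus_def intro!: hom_deg_diff hom_deg_sum)

lemma hom_deg_relators: "x \<in> relators E \<Longrightarrow> \<exists>k. hom_deg k x"
proof -
  have v: "hom_deg 0 (vert v * vert w - (if v = w then vert v else 0))" for v w
    using hom_deg_mult[of 0 "vert v" 0 "vert w"] by (auto intro!: hom_deg_diff)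
  have e: "hom_deg 1 (vert v * edge e - edge e)" "hom_deg 1 (edge e * vert v - edge e)" 
    "hom_deg (-1) (vert v * ghost e - ghost e)" "hom_deg (-1) (ghost e * vert v - ghost e)" for v e
    using hom_deg_mult[of 0 "vert v" 1 "edge e"] hom_deg_mult[of 1 "edge e" 0 "vert v"]
      hom_deg_mult[of 0 "vert v" "-1" "ghost e"] hom_deg_mult[of "-1" "ghost e" 0 "vert v"]
    by (auto intro!: hom_deg_diff)
  have ee: "hom_deg 0 (ghost e * edge f - (if e = f then vert v else 0))" for v e f
    using hom_deg_mult[of "-1" "ghost e" 1 "edge f"] by (auto intro!: hom_deg_diff)
  assume "x \<in> relators E"
  then show ?thesis unfolding relators_def
    by (elim UnE CollectE exE conjE; hypsubst; intro exI) (rule v e ee hom_deg_vert_minus)+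
qed

end

section \<open>Graded ideals\<close>

context leavitt
begin

lemma hpart_closed_rel: "hpart_closed (rel_ideal E)"
  unfolding rel_ideal_eq_ugen using relators_aug hom_deg_relators by (rule hpart_closed_ugen)

lemma eqv_hpart: "x \<approx> y \<Longrightarrow> hpart k x \<approx> hpart k y"
  using hpart_closed_rel unfolding eqv_def hpart_closed_def hpart_diff[symmetric] by blast

lemma const_left_commute: "const c * (const d * x) = const d * (const c * x)"
  by (simp add: mult.commute flip: mult.assoc const_simps(5))

lemma lspan_scale:
  assumes "x \<in> lspan B" shows "const c * x \<in> lspan B"
  by (rule lspan_map[of x B "\<lambda>x. const c * x", OF assms])
    (auto simp: distrib_left const_left_commute lspan_base intro: uideal_mult_left[OF uideal_rel])

lemma lspan_sumE:
  assumes "x \<in> lspan B"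
  obtains c T where "finite T" "T \<subseteq> B" "x \<approx> (\<Sum>m\<in>T. const (c m) * m)"
proof -
  have "\<exists>c T. finite T \<and> T \<subseteq> B \<and> x \<approx> (\<Sum>m\<in>T. const (c m) * m)"
    using assms
  proof (induction x rule: lspan.induct)
    case (zero x)
    then show ?case by (intro exI[of _ "\<lambda>_. 0"] exI[of _ "{}"]) (simp add: eqv_0_iff)
  next
    case (step b x d)
    then obtain c T where T: "finite T" "T \<subseteq> B" "x \<approx> (\<Sum>m\<in>T. const (c m) * m)" by auto
    define c' where "c' = c(b := (if b \<in> T then c b else 0) + d)"
    have rest: "(\<Sum>m\<in>T - {b}. const (c' m) * m) = (\<Sum>m\<in>T - {b}. const (c m) * m)"
      by (intro sum.cong) (auto simp: c'_def)
    have "(\<Sum>m\<in>insert b T. const (c' m) * m) = const d * b + (\<Sum>m\<in>T. const (c m) * m)"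
    proof (cases "b \<in> T")
      case True
      then show ?thesis
        using rest T(1) by (simp add: insert_absorb sum.remove[of T b] c'_def const_simps algebra_simps)
    next
      case False
      then show ?thesis using rest T(1) by (simp add: c'_def)
    qed
    then have "const d * b + x \<approx> (\<Sum>m\<in>insert b T. const (c' m) * m)"
      using T(3) by (auto intro: eqv_add)
    then show ?case using T step.hyps by (intro exI[of _ c'] exI[of _ "insert b T"]) auto
  qed
  then show ?thesis using that by blast
qed

lemma lpa_component_eq:
  "lpa_component E k = lpa_cls E ` {q :: ('v, 'e, 'r) ncpoly. q \<in> aug E \<and> hom_deg k q}" (is "_ = ?R")
proof
  show "lpa_component E k \<subseteq> ?R"
  proof
    fix X :: "('v, 'e, 'r) lpa_elem" assume "X \<in> lpa_component E k"
    then obtain c T where X: "X = lpa_cls E (\<Sum>m\<in>T. scale (c m) m)" and T: "T \<subseteq> deg_monomials E k"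
      by (auto simp: lpa_component_def)
    have "(\<Sum>m\<in>T. scale (c m) m) \<in> aug E"
      using T deg_monomials_aug by (intro aug_sum aug_scale) auto
    moreover have "hom_deg k (\<Sum>m\<in>T. scale (c m) m)"
    proof (intro hom_deg_sum)
      fix m assume "m \<in> T"
      then have "hom_deg (0 + k) (const (c m) * m)"
        using T hom_deg_gens(4) by (intro hom_deg_mult) (auto intro: hom_deg_monomial)
      then show "hom_deg k (scale (c m) m)" by (simp add: scale_conv_const)
    qed
    ultimately show "X \<in> ?R" using X by auto
  qed
  show "?R \<subseteq> lpa_component E k"
  proof
    fix X assume "X \<in> ?R"
    then obtain q :: "('v, 'e, 'r) ncpoly" where q: "X = lpa_cls E q" "q \<in> aug E" "hom_deg k q" by auto
    obtain c T where "finite T" "T \<subseteq> deg_monomials E k" "q \<approx> (\<Sum>m\<in>T. const (c m) * m)"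
      by (rule lspan_sumE[OF hom_deg_lspan[OF q(2,3)]])
    moreover from this have "X = lpa_cls E (\<Sum>m\<in>T. scale (c m) m)"
      by (simp add: q(1) scale_conv_const lpa_cls_eq_iff eqv_def)
    ultimately show "X \<in> lpa_component E k"
      unfolding lpa_component_def by blast
  qed
qed

text \<open>
  Independence of the components of \<open>lpa E\<close>: a sum determines its summands, since the ideal of
  relations is homogeneous and taking homogeneous parts is therefore well defined on classes.
\<close>

lemma component_sum:
  fixes f :: "int \<Rightarrow> ('v, 'e, 'r) lpa_elem"
  assumes f: "\<And>k. f k \<in> lpa_component E k" and fin: "finite {k. f k \<noteq> \<zero>\<^bsub>lpa E\<^esub>}"
    and x: "(\<Oplus>\<^bsub>lpa E\<^esub>k\<in>{k. f k \<noteq> \<zero>\<^bsub>lpa E\<^esub>}. f k) = lpa_cls E x"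
  shows "f j = lpa_cls E (hpart j x)"
proof -
  let ?S = "{k. f k \<noteq> \<zero>\<^bsub>lpa E\<^esub>}"
  have "\<forall>k. \<exists>q. q \<in> aug E \<and> hom_deg k q \<and> f k = lpa_cls E q \<and> (f k = \<zero>\<^bsub>lpa E\<^esub> \<longrightarrow> q = 0)"
  proof
    fix k
    show "\<exists>q. q \<in> aug E \<and> hom_deg k q \<and> f k = lpa_cls E q \<and> (f k = \<zero>\<^bsub>lpa E\<^esub> \<longrightarrow> q = 0)"
    proof (cases "f k = \<zero>\<^bsub>lpa E\<^esub>")
      case True
      then show ?thesis by (intro exI[of _ 0]) (simp add: zero_lpa)
    next
      case False
      then show ?thesis using f[of k] by (auto simp: lpa_component_eq)
    qed
  qed
  then obtain q where q: "\<And>k. q k \<in> aug E" "\<And>k. hom_deg k (q k)" "\<And>k. f k = lpa_cls E (q k)"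
    "\<And>k. f k = \<zero>\<^bsub>lpa E\<^esub> \<Longrightarrow> q k = 0"
    by metis
  have "lpa_cls E x = lpa_cls E (\<Sum>k\<in>?S. q k)"
    using finsum_lpa[of ?S q] q(1) fin x by (simp flip: q(3))
  then have "hpart j x \<approx> hpart j (\<Sum>k\<in>?S. q k)"
    by (intro eqv_hpart) (simp add: eqv_def lpa_cls_eq_iff)
  also have "hpart j (\<Sum>k\<in>?S. q k) = (\<Sum>k\<in>?S. if k = j then q k else 0)"
    unfolding hpart_sum by (intro sum.cong refl) (use hpart_hom_deg[OF q(2)] in auto)
  also have "\<dots> = q j" using fin q(4)[of j] by (auto simp: sum.delta)
  finally show ?thesis by (simp add: q(3) eqv_def lpa_cls_eq_iff uideal_cong_sym[OF uideal_rel])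
qed

lemma finsum_hpart:
  assumes p: "(p :: ('v, 'e, 'r) ncpoly) \<in> aug E"
  defines "f \<equiv> \<lambda>k. lpa_cls E (hpart k p)"
  shows "finite {k. f k \<noteq> \<zero>\<^bsub>lpa E\<^esub>}" "(\<Oplus>\<^bsub>lpa E\<^esub>k\<in>{k. f k \<noteq> \<zero>\<^bsub>lpa E\<^esub>}. f k) = lpa_cls E p"
proof -
  let ?S = "{k. f k \<noteq> \<zero>\<^bsub>lpa E\<^esub>}" and ?A = "wdeg ` Poly_Mapping.keys p"
  have "hpart k p = 0" if "k \<notin> ?A" for k
    using that by (intro poly_mapping_eqI) (auto simp: lookup_hpart when_def in_keys_iff)
  then have S: "?S \<subseteq> ?A" by (auto simp: f_def zero_lpa)
  then show fin: "finite ?S" by (rule finite_subset) simp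
  have "p = (\<Sum>k\<in>?A. hpart k p)" by (simp add: sum_hpart)
  also have "\<dots> \<approx> (\<Sum>k\<in>?A. if k \<in> ?S then hpart k p else 0)"
    by (intro eqv_sum) (auto simp: f_def zero_lpa lpa_cls_eq_iff eqv_def uideal_0[OF uideal_rel])
  also have "(\<Sum>k\<in>?A. if k \<in> ?S then hpart k p else 0) = (\<Sum>k\<in>?S. hpart k p)"
    using S by (intro sum.mono_neutral_cong_right) auto
  finally have "lpa_cls E p = lpa_cls E (\<Sum>k\<in>?S. hpart k p)" by (simp add: eqv_def lpa_cls_eq_iff)
  then show "(\<Oplus>\<^bsub>lpa E\<^esub>k\<in>?S. f k) = lpa_cls E p"
    using finsum_lpa[of ?S "\<lambda>k. hpart k p"] fin p by (simp add: f_def)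
qed

lemma graded_ideal_iff:
  assumes I: "rng_ideal I (lpa E)"
  shows "graded_ideal E I \<longleftrightarrow> hpart_closed (lift_ideal I)"
proof -
  let ?C = "\<lambda>k. I \<inter> lpa_component E k"
  let ?sum = "\<lambda>f. \<Oplus>\<^bsub>lpa E\<^esub>k\<in>{k. f k \<noteq> \<zero>\<^bsub>lpa E\<^esub>}. f k"
  let ?D = "{f. (\<forall>k. f k \<in> ?C k) \<and> finite {k :: int. f k \<noteq> \<zero>\<^bsub>lpa E\<^esub>}}"
  have G: "graded_ideal E I \<longleftrightarrow> bij_betw ?sum ?D I"
    using I by (simp add: graded_ideal_def is_internal_direct_sum_def)
  have sum_carrier: "\<exists>x\<in>aug E. ?sum f = lpa_cls E x" if "f \<in> ?D" for f
  proof -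
    interpret abelian_group "lpa E :: ('r, ('v, 'e, 'r) lpa_elem) module" by (rule abelian_group_lpa)
    have "f \<in> {k. f k \<noteq> \<zero>\<^bsub>lpa E\<^esub>} \<rightarrow> carrier (lpa E)"
      using that rng_ideal_closed(3)[OF I] by auto
    from finsum_closed[OF this] show ?thesis by (auto simp: carrier_lpa)
  qed
  note I' = full_idealD(1)[OF full_lift_ideal[OF I]]
  show ?thesis
  proof
    assume "graded_ideal E I"
    then have bij: "bij_betw ?sum ?D I" using G by simp
    show "hpart_closed (lift_ideal I)"
      unfolding hpart_closed_def
    proof (intro ballI allI)
      fix p k assume p: "p \<in> lift_ideal I"
      then have "lpa_cls E p \<in> I" "p \<in> aug E" by (auto simp: lift_ideal_def)
      then have "lpa_cls E p \<in> ?sum ` ?D" using bij by (simp add: bij_betw_def)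
      then obtain f where f: "lpa_cls E p = ?sum f" "f \<in> ?D" by (rule imageE)
      have "f k = lpa_cls E (hpart k p)"
        by (rule component_sum) (use f in auto)
      moreover have "f k \<in> I" using f(2) by blast
      ultimately show "hpart k p \<in> lift_ideal I" using \<open>p \<in> aug E\<close>
        by (simp add: lift_ideal_def)
    qed
  next
    assume H: "hpart_closed (lift_ideal I)"
    have "inj_on ?sum ?D"
    proof (rule inj_onI)
      fix f g assume f: "f \<in> ?D" and g: "g \<in> ?D" and eq: "?sum f = ?sum g"
      obtain x where x: "?sum f = lpa_cls E x" using sum_carrier[OF f] by blast
      have "f k = lpa_cls E (hpart k x)" "g k = lpa_cls E (hpart k x)" for k
        by (rule component_sum; use f g x eq in auto)+
      then show "f = g" by auto
    qed
    moreover have "?sum ` ?D \<subseteq> I"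
    proof
      fix X assume "X \<in> ?sum ` ?D"
      then obtain f where f: "X = ?sum f" "f \<in> ?D" by (rule imageE)
      obtain x where x: "x \<in> aug E" "?sum f = lpa_cls E x" using sum_carrier[OF f(2)] by blast
      have "f k = lpa_cls E (hpart k x)" for k
        by (rule component_sum) (use f x in auto)
      moreover have "f k \<in> I" for k using f(2) by blast
      ultimately have "hpart k x \<in> lift_ideal I" for k
        using x(1) by (simp add: lift_ideal_def)
      then have "(\<Sum>k\<in>wdeg ` Poly_Mapping.keys x. hpart k x) \<in> lift_ideal I"
        by (intro uideal_sum[OF I'])
      then show "X \<in> I" using f x by (simp add: sum_hpart lift_ideal_def)
    qed
    moreover have "I \<subseteq> ?sum ` ?D"
    proof
      fix X assume X: "X \<in> I"
      then have "X \<in> lpa_cls E ` lift_ideal I" by (simp add: image_lift_ideal I)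
      then obtain p where p: "X = lpa_cls E p" "p \<in> lift_ideal I" by (rule imageE)
      have pa: "p \<in> aug E" using p by (simp add: lift_ideal_def)
      have 1: "(\<lambda>k. lpa_cls E (hpart k p)) \<in> ?D"
        using finsum_hpart(1)[OF pa] H p pa by (auto simp: hpart_closed_def lift_ideal_def lpa_component_eq)
      show "X \<in> ?sum ` ?D"
      proof (rule image_eqI)
        show "X = ?sum (\<lambda>k. lpa_cls E (hpart k p))" using finsum_hpart(2)[OF pa] p by simp
      qed (rule 1)
    qed
    ultimately show "graded_ideal E I" unfolding G by (simp add: bij_betw_def subset_antisym)
  qed
qed

section \<open>Reduction of homogeneous elements\<close>

text \<open>
  For finite \<open>F\<close>, the idempotent \<open>\<Sum>\<^bsub>e\<in>F\<^esub> e e\<^sup>*\<close>: it projects onto the paths that begin with an edge in \<open>F\<close>.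
\<close>

definition epr :: "'e set \<Rightarrow> ('v, 'e, 'r) ncpoly" where
  "epr F = (\<Sum>e\<in>F. edge e * ghost e)"

lemma vert_minus_epr: "vert_minus v F = vert v - epr F"
  by (simp add: vert_minus_def epr_def)

lemma epr_aug: "F \<subseteq> arcs E \<Longrightarrow> epr F \<in> aug E"
  by (auto simp: epr_def intro!: aug_sum)

lemma epr_uni [simp]: "F \<subseteq> arcs E \<Longrightarrow> epr F \<in> uni_alg E"
  by (simp add: epr_aug)

lemma epr_edge:
  assumes "finite F" "F \<subseteq> arcs E" "e \<in> arcs E"
  shows "epr F * edge e \<approx> (if e \<in> F then edge e else 0)"
proof -
  have "epr F * edge e = (\<Sum>f\<in>F. edge f * (ghost f * edge e))"
    by (simp add: epr_def sum_distrib_right mult.assoc)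
  also have "\<dots> \<approx> (\<Sum>f\<in>F. edge f * (if f = e then vert (head E f) else 0))"
    using assms by (intro eqv_sum eqv_mult_left ghost_edge) auto
  also have "\<dots> = (if e \<in> F then edge e * vert (head E e) else 0)"
    using assms by (simp add: if_distrib[of "\<lambda>x. _ * x"] sum.delta' eq_commute[of e] cong: if_cong)
  also have "\<dots> \<approx> (if e \<in> F then edge e else 0)"
    using edge_head assms by auto
  finally show ?thesis .
qed

lemma ghost_epr:
  assumes "finite F" "F \<subseteq> arcs E" "e \<in> arcs E"
  shows "ghost e * epr F \<approx> (if e \<in> F then ghost e else 0)"
proof -
  have "ghost e * epr F = (\<Sum>f\<in>F. ghost e * edge f * ghost f)"
    by (simp add: epr_def sum_distrib_left mult.assoc)
  also have "\<dots> \<approx> (\<Sum>f\<in>F. (if e = f then vert (head E e) else 0) * ghost f)"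
    using assms by (intro eqv_sum eqv_mult_right ghost_edge) auto
  also have "\<dots> = (if e \<in> F then vert (head E e) * ghost e else 0)"
    using assms by (simp add: if_distrib[of "\<lambda>x. x * _"] sum.delta cong: if_cong)
  also have "\<dots> \<approx> (if e \<in> F then ghost e else 0)"
    using head_ghost assms by auto
  finally show ?thesis .
qed

lemma epr_mult_subset:
  assumes "finite F" "F \<subseteq> arcs E" "G \<subseteq> F"
  shows "epr G * epr F \<approx> epr G" "epr F * epr G \<approx> epr G"
proof -
  have in_F: "e \<in> F" "e \<in> arcs E" if "e \<in> G" for e using that assms by auto
  have ghost_F: "ghost e * epr F \<approx> ghost e" if "e \<in> F" for e
    using ghost_epr[of F e] assms that by auto
  have edge_F: "epr F * edge e \<approx> edge e" if "e \<in> F" for e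
    using epr_edge[of F e] assms that by auto
  have "epr G * epr F = (\<Sum>e\<in>G. edge e * (ghost e * epr F))"
    unfolding epr_def[of G] by (simp add: sum_distrib_right mult.assoc)
  also have "\<dots> \<approx> (\<Sum>e\<in>G. edge e * ghost e)"
    using in_F by (intro eqv_sum eqv_mult_left ghost_F) auto
  finally show "epr G * epr F \<approx> epr G" by (simp add: epr_def)
  have "epr F * epr G = (\<Sum>e\<in>G. epr F * edge e * ghost e)"
    unfolding epr_def[of G] by (simp add: sum_distrib_left mult.assoc)
  also have "\<dots> \<approx> (\<Sum>e\<in>G. edge e * ghost e)"
    using in_F by (intro eqv_sum eqv_mult_right edge_F) auto
  finally show "epr F * epr G \<approx> epr G" by (simp add: epr_def)
qed

lemma vert_epr:
  assumes "finite F" "F \<subseteq> arcs E" "v \<in> verts E"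
  shows "vert v * epr F \<approx> epr {e \<in> F. tail E e = v}" "epr F * vert v \<approx> epr {e \<in> F. tail E e = v}"
proof -
  have *: "epr {e \<in> F. tail E e = v} = (\<Sum>e\<in>F. if tail E e = v then edge e * ghost e else 0)"
    using assms(1) by (simp add: epr_def sum.inter_filter)
  have "vert v * epr F = (\<Sum>e\<in>F. vert v * edge e * ghost e)"
    by (simp add: epr_def sum_distrib_left mult.assoc)
  also have "\<dots> \<approx> (\<Sum>e\<in>F. (if v = tail E e then edge e else 0) * ghost e)"
    using assms by (intro eqv_sum eqv_mult_right vert_edge) auto
  also have "\<dots> = epr {e \<in> F. tail E e = v}"
    unfolding * by (intro sum.cong) auto
  finally show "vert v * epr F \<approx> epr {e \<in> F. tail E e = v}" .
  have "epr F * vert v = (\<Sum>e\<in>F. edge e * (ghost e * vert v))"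
    by (simp add: epr_def sum_distrib_right mult.assoc)
  also have "\<dots> \<approx> (\<Sum>e\<in>F. edge e * (if v = tail E e then ghost e else 0))"
    using assms by (intro eqv_sum eqv_mult_left ghost_vert) auto
  also have "\<dots> = epr {e \<in> F. tail E e = v}"
    unfolding * by (intro sum.cong) auto
  finally show "epr F * vert v \<approx> epr {e \<in> F. tail E e = v}" .
qed

lemma epr_path_elem:
  assumes "finite F" "F \<subseteq> arcs E" "awalk u p w" "p \<noteq> []" "hd p \<in> F"
  shows "epr F * path_elem u p \<approx> path_elem u p"
proof -
  obtain e q where p: "p = e # q" using assms(4) by (cases p) auto
  then have "epr F * edge e * prod_list (map edge q) \<approx> edge e * prod_list (map edge q)"
    using assms epr_edge[of F e] by (intro eqv_mult_right prod_edges_uni) (auto simp: awalk_def)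
  then show ?thesis by (simp add: p path_elem_Cons mult.assoc)
qed

lemma path_star_epr:
  assumes "finite F" "F \<subseteq> arcs E" "awalk u p w" "p \<noteq> []" "hd p \<in> F"
  shows "path_star u p * epr F \<approx> path_star u p"
proof -
  obtain e q where p: "p = e # q" using assms(4) by (cases p) auto
  then have "prod_list (map ghost (rev q)) * (ghost e * epr F) \<approx> prod_list (map ghost (rev q)) * ghost e"
    using assms ghost_epr[of F e] by (intro eqv_mult_left prod_ghosts_uni) (auto simp: awalk_def)
  then show ?thesis by (simp add: p path_star_Cons mult.assoc)
qed

text \<open>
  The monomials of degree 0 filter the component of degree 0 by their length; passing from \<open>x\<close> to
  \<open>e\<^sup>* x f\<close> lowers the level by one.
\<close>

definition level :: "nat \<Rightarrow> ('v, 'e, 'r) ncpoly set" where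
  "level n = {path_elem u p * path_star u' q | u p u' q w.
     awalk u p w \<and> awalk u' q w \<and> length p = length q \<and> length p \<le> n}"

lemma levelI: "awalk u p w \<Longrightarrow> awalk u' q w \<Longrightarrow> length p = length q \<Longrightarrow> length p \<le> n
    \<Longrightarrow> path_elem u p * path_star u' q \<in> level n"
  unfolding level_def by blast

lemma level_mono: "m \<le> n \<Longrightarrow> level m \<subseteq> level n"
  unfolding level_def by (intro subsetI, elim CollectE exE conjE, hypsubst) (fold level_def, rule levelI, auto)

lemma lspan_deg_0_level:
  assumes "x \<in> lspan (deg_monomials E 0)"
  shows "\<exists>n. x \<in> lspan (level n)"
  using assms
proof (induction x rule: lspan.induct)
  case (step b x c)
  then obtain n where n: "x \<in> lspan (level n)" by auto
  obtain u p u' q w where b: "b = path_elem u p * path_star u' q" "awalk u p w" "awalk u' q w"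
    "length p = length q"
    using step.hyps(1) by (auto simp: deg_monomials_def)
  have "x \<in> lspan (level (max n (length p)))"
    using lspan_mono[OF level_mono[OF max.cobounded1]] n by blast
  moreover have "b \<in> level (max n (length p))" using b levelI by simp
  ultimately show ?case using lspan.step by blast
qed (auto intro: lspan.zero)

lemma ghost_level_edge:
  assumes "x \<in> lspan (level (Suc n))" "e \<in> arcs E" "f \<in> arcs E"
  shows "ghost e * x * edge f \<in> lspan (level n)"
proof (rule lspan_map[of x "level (Suc n)" "\<lambda>x. ghost e * x * edge f", OF assms(1)])
  show "ghost e * (const c * y) * edge f = const c * (ghost e * y * edge f)" for c y
    using const_commute[of c "ghost e"] by (metis mult.assoc)
  show "ghost e * b * edge f \<in> lspan (level n)" if b: "b \<in> level (Suc n)" for b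
  proof -
    obtain u p u' q w where b: "b = path_elem u p * path_star u' q" and p: "awalk u p w"
      and q: "awalk u' q w" and len: "length p = length q" "length p \<le> Suc n"
      using b by (auto simp: level_def)
    show ?thesis
    proof (cases p)
      case Nil
      then have eq: "q = []" "u = w" "u' = w" "w \<in> verts E" using len p q by (auto simp: awalk_def)
      have h: "awalk (head E e) [] (head E e)" using assms by (simp add: awalk_def)
      have hh: "vert (head E e) * vert (head E e) \<in> level n"
        using levelI[OF h h] by simp
      have "ghost e * b * edge f = ghost e * vert w * (vert w * edge f)"
        using b eq Nil by (simp add: mult.assoc)
      also have "\<dots> \<approx> (if w = tail E e then ghost e else 0) * (if w = tail E f then edge f else 0)"
        using assms eq by (intro eqv_mult ghost_vert vert_edge) auto
      finally have *: "ghost e * b * edge f \<approx> \<dots>" .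
      have "ghost e * edge f \<approx> (if e = f then vert (head E e) * vert (head E e) else 0)"
      proof (cases "e = f")
        case True
        then have "ghost e * edge f \<approx> vert (head E e)" using ghost_edge[of e f] assms by simp
        also have "\<dots> \<approx> vert (head E e) * vert (head E e)"
          using vert_vert[of "head E e" "head E e"] assms by (auto intro: eqv_sym)
        finally show ?thesis using True by simp
      qed (use ghost_edge[of e f] assms in auto)
      from lspan_eqv[OF _ this] have "ghost e * edge f \<in> lspan (level n)"
        using lspan_base[OF hh, of 1] lspan_0 by (cases "e = f") (simp_all add: const_simps)
      then show ?thesis using lspan_eqv[OF _ *] lspan_0 by auto
    next
      case (Cons a p')
      then obtain b' q' where q': "q = b' # q'" using len by (cases q) auto
      have "ghost e * b * edge f = ghost e * path_elem u p * (path_star u' q * edge f)"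
        using b by (simp add: mult.assoc)
      also have "\<dots> \<approx> (if e = a then path_elem (head E a) p' else 0) *
          (if f = b' then path_star (head E b') q' else 0)"
      proof (rule eqv_mult)
        show "ghost e * path_elem u p \<approx> (if e = a then path_elem (head E a) p' else 0)"
          using ghost_path_elem[of u a p' w e] assms(2) p Cons by simp
        show "path_star u' q * edge f \<approx> (if f = b' then path_star (head E b') q' else 0)"
          using path_star_edge[of u' b' q' w f] assms(3) q q' by simp
        show "(if e = a then path_elem (head E a) p' else 0 :: ('v, 'e, 'r) ncpoly) \<in> uni_alg E"
          using path_aug(1)[of "head E a" p' w] awalk_ConsD[of u a p' w] p Cons by auto
        show "path_star u' q * edge f \<in> (uni_alg E :: ('v, 'e, 'r) ncpoly set)" using path_aug(2)[OF q] assms(3) by simp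
      qed
      finally have *: "ghost e * b * edge f \<approx> \<dots>" .
      have "path_elem (head E a) p' * path_star (head E b') q' \<in> level n"
        using awalk_ConsD[of u a p' w] awalk_ConsD[of u' b' q' w] p q len Cons q'
        by (intro levelI) auto
      from lspan_base[OF this, of 1] show ?thesis
        using lspan_0 by (intro lspan_eqv[OF _ *]) (auto simp: const_simps)
    qed
  qed
  show "ghost e * y * edge f \<in> rel_ideal E" if "y \<in> rel_ideal E" for y
    using that assms by (intro uideal_mult_right[OF uideal_rel] uideal_mult_left[OF uideal_rel]) auto
qed (simp add: algebra_simps)

text \<open>
  For large finite \<open>F\<close> the projection \<open>P\<close> given by \<open>F\<close> satisfies \<open>P m P = m\<close> for every monomial
  \<open>m = \<alpha> \<beta>\<^sup>*\<close> of positive length occurring in \<open>x\<close>, whereas \<open>v - P v P\<close> is \<open>v\<close> minus those \<open>e e\<^sup>*\<close>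
  whose edge \<open>e\<close> in \<open>F\<close> starts at \<open>v\<close>.  So \<open>x - P x P\<close> sees only the vertices in \<open>x\<close>.  At level 0
  there are only vertices, and \<open>F\<close> may be any finite set.
\<close>

lemma level_decomposition:
  assumes "x \<in> lspan (level n)"
  obtains F0 where "finite F0" "F0 \<subseteq> arcs E" "n = 0 \<Longrightarrow> F0 = {}"
    "\<And>F. finite F \<Longrightarrow> F0 \<subseteq> F \<Longrightarrow> F \<subseteq> arcs E \<Longrightarrow>
       x - epr F * x * epr F \<in> lspan ((\<lambda>v. vert_minus v {e \<in> F. tail E e = v}) ` verts E)"
proof -
  let ?V = "\<lambda>F. (\<lambda>v. vert_minus v {e \<in> F. tail E e = v}) ` verts E"
  let ?P = "\<lambda>x F0. finite F0 \<and> F0 \<subseteq> arcs E \<and> (n = 0 \<longrightarrow> F0 = {}) \<and>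
    (\<forall>F. finite F \<longrightarrow> F0 \<subseteq> F \<longrightarrow> F \<subseteq> arcs E \<longrightarrow> x - epr F * x * epr F \<in> lspan (?V F))"
  have mon: "\<exists>F0. ?P b F0" if "b \<in> level n" for b
  proof -
    obtain u p u' q w where b: "b = path_elem u p * path_star u' q" and p: "awalk u p w"
      and q: "awalk u' q w" and len: "length p = length q" "length p \<le> n"
      using \<open>b \<in> level n\<close> by (auto simp: level_def)
    note aug = path_aug[OF p] path_aug[OF q]
    show ?thesis
    proof (cases "p = []")
      case True
      then have eq: "q = []" "u = w" "u' = w" "w \<in> verts E" using len p q by (auto simp: awalk_def)
      have "b - epr F * b * epr F \<in> lspan (?V F)" if F: "finite F" "F \<subseteq> arcs E" for F
      proof -
        let ?G = "{e \<in> F. tail E e = w}"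
        have b': "b \<approx> vert w" using vert_vert[of w w] b eq True by simp
        have "epr F * b * epr F \<approx> epr F * vert w * epr F"
          using b' F by (intro eqv_mult_left eqv_mult_right) auto
        also have "\<dots> \<approx> epr ?G * epr F"
          using vert_epr[OF F eq(4)] F by (intro eqv_mult_right) auto
        also have "\<dots> \<approx> epr ?G" using F by (intro epr_mult_subset) auto
        finally have "b - epr F * b * epr F \<approx> vert_minus w ?G"
          unfolding vert_minus_epr by (intro eqv_diff b')
        moreover have "vert_minus w ?G \<in> lspan (?V F)"
          using lspan_base[of "vert_minus w ?G" "?V F" 1] eq by (auto simp: const_simps)
        ultimately show ?thesis by (rule lspan_eqv[rotated])
      qed
      then show ?thesis by (intro exI[of _ "{}"]) auto
    next
      case False
      then have q0: "q \<noteq> []" and n: "n \<noteq> 0" using len by (cases p; auto)+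
      have "b - epr F * b * epr F \<in> lspan (?V F)"
        if F: "finite F" "{hd p, hd q} \<subseteq> F" "F \<subseteq> arcs E" for F
      proof -
        have "epr F * b * epr F = epr F * path_elem u p * (path_star u' q * epr F)"
          by (simp add: b mult.assoc)
        also have "\<dots> \<approx> b" unfolding b
          using F aug epr_path_elem[OF F(1,3) p False] path_star_epr[OF F(1,3) q q0]
          by (intro eqv_mult) auto
        finally have "b - epr F * b * epr F \<approx> b - b" by (intro eqv_diff) auto
        then show ?thesis by (intro lspan_eqv[OF lspan_0]) simp
      qed
      moreover have "{hd p, hd q} \<subseteq> arcs E" using p q False q0 by (auto simp: awalk_def)
      ultimately show ?thesis using n by (intro exI[of _ "{hd p, hd q}"]) auto
    qed
  qed
  have "\<exists>F0. ?P x F0"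
    using assms
  proof (induction x rule: lspan.induct)
    case (zero x)
    have "x - epr F * x * epr F \<in> lspan (?V F)" if "F \<subseteq> arcs E" for F
      using that zero by (intro lspan.zero uideal_diff[OF uideal_rel] uideal_mult_left[OF uideal_rel]
        uideal_mult_right[OF uideal_rel]) auto
    then show ?case by (intro exI[of _ "{}"]) auto
  next
    case (step b x c)
    obtain F1 where F1: "?P b F1" using mon[OF step.hyps(1)] by blast
    obtain F2 where F2: "?P x F2" using step.IH by blast
    have "const c * b + x - epr F * (const c * b + x) * epr F \<in> lspan (?V F)"
      if F: "finite F" "F1 \<union> F2 \<subseteq> F" "F \<subseteq> arcs E" for F
    proof -
      have "const c * (b - epr F * b * epr F) + (x - epr F * x * epr F) \<in> lspan (?V F)"
        using F F1 F2 by (intro lspan_add lspan_scale) auto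
      also have "const c * (b - epr F * b * epr F) + (x - epr F * x * epr F) =
          const c * b + x - epr F * (const c * b + x) * epr F"
        using const_commute[of c "epr F"] by (simp add: algebra_simps flip: mult.assoc)
      finally show ?thesis .
    qed
    then show ?case using F1 F2 by (intro exI[of _ "F1 \<union> F2"]) auto
  qed
  then show ?thesis using that by blast
qed

definition reducible :: "('v, 'e, 'r) ncpoly set \<Rightarrow> ('v, 'e, 'r) ncpoly \<Rightarrow> bool" where
  "reducible J x \<longleftrightarrow> (\<exists>a\<in>uni_alg E. \<exists>b\<in>uni_alg E. \<exists>c u F. u \<in> verts E \<and> finite F \<and> F \<subseteq> out_arcs E u \<and>
     a * x * b - const c * vert_minus u F \<in> J \<and> const c * vert_minus u F \<notin> J)"

lemma reducible_mult:
  assumes "reducible J (a * x * b)" "a \<in> uni_alg E" "b \<in> uni_alg E"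
  shows "reducible J x"
proof -
  obtain a' b' c u F where *: "a' \<in> uni_alg E" "b' \<in> uni_alg E" "u \<in> verts E" "finite F" "F \<subseteq> out_arcs E u"
    "a' * (a * x * b) * b' - const c * vert_minus u F \<in> J" "const c * vert_minus u F \<notin> J"
    using assms(1) unfolding reducible_def by blast
  then have "(a' * a) * x * (b * b') - const c * vert_minus u F \<in> J" by (simp add: mult.assoc)
  then show ?thesis unfolding reducible_def using * assms(2,3) by blast
qed

text \<open>
  The polynomials in the spanning set for different vertices are orthogonal, so that multiplying
  by \<open>v\<close> from both sides isolates one term.
\<close>

lemma reducible_lspan_vert_minus:
  assumes J: "full_ideal J" and x: "x - y \<in> J" "y \<notin> J" and F: "finite F" "F \<subseteq> arcs E"
    and y: "y \<in> lspan ((\<lambda>v. vert_minus v {e \<in> F. tail E e = v}) ` verts E)"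
  shows "reducible J x"
proof -
  note J' = full_idealD(1)[OF J]
  let ?g = "\<lambda>v. vert_minus v {e \<in> F. tail E e = v} :: ('v, 'e, 'r) ncpoly"
  obtain c T where T: "finite T" "T \<subseteq> ?g ` verts E" "y \<approx> (\<Sum>m\<in>T. const (c m) * m)"
    by (rule lspan_sumE[OF y])
  have "(\<Sum>m\<in>T. const (c m) * m) \<notin> J" using x(2) eqv_full_ideal[OF J T(3)] by simp
  then obtain m where m: "m \<in> T" "const (c m) * m \<notin> J"
    using uideal_sum[OF J', of T "\<lambda>m. const (c m) * m"] by auto
  then obtain v where v: "v \<in> verts E" "m = ?g v" using T(2) by auto
  have g: "vert v * ?g w * vert v \<approx> (if v = w then ?g v else 0)" if w: "w \<in> verts E" for w
  proof -
    let ?H = "{e \<in> F. tail E e = w}"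
    have H: "finite ?H" "?H \<subseteq> arcs E" using F by auto
    have HH: "{e \<in> ?H. tail E e = v} = (if v = w then ?H else {})" by auto
    have "vert v * ?g w \<approx> (if v = w then vert v else 0) - epr {e \<in> ?H. tail E e = v}"
      unfolding vert_minus_epr right_diff_distrib
      using v w H by (intro eqv_diff vert_vert vert_epr)
    also have "\<dots> = (if v = w then ?g v else 0)" unfolding HH by (auto simp: vert_minus_epr epr_def)
    finally have 1: "vert v * ?g w \<approx> \<dots>" .
    have "?g v * vert v \<approx> vert v - epr {e \<in> {e \<in> F. tail E e = v}. tail E e = v}"
      unfolding vert_minus_epr left_diff_distrib
      using v F vert_vert[of v v] by (intro eqv_diff vert_epr) auto
    then have 2: "?g v * vert v \<approx> ?g v" by (simp add: vert_minus_epr)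
    from eqv_mult_right[OF 1, of "vert v"] v have
      "vert v * ?g w * vert v \<approx> (if v = w then ?g v * vert v else 0)"
      by (auto simp: if_distrib[of "\<lambda>x. x * _"])
    then show ?thesis using 2 eqv_trans by (auto split: if_splits)
  qed
  have "vert v * y * vert v \<approx> vert v * (\<Sum>m\<in>T. const (c m) * m) * vert v"
    using v T by (intro eqv_mult_right eqv_mult_left) auto
  also have "\<dots> = (\<Sum>m\<in>T. const (c m) * (vert v * m * vert v))"
    by (simp add: sum_distrib_left sum_distrib_right const_commute[of _ "vert v"] flip: mult.assoc)
  also have "\<dots> \<approx> (\<Sum>k\<in>T. const (c k) * (if k = m then m else 0))"
  proof (intro eqv_sum eqv_mult_left)
    fix k assume "k \<in> T"
    then obtain w where w: "w \<in> verts E" "k = ?g w" using T by auto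
    show "vert v * k * vert v \<approx> (if k = m then m else 0)"
    proof (cases "v = w")
      case False
      \<comment> \<open>if two vertices gave the same polynomial, cutting by \<open>v\<close> would show that it vanishes\<close>
      have 1: "vert v * k * vert v \<approx> 0" using g[OF w(1)] w False by simp
      have "k \<noteq> m"
      proof
        assume "k = m"
        then have "m \<approx> vert v * k * vert v" using g[OF v(1)] v by (simp add: eqv_sym)
        also note 1
        finally have "m \<in> J" using full_idealD(2)[OF J] by (simp add: eqv_0_iff)
        then show False using m(2) uideal_mult_left[OF J', of m "const (c m)"] by simp
      qed
      then show ?thesis using 1 by simp
    qed (use g[OF w(1)] w v in simp)
  qed simp
  also have "(\<Sum>k\<in>T. const (c k) * (if k = m then m else 0)) = const (c m) * m"
    using T(1) m(1) by (simp add: if_distrib[of "\<lambda>x. _ * x"] sum.delta cong: if_cong)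
  finally have "vert v * y * vert v - const (c m) * m \<in> J" by (rule eqv_full_ideal_diff[OF J])
  moreover have "vert v * x * vert v - vert v * y * vert v \<in> J"
    using v uideal_mult_right[OF J' uideal_mult_left[OF J' x(1), of "vert v"], of "vert v"]
    by (simp add: algebra_simps)
  ultimately have "vert v * x * vert v - const (c m) * m \<in> J" by (rule uideal_cong_trans[OF J', rotated])
  then show ?thesis
    unfolding reducible_def
    using v m F by (intro bexI[of _ "vert v"] exI[of _ "c m"] exI[of _ v] exI[of _ "{e \<in> F. tail E e = v}"]) auto
qed

text \<open>
  If some \<open>e\<^sup>* x f\<close> lies outside of \<open>J\<close>, it has smaller level.  Otherwise \<open>P x P \<in> J\<close> for the projections
  of the preceding decomposition, and only the vertex part of \<open>x\<close> is left modulo \<open>J\<close>.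
\<close>

lemma reducible_level:
  assumes J: "full_ideal J"
  shows "x \<in> lspan (level n) \<Longrightarrow> x \<notin> J \<Longrightarrow> reducible J x"
proof (induction n arbitrary: x)
  case 0
  obtain F0 where F0: "finite F0" "F0 \<subseteq> arcs E" "(0::nat) = 0 \<Longrightarrow> F0 = {}" "\<And>F. finite F \<Longrightarrow> F0 \<subseteq> F \<Longrightarrow> F \<subseteq> arcs E \<Longrightarrow>
       x - epr F * x * epr F \<in> lspan ((\<lambda>v. vert_minus v {e \<in> F. tail E e = v}) ` verts E)"
    by (rule level_decomposition[OF 0(1)]) blast
  show ?case
    by (rule reducible_lspan_vert_minus[OF J, of x x "{}"])
      (use F0(4)[of "{}"] F0(3) 0 uideal_0[OF full_idealD(1)[OF J]] in \<open>auto simp: epr_def\<close>)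
next
  case (Suc n)
  note J' = full_idealD(1)[OF J]
  show ?case
  proof (cases "\<exists>e\<in>arcs E. \<exists>f\<in>arcs E. ghost e * x * edge f \<notin> J")
    case True
    then obtain e f where ef: "e \<in> arcs E" "f \<in> arcs E" "ghost e * x * edge f \<notin> J" by auto
    have "reducible J (ghost e * x * edge f)"
      by (rule Suc.IH[OF ghost_level_edge[OF Suc.prems(1) ef(1,2)] ef(3)])
    then show ?thesis by (rule reducible_mult) (use ef in auto)
  next
    case False
    obtain F where F: "finite F" "F \<subseteq> arcs E"
      "x - epr F * x * epr F \<in> lspan ((\<lambda>v. vert_minus v {e \<in> F. tail E e = v}) ` verts E)"
      by (rule level_decomposition[OF Suc.prems(1)]) blast
    have "epr F * x * epr F = (\<Sum>e\<in>F. \<Sum>f\<in>F. edge e * (ghost e * x * edge f) * ghost f)"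
      by (simp add: epr_def sum_distrib_left sum_distrib_right mult.assoc) (rule sum.swap)
    also have "\<dots> \<in> J"
    proof (rule uideal_sum[OF J'], rule uideal_sum[OF J'])
      fix e f assume ef: "e \<in> F" "f \<in> F"
      show "edge e * (ghost e * x * edge f) * ghost f \<in> J"
        by (rule uideal_mult_right[OF J' uideal_mult_left[OF J']]) (use ef False F in auto)
    qed
    finally have P: "epr F * x * epr F \<in> J" .
    show ?thesis
    proof (rule reducible_lspan_vert_minus[OF J _ _ F])
      show "x - (x - epr F * x * epr F) \<in> J" using P by simp
      then show "x - epr F * x * epr F \<notin> J" using uideal_cong[OF J'] Suc.prems(2) by blast
    qed
  qed
qed

text \<open>
  In positive degree every monomial begins with an edge.
\<close>

lemma epr_lspan_pos:
  assumes "x \<in> lspan (deg_monomials E k)" "k > 0"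
  shows "\<exists>F0. finite F0 \<and> F0 \<subseteq> arcs E \<and> (\<forall>F. finite F \<longrightarrow> F0 \<subseteq> F \<longrightarrow> F \<subseteq> arcs E \<longrightarrow> epr F * x \<approx> x)"
  using assms(1)
proof (induction x rule: lspan.induct)
  case (zero x)
  then show ?case
    by (intro exI[of _ "{}"])
      (auto simp: eqv_def intro!: uideal_diff[OF uideal_rel] uideal_mult_left[OF uideal_rel])
next
  case (step b x c)
  then obtain F0 where F0: "finite F0" "F0 \<subseteq> arcs E"
    "\<And>F. finite F \<Longrightarrow> F0 \<subseteq> F \<Longrightarrow> F \<subseteq> arcs E \<Longrightarrow> epr F * x \<approx> x" by auto
  obtain u p u' q w where b: "b = path_elem u p * path_star u' q" and p: "awalk u p w"
    and q: "awalk u' q w" and k: "int (length p) - int (length q) = k"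
    using step.hyps(1) by (auto simp: deg_monomials_def)
  have p0: "p \<noteq> []" using k assms(2) by auto
  have "epr F * (const c * b + x) \<approx> const c * b + x"
    if F: "finite F" "insert (hd p) F0 \<subseteq> F" "F \<subseteq> arcs E" for F
  proof -
    have "epr F * path_elem u p * path_star u' q \<approx> b"
      unfolding b using F p0 path_aug[OF q] by (intro eqv_mult_right epr_path_elem[OF _ _ p]) auto
    then have "const c * (epr F * b) \<approx> const c * b"
      by (intro eqv_mult_left) (auto simp: b mult.assoc)
    then have "const c * (epr F * b) + epr F * x \<approx> const c * b + x"
      using F F0(3)[of F] by (intro eqv_add) auto
    then show ?thesis
      using const_commute[of c "epr F"] by (simp add: algebra_simps flip: mult.assoc)
  qed
  then show ?case using F0 p0 p by (intro exI[of _ "insert (hd p) F0"]) (auto simp: awalk_def)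
qed

text \<open>
  In negative degree every monomial ends with a ghost edge.
\<close>

lemma epr_lspan_neg:
  assumes "x \<in> lspan (deg_monomials E k)" "k < 0"
  shows "\<exists>F0. finite F0 \<and> F0 \<subseteq> arcs E \<and> (\<forall>F. finite F \<longrightarrow> F0 \<subseteq> F \<longrightarrow> F \<subseteq> arcs E \<longrightarrow> x * epr F \<approx> x)"
  using assms(1)
proof (induction x rule: lspan.induct)
  case (zero x)
  then show ?case
    by (intro exI[of _ "{}"])
      (auto simp: eqv_def intro!: uideal_diff[OF uideal_rel] uideal_mult_right[OF uideal_rel])
next
  case (step b x c)
  then obtain F0 where F0: "finite F0" "F0 \<subseteq> arcs E"
    "\<And>F. finite F \<Longrightarrow> F0 \<subseteq> F \<Longrightarrow> F \<subseteq> arcs E \<Longrightarrow> x * epr F \<approx> x" by auto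
  obtain u p u' q w where b: "b = path_elem u p * path_star u' q" and p: "awalk u p w"
    and q: "awalk u' q w" and k: "int (length p) - int (length q) = k"
    using step.hyps(1) by (auto simp: deg_monomials_def)
  have q0: "q \<noteq> []" using k assms(2) by auto
  have "(const c * b + x) * epr F \<approx> const c * b + x"
    if F: "finite F" "insert (hd q) F0 \<subseteq> F" "F \<subseteq> arcs E" for F
  proof -
    have "path_elem u p * (path_star u' q * epr F) \<approx> b"
      unfolding b using F q0 path_aug[OF p] by (intro eqv_mult_left path_star_epr[OF _ _ q]) auto
    then have "const c * (b * epr F) \<approx> const c * b"
      by (intro eqv_mult_left) (auto simp: b mult.assoc)
    then have "const c * (b * epr F) + x * epr F \<approx> const c * b + x"
      using F F0(3)[of F] by (intro eqv_add) auto
    then show ?thesis by (simp add: algebra_simps)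
  qed
  then show ?case using F0 q0 q by (intro exI[of _ "insert (hd q) F0"]) (auto simp: awalk_def)
qed

text \<open>
  Multiplication by a suitable \<open>e\<^sup>*\<close> on the left or \<open>e\<close> on the right moves \<open>x\<close> into degree 0 without
  entering \<open>J\<close>, for otherwise \<open>x\<close> itself, a sum of terms \<open>e e\<^sup>* x\<close> or \<open>x e e\<^sup>*\<close>, would lie in \<open>J\<close>.
\<close>

theorem homogeneous_reducible:
  assumes J: "full_ideal J" and "x \<in> aug E" "hom_deg k x" "x \<notin> J"
  shows "reducible J x"
  using assms(2-4)
proof (induction "nat \<bar>k\<bar>" arbitrary: k x)
  case 0
  then show ?case using lspan_deg_0_level hom_deg_lspan reducible_level[OF J] by fastforce
next
  case (Suc n)
  note J' = full_idealD(1)[OF J]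
  note x = hom_deg_lspan[OF Suc.prems(1,2)]
  show ?case
  proof (cases "k > 0")
    case True
    obtain F where F: "finite F" "F \<subseteq> arcs E" "epr F * x \<approx> x"
      using epr_lspan_pos[OF x True] by blast
    have "\<exists>e\<in>F. ghost e * x \<notin> J"
    proof (rule ccontr)
      assume "\<not> ?thesis"
      then have *: "\<forall>e\<in>F. ghost e * x \<in> J" by blast
      have "(\<Sum>e\<in>F. edge e * (ghost e * x)) \<in> J"
        by (rule uideal_sum[OF J'], rule uideal_mult_left[OF J']) (use F * in auto)
      then show False using eqv_full_ideal[OF J F(3)] Suc.prems(3)
        by (simp add: epr_def sum_distrib_right mult.assoc)
    qed
    then obtain e where e: "e \<in> arcs E" "ghost e * x \<notin> J" using F by auto
    have "reducible J (ghost e * x)"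
    proof (rule Suc.hyps(1))
      show "n = nat \<bar>-1 + k\<bar>" using Suc.hyps(2) True by simp
      show "hom_deg (-1 + k) (ghost e * x)" using Suc.prems by (intro hom_deg_mult) auto
    qed (use e Suc.prems in auto)
    then show ?thesis using reducible_mult[of J "ghost e" x 1] e by simp
  next
    case False
    then have k: "k < 0" using Suc.hyps(2) by simp
    obtain F where F: "finite F" "F \<subseteq> arcs E" "x * epr F \<approx> x"
      using epr_lspan_neg[OF x k] by blast
    have "\<exists>e\<in>F. x * edge e \<notin> J"
    proof (rule ccontr)
      assume "\<not> ?thesis"
      then have *: "\<forall>e\<in>F. x * edge e \<in> J" by blast
      have "(\<Sum>e\<in>F. (x * edge e) * ghost e) \<in> J"
        by (rule uideal_sum[OF J'], rule uideal_mult_right[OF J']) (use F * in auto)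
      then show False using eqv_full_ideal[OF J F(3)] Suc.prems(3)
        by (simp add: epr_def sum_distrib_left mult.assoc)
    qed
    then obtain e where e: "e \<in> arcs E" "x * edge e \<notin> J" using F by auto
    have "reducible J (x * edge e)"
    proof (rule Suc.hyps(1))
      show "n = nat \<bar>k + 1\<bar>" using Suc.hyps(2) k by simp
      show "hom_deg (k + 1) (x * edge e)" using Suc.prems by (intro hom_deg_mult) auto
    qed (use e Suc.prems in auto)
    then show ?thesis using reducible_mult[of J 1 x "edge e"] e by simp
  qed
qed

end

section \<open>The ideals attached to hereditary saturated sets\<close>

context leavitt
begin

definition outside :: "'v set \<Rightarrow> 'v \<Rightarrow> 'e set" where
  "outside H v = {e \<in> out_arcs E v. head E e \<notin> H}"

text \<open>
  The element \<open>v\<^sup>H\<close> of the definition of \<open>I(H,S)\<close>.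
\<close>

definition gap :: "'v set \<Rightarrow> 'v \<Rightarrow> ('v, 'e, 'r) ncpoly" where
  "gap H v = vert_minus v (outside H v)"

text \<open>
  The polynomials that represent elements of \<open>I(H,S)\<close>.
\<close>

definition hs_ideal :: "'v set \<Rightarrow> 'v set \<Rightarrow> ('v, 'e, 'r) ncpoly set" where
  "hs_ideal H S = ugen E (relators E \<union> (vert ` H \<union> gap H ` S))"

lemma outside_arcs: "outside H v \<subseteq> arcs E" "e \<in> outside H v \<Longrightarrow> tail E e = v"
  by (auto simp: outside_def)

lemma breaking_iff: "v \<in> breaking E H \<longleftrightarrow> v \<in> verts E - H \<and> infinite (out_arcs E v) \<and>
    finite (outside H v) \<and> outside H v \<noteq> {}"
  by (auto simp: breaking_def infinite_emitter_def outside_def)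

lemma gap_aug: "v \<in> verts E \<Longrightarrow> gap H v \<in> aug E"
  unfolding gap_def by (rule vert_minus_aug) (auto simp: outside_def)

lemma hs_generators_aug: "H \<subseteq> verts E \<Longrightarrow> S \<subseteq> breaking E H \<Longrightarrow> vert ` H \<union> gap H ` S \<subseteq> aug E"
  using gap_aug by (auto simp: breaking_iff)

lemma full_hs_ideal:
  assumes "H \<subseteq> verts E" "S \<subseteq> breaking E H"
  shows "full_ideal (hs_ideal H S)"
  using assms hs_generators_aug[OF assms] relators_aug uideal_ugen[of "relators E \<union> (vert ` H \<union> gap H ` S)" E]
  unfolding full_ideal_def rel_ideal_eq_ugen hs_ideal_def by (auto simp: ugen_def)

lemma hs_ideal_generators:
  "v \<in> H \<Longrightarrow> vert v \<in> hs_ideal H S" "v \<in> S \<Longrightarrow> gap H v \<in> hs_ideal H S"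
  unfolding hs_ideal_def by (auto intro!: subsetD[OF ugen_superset])

lemma hpart_closed_hs_ideal:
  assumes "H \<subseteq> verts E" "S \<subseteq> breaking E H"
  shows "hpart_closed (hs_ideal H S)"
  unfolding hs_ideal_def
proof (rule hpart_closed_ugen)
  show "relators E \<union> (vert ` H \<union> gap H ` S) \<subseteq> aug E"
    using hs_generators_aug[OF assms] relators_aug by auto
  show "\<exists>k. hom_deg k x" if "x \<in> relators E \<union> (vert ` H \<union> gap H ` S)" for x
    using that
  proof (elim UnE imageE)
    show "\<exists>k. hom_deg k x" if "x = vert v" for v using that by (intro exI[of _ 0]) simp
    show "\<exists>k. hom_deg k x" if "x = gap H v" for v
      using that hom_deg_vert_minus by (intro exI[of _ 0]) (simp add: gap_def)
  qed (rule hom_deg_relators)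
qed

lemma lift_ideal_HS:
  assumes "H \<subseteq> verts E" "S \<subseteq> breaking E H"
  shows "rng_ideal (ideal_HS E H S :: ('v, 'e, 'r) lpa_elem set) (lpa E)"
    "lift_ideal (ideal_HS E H S) = hs_ideal H S"
proof -
  have "ideal_HS E H S = rng_genideal (lpa E) (lpa_cls E ` (vert ` H \<union> gap H ` S))"
    unfolding ideal_HS_def image_Un image_image gap_def outside_def Setcompr_eq_image ..
  then show "rng_ideal (ideal_HS E H S :: ('v, 'e, 'r) lpa_elem set) (lpa E)"
    "lift_ideal (ideal_HS E H S) = hs_ideal H S"
    using lift_rng_genideal[OF hs_generators_aug[OF assms]] by (simp_all add: hs_ideal_def)
qed

lemma vert_vert_minus:
  assumes "u \<in> verts E" "finite F" "F \<subseteq> out_arcs E u"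
  shows "vert u * vert_minus u F \<approx> vert_minus u F" "vert_minus u F * vert u \<approx> vert_minus u F"
proof -
  have F: "F \<subseteq> arcs E" "{e \<in> F. tail E e = u} = F" using assms(3) by auto
  have "vert u * vert_minus u F \<approx> vert u - epr {e \<in> F. tail E e = u}"
    unfolding vert_minus_epr right_diff_distrib
    using vert_vert[of u u] assms F by (intro eqv_diff vert_epr) auto
  then show "vert u * vert_minus u F \<approx> vert_minus u F" by (simp add: F vert_minus_epr)
  have "vert_minus u F * vert u \<approx> vert u - epr {e \<in> F. tail E e = u}"
    unfolding vert_minus_epr left_diff_distrib
    using vert_vert[of u u] assms F by (intro eqv_diff vert_epr) auto
  then show "vert_minus u F * vert u \<approx> vert_minus u F" by (simp add: F vert_minus_epr)
qed

lemma epr_in_ideal: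
  assumes J: "full_ideal J" and F: "F \<subseteq> arcs E" "\<And>e. e \<in> F \<Longrightarrow> vert (head E e) \<in> J"
  shows "epr F \<in> J"
  unfolding epr_def
proof (rule uideal_sum[OF full_idealD(1)[OF J]])
  fix e assume e: "e \<in> F"
  have eq: "edge e * vert (head E e) * ghost e \<approx> edge e * ghost e"
    using e F by (intro eqv_mult_right edge_head) auto
  have "edge e * vert (head E e) * ghost e \<in> J"
    by (rule uideal_mult_right[OF full_idealD(1)[OF J]], rule uideal_mult_left[OF full_idealD(1)[OF J]])
      (use e F in auto)
  then show "edge e * ghost e \<in> J" using eqv_full_ideal[OF J eq] by simp
qed

text \<open>
  Modulo \<open>J\<close>, the element \<open>z\<close> is a two-sided multiple of \<open>x\<close> with a single term, as opposed to
  an arbitrary element of the ideal generated by \<open>x\<close>.  If \<open>x\<close> and \<open>y\<close> compress to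
  elements whose product is not in \<open>J\<close>, then some \<open>x a y\<close> is not in \<open>J\<close>.
\<close>

definition compresses_to :: "('v, 'e, 'r) ncpoly set \<Rightarrow> ('v, 'e, 'r) ncpoly \<Rightarrow> ('v, 'e, 'r) ncpoly \<Rightarrow> bool" where
  "compresses_to J x z \<longleftrightarrow> (\<exists>a\<in>uni_alg E. \<exists>b\<in>uni_alg E. a * x * b - z \<in> J)"

lemma compresses_toI: "a * x * b - z \<in> J \<Longrightarrow> a \<in> uni_alg E \<Longrightarrow> b \<in> uni_alg E \<Longrightarrow> compresses_to J x z"
  unfolding compresses_to_def by blast

lemma compresses_to_cong: "full_ideal J \<Longrightarrow> x - z \<in> J \<Longrightarrow> compresses_to J x z"
  using compresses_toI[of 1 x 1 z J] by simp

lemma compresses_to_trans: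
  assumes J: "full_ideal J" and "compresses_to J x y" "compresses_to J y z"
  shows "compresses_to J x z"
proof -
  note J' = full_idealD(1)[OF J]
  obtain a b where ab: "a \<in> uni_alg E" "b \<in> uni_alg E" "a * x * b - y \<in> J"
    using assms(2) unfolding compresses_to_def by blast
  obtain c d where cd: "c \<in> uni_alg E" "d \<in> uni_alg E" "c * y * d - z \<in> J"
    using assms(3) unfolding compresses_to_def by blast
  have "c * (a * x * b - y) * d \<in> J"
    by (rule uideal_mult_right[OF J' uideal_mult_left[OF J']]) (use ab cd in auto)
  then have "(c * a) * x * (b * d) - c * y * d \<in> J" by (simp add: algebra_simps)
  from uideal_cong_trans[OF J' this cd(3)] show ?thesis
    by (rule compresses_toI) (use ab cd in auto)
qed

lemma compresses_to_const:
  assumes J: "full_ideal J" and "compresses_to J x y"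
  shows "compresses_to J (const c * x) (const c * y)"
proof -
  obtain a b where ab: "a \<in> uni_alg E" "b \<in> uni_alg E" "a * x * b - y \<in> J"
    using assms(2) unfolding compresses_to_def by blast
  have "const c * (a * x * b - y) \<in> J"
    by (rule uideal_mult_left[OF full_idealD(1)[OF J] ab(3)]) simp
  also have "const c * (a * x * b - y) = a * (const c * x) * b - const c * y"
    using const_commute[of c a] by (simp add: right_diff_distrib flip: mult.assoc)
  finally show ?thesis by (rule compresses_toI) (use ab in auto)
qed

lemma compresses_to_mem:
  assumes J: "full_ideal J" and "compresses_to J x y" "x \<in> J"
  shows "y \<in> J"
proof -
  note J' = full_idealD(1)[OF J]
  obtain a b where ab: "a \<in> uni_alg E" "b \<in> uni_alg E" "a * x * b - y \<in> J"
    using assms(2) unfolding compresses_to_def by blast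
  have "a * x * b \<in> J" by (rule uideal_mult_right[OF J' uideal_mult_left[OF J']]) (use ab assms in auto)
  then show ?thesis using uideal_cong[OF J' ab(3)] by simp
qed

lemma compresses_to_mono: "J \<subseteq> I \<Longrightarrow> compresses_to J x y \<Longrightarrow> compresses_to I x y"
  unfolding compresses_to_def by blast

lemma compresses_to_path:
  assumes J: "full_ideal J" and p: "awalk w p y"
  shows "compresses_to J (vert w) (vert y)"
proof -
  note aug = path_aug[OF p]
  have w: "w \<in> verts E" using p by auto
  have "path_star w p * vert w * path_elem w p \<approx> path_star w p * path_elem w p"
    unfolding mult.assoc using vert_path_elem[OF p w] aug by (intro eqv_mult_left) auto
  also have "\<dots> \<approx> vert y" by (rule path_star_path_elem[OF p])
  finally show ?thesis by (intro compresses_toI[OF eqv_full_ideal_diff[OF J]]) (use aug in auto)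
qed

text \<open>
  If an edge \<open>e\<close> from \<open>u\<close> with range outside of \<open>H\<close> is missing in \<open>F\<close>, then \<open>e\<^sup>* p e\<close> is the range of
  \<open>e\<close>, where \<open>p\<close> is the given element.  If none is missing, the edges in \<open>F\<close> with range in \<open>H\<close> may
  be dropped modulo \<open>J\<close>, and what remains is \<open>u\<^sup>H\<close>.  It is the vertex \<open>u\<close> if no edge is left, it
  lies in \<open>J\<close> if \<open>u\<close> is regular, and otherwise \<open>u\<close> is a breaking vertex.
\<close>

lemma vert_minus_compresses:
  assumes J: "full_ideal J" and H: "\<And>v. v \<in> H \<Longrightarrow> vert v \<in> J" "\<And>v. v \<in> S \<Longrightarrow> gap H v \<in> J"
    and u: "u \<in> verts E" and F: "finite F" "F \<subseteq> out_arcs E u" and notin: "vert_minus u F \<notin> J"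
  shows "(\<exists>w\<in>verts E - H. compresses_to J (vert_minus u F) (vert w)) \<or>
     (\<exists>w\<in>breaking E H - S. compresses_to J (vert_minus u F) (gap H w))"
proof -
  note J' = full_idealD(1)[OF J]
  have FE: "F \<subseteq> arcs E" using F by auto
  show ?thesis
  proof (cases "\<exists>e\<in>out_arcs E u - F. head E e \<notin> H")
    case True
    then obtain e where e: "e \<in> arcs E" "tail E e = u" "e \<notin> F" "head E e \<notin> H" by auto
    have "ghost e * vert_minus u F \<approx> ghost e - 0"
      unfolding vert_minus_epr right_diff_distrib
      using e u FE F ghost_tail[of e] ghost_epr[of F e] by (intro eqv_diff) auto
    then have "ghost e * vert_minus u F * edge e \<approx> ghost e * edge e"
      using e by (intro eqv_mult_right) auto
    also have "\<dots> \<approx> vert (head E e)" using ghost_edge[of e e] e by simp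
    finally have "compresses_to J (vert_minus u F) (vert (head E e))"
      by (intro compresses_toI[OF eqv_full_ideal_diff[OF J]]) (use e in auto)
    then show ?thesis using e by auto
  next
    case False
    let ?K = "outside H u"
    have K: "?K \<subseteq> F" using False by (auto simp: outside_def)
    then have finK: "finite ?K" using F finite_subset by auto
    have diff: "vert_minus u ?K - vert_minus u G \<in> J" if "?K \<subseteq> G" "G \<subseteq> out_arcs E u" "finite G" for G
    proof -
      have "epr (G - ?K) \<in> J"
        using that by (intro epr_in_ideal[OF J]) (auto simp: outside_def intro: H)
      moreover have "epr G = epr (G - ?K) + epr ?K"
        using that by (simp add: epr_def sum.subset_diff)
      ultimately show ?thesis by (simp add: vert_minus_epr)
    qed
    have cong: "vert_minus u F - gap H u \<in> J"
      unfolding gap_def using diff[OF K F(2,1)] by (rule uideal_cong_sym[OF J'])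
    have uH: "u \<notin> H"
    proof
      assume "u \<in> H"
      then have "vert u * vert_minus u F \<in> J"
        using H(1) vert_minus_aug[OF u FE] by (intro uideal_mult_right[OF J']) auto
      then show False using notin eqv_full_ideal[OF J vert_vert_minus(1)[OF u F]] by simp
    qed
    show ?thesis
    proof (cases "?K = {}")
      case True
      then have "compresses_to J (vert_minus u F) (vert u)"
        using cong by (intro compresses_to_cong[OF J]) (simp add: gap_def vert_minus_def)
      then show ?thesis using u uH by auto
    next
      case ne: False
      have "infinite (out_arcs E u)"
      proof
        assume fin: "finite (out_arcs E u)"
        then have "regular_vertex E u" using ne u by (auto simp: regular_vertex_def outside_def)
        then have "vert_minus u (out_arcs E u) \<in> J" using regular_rel full_idealD(2)[OF J] by blast
        then have "gap H u \<in> J"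
          using uideal_cong[OF J' diff[of "out_arcs E u"]] fin unfolding gap_def
          by (auto simp: outside_def subset_iff)
        then show False using uideal_cong[OF J' cong] notin by simp
      qed
      then have "u \<in> breaking E H" using ne u uH finK by (simp add: breaking_iff)
      moreover have "u \<notin> S" using H(2)[of u] uideal_cong[OF J' cong] notin by auto
      ultimately show ?thesis using compresses_to_cong[OF J cong] by auto
    qed
  qed
qed

lemma homogeneous_compresses:
  assumes J: "full_ideal J" and H: "\<And>v. v \<in> H \<Longrightarrow> vert v \<in> J" "\<And>v. v \<in> S \<Longrightarrow> gap H v \<in> J"
    and x: "x \<in> aug E" "hom_deg k x" "x \<notin> J"
  obtains c u F where "c \<noteq> 0" "u \<in> verts E" "finite F" "F \<subseteq> out_arcs E u"
    "compresses_to J x (const c * vert_minus u F)" "vert_minus u F \<notin> J"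
proof -
  obtain a b c u F where *: "a \<in> uni_alg E" "b \<in> uni_alg E" "u \<in> verts E" "finite F" "F \<subseteq> out_arcs E u"
    "a * x * b - const c * vert_minus u F \<in> J" "const c * vert_minus u F \<notin> J"
    using homogeneous_reducible[OF J x] unfolding reducible_def by blast
  have "c \<noteq> 0" using *(7) uideal_0[OF full_idealD(1)[OF J]] by (auto simp: const_simps)
  moreover have "vert_minus u F \<notin> J"
    using *(7) uideal_mult_left[OF full_idealD(1)[OF J], of "vert_minus u F" "const c"] by auto
  moreover have "compresses_to J x (const c * vert_minus u F)" by (rule compresses_toI[OF *(6,1,2)])
  ultimately show ?thesis using that * by blast
qed

end

section \<open>A representation by branching\<close>

fun word_op :: "('g \<Rightarrow> ('x \<Rightarrow> 'r) \<Rightarrow> 'x \<Rightarrow> 'r) \<Rightarrow> 'g list \<Rightarrow> ('x \<Rightarrow> 'r) \<Rightarrow> 'x \<Rightarrow> 'r" where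
  "word_op G [] \<phi> = \<phi>"
| "word_op G (g # w) \<phi> = G g (word_op G w \<phi>)"

lemma word_op_append: "word_op G (u @ w) \<phi> = word_op G u (word_op G w \<phi>)"
  by (induction u) auto

text \<open>
  The action of polynomials when a generator \<open>g\<close> acts by the operator \<open>G g\<close>.  The operators are
  maps on all functions from a set to the ring, so that no basis has to be chosen.
\<close>

definition poly_op :: "(('v, 'e) gen \<Rightarrow> ('x \<Rightarrow> 'r::comm_ring_1) \<Rightarrow> 'x \<Rightarrow> 'r) \<Rightarrow> ('v, 'e, 'r) ncpoly
    \<Rightarrow> ('x \<Rightarrow> 'r) \<Rightarrow> 'x \<Rightarrow> 'r" where
  "poly_op G p \<phi> x = (\<Sum>w\<in>Poly_Mapping.keys p. Poly_Mapping.lookup p w * word_op G (letters w) \<phi> x)"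

locale gen_ops =
  fixes G :: "('v, 'e) gen \<Rightarrow> ('x \<Rightarrow> 'r::comm_ring_1) \<Rightarrow> 'x \<Rightarrow> 'r"
  assumes G_add: "G g (\<lambda>x. \<phi> x + \<psi> x) = (\<lambda>x. G g \<phi> x + G g \<psi> x)"
    and G_scale: "G g (\<lambda>x. c * \<phi> x) = (\<lambda>x. c * G g \<phi> x)"
begin

lemma word_op_add: "word_op G w (\<lambda>x. \<phi> x + \<psi> x) = (\<lambda>x. word_op G w \<phi> x + word_op G w \<psi> x)"
  by (induction w) (simp_all add: G_add)

lemma word_op_scale: "word_op G w (\<lambda>x. c * \<phi> x) = (\<lambda>x. c * word_op G w \<phi> x)"
  by (induction w) (simp_all add: G_scale)

lemma word_op_zero: "word_op G w (\<lambda>x. 0) = (\<lambda>x. 0)"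
  using word_op_scale[of w 0 "\<lambda>x. 0"] by simp

lemma poly_op_superset:
  "finite A \<Longrightarrow> Poly_Mapping.keys p \<subseteq> A \<Longrightarrow>
    poly_op G p \<phi> x = (\<Sum>w\<in>A. Poly_Mapping.lookup p w * word_op G (letters w) \<phi> x)"
  unfolding poly_op_def by (intro sum.mono_neutral_left) (auto simp: in_keys_iff)

lemma poly_op_0 [simp]: "poly_op G 0 \<phi> x = 0"
  by (simp add: poly_op_def)

lemma poly_op_add: "poly_op G (p + q) \<phi> x = poly_op G p \<phi> x + poly_op G q \<phi> x"
proof -
  let ?A = "Poly_Mapping.keys p \<union> Poly_Mapping.keys q"
  have *: "finite ?A" "Poly_Mapping.keys p \<subseteq> ?A" "Poly_Mapping.keys q \<subseteq> ?A" "Poly_Mapping.keys (p + q) \<subseteq> ?A"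
    using keys_add[of p q] by auto
  show ?thesis
    by (simp only: poly_op_superset[OF *(1,2)] poly_op_superset[OF *(1,3)] poly_op_superset[OF *(1,4)]
        lookup_add distrib_right sum.distrib)
qed

lemma poly_op_single: "poly_op G (Poly_Mapping.single w c) \<phi> x = c * word_op G (letters w) \<phi> x"
  by (cases "c = 0") (simp_all add: poly_op_def)

lemma poly_op_zero_fun: "poly_op G p (\<lambda>x. 0) x = 0"
  by (simp add: poly_op_def word_op_zero)

lemma poly_op_single_mult:
  "poly_op G (Poly_Mapping.single w c * q) \<phi> x = c * word_op G (letters w) (poly_op G q \<phi>) x"
proof (induction q rule: poly_mapping_additive_induct)
  case zero
  have "poly_op G 0 \<phi> = (\<lambda>x. 0)" by (rule ext) simp
  then show ?case by (simp add: word_op_zero)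
next
  case (add q v d)
  have "poly_op G (q + Poly_Mapping.single v d) \<phi> = (\<lambda>x. poly_op G q \<phi> x + d * word_op G (letters v) \<phi> x)"
    by (rule ext) (simp add: poly_op_add poly_op_single)
  then show ?case
    by (simp add: distrib_left mult_single poly_op_add poly_op_single add word_op_append
        word_op_add word_op_scale mult.assoc)
qed

lemma poly_op_mult: "poly_op G (p * q) \<phi> x = poly_op G p (poly_op G q \<phi>) x"
proof (induction p rule: poly_mapping_additive_induct)
  case (add p w c)
  then show ?case by (simp add: distrib_right poly_op_add poly_op_single poly_op_single_mult)
qed simp

lemma poly_op_diff: "poly_op G (p - q) \<phi> x = poly_op G p \<phi> x - poly_op G q \<phi> x"
  using poly_op_add[of "p - q" q \<phi> x] by simp

lemma poly_op_sum: "poly_op G (sum f A) \<phi> x = (\<Sum>i\<in>A. poly_op G (f i) \<phi> x)"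
  by (induction A rule: infinite_finite_induct) (simp_all add: poly_op_add)

lemma poly_op_gen: "poly_op G (gen_elem g) \<phi> = G g \<phi>"
  by (rule ext) (simp add: gen_elem_def poly_op_single)

lemma poly_op_const: "poly_op G (const c * p) \<phi> x = c * poly_op G p \<phi> x"
  by (simp add: const_def poly_op_single_mult)

lemma poly_op_vert_minus:
  "poly_op G (vert_minus v F) \<phi> x = G (Vertex v) \<phi> x - (\<Sum>e\<in>F. G (Edge e) (G (Ghost e) \<phi>) x)"
  by (simp add: vert_minus_def poly_op_diff poly_op_sum poly_op_mult poly_op_gen)

lemma uideal_kernel: "uideal E {p \<in> aug E. \<forall>\<phi> x. poly_op G p \<phi> x = 0}"
proof (rule uidealI)
  fix p a :: "('v, 'e, 'r) ncpoly" assume p: "p \<in> {p \<in> aug E. \<forall>\<phi> x. poly_op G p \<phi> x = 0}" and a: "a \<in> uni_alg E"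
  have "poly_op G p \<phi> = (\<lambda>x. 0)" for \<phi> using p by auto
  then show "a * p \<in> {p \<in> aug E. \<forall>\<phi> x. poly_op G p \<phi> x = 0}"
    "p * a \<in> {p \<in> aug E. \<forall>\<phi> x. poly_op G p \<phi> x = 0}"
    using p a by (auto simp: poly_op_mult poly_op_zero_fun)
qed (auto simp: poly_op_add)

end

context leavitt
begin

definition hereditary :: "'v set \<Rightarrow> bool" where
  "hereditary H \<longleftrightarrow> H \<subseteq> verts E \<and> (\<forall>e\<in>arcs E. tail E e \<in> H \<longrightarrow> head E e \<in> H)"

definition saturated :: "'v set \<Rightarrow> bool" where
  "saturated H \<longleftrightarrow> (\<forall>v. regular_vertex E v \<longrightarrow> head E ` out_arcs E v \<subseteq> H \<longrightarrow> v \<in> H)"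

text \<open>
  The point \<open>(v, n)\<close> is to lie in the domain of the vertex \<open>v\<close>.  An edge \<open>e\<close> maps the domain of its
  range injectively into that of its source, by \<open>(r(e), m) \<mapsto> (s(e), g e m)\<close>, with disjoint images for
  different edges.  The images must exhaust the domain of \<open>v\<close> if \<open>v\<close> is regular or in \<open>S\<close>, and leave
  something over if not.  Since there are countably many edges, such injections of the natural
  numbers exist; that \<open>H\<close> is saturated guarantees an edge where the domain has to be exhausted.
\<close>

lemma branching_exists:
  assumes "countable (arcs E)" "hereditary H" "saturated H" "S \<subseteq> breaking E H"
  obtains g :: "'e \<Rightarrow> nat \<Rightarrow> nat" where
    "\<forall>e\<in>arcs E. \<forall>f\<in>arcs E. tail E e = tail E f \<longrightarrow> head E e \<notin> H \<longrightarrow> head E f \<notin> H \<longrightarrow>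
       (\<forall>m n. g e m = g f n \<longrightarrow> e = f \<and> m = n)"
    "\<forall>v\<in>verts E - H. regular_vertex E v \<or> v \<in> S \<longrightarrow> (\<forall>n. \<exists>e\<in>outside H v. n \<in> range (g e))"
    "\<forall>v\<in>verts E - H. \<not> (regular_vertex E v \<or> v \<in> S) \<longrightarrow> (\<exists>n. \<forall>e\<in>outside H v. n \<notin> range (g e))"
proof -
  let ?A = "\<lambda>v. outside H v \<times> (UNIV :: nat set)"
  have "\<exists>h :: 'e \<times> nat \<Rightarrow> nat. inj_on h (?A v) \<and> (if regular_vertex E v \<or> v \<in> S then h ` ?A v = UNIV else 0 \<notin> h ` ?A v)"
    if v: "v \<in> verts E - H" for v
  proof (cases "regular_vertex E v \<or> v \<in> S")
    case True
    then have ne: "outside H v \<noteq> {}"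
      using assms(3,4) v by (auto simp: saturated_def outside_def breaking_def)
    have "countable (outside H v)" using assms(1) outside_arcs(1) countable_subset by blast
    then have "countable (?A v)" by auto
    moreover have "infinite (?A v)" using ne by (auto simp: finite_cartesian_product_iff)
    ultimately have "bij_betw (to_nat_on (?A v)) (?A v) UNIV" by (rule to_nat_on_infinite)
    then show ?thesis using True by (intro exI[of _ "to_nat_on (?A v)"]) (simp add: bij_betw_def)
  next
    case False
    have "countable (outside H v)" using assms(1) outside_arcs(1) countable_subset by blast
    then have "countable (?A v)" by auto
    then have "inj_on (to_nat_on (?A v)) (?A v)" by (rule inj_on_to_nat_on)
    \<comment> \<open>shifting the enumeration leaves the number 0 outside of all images\<close>
    then have inj: "inj_on (Suc \<circ> to_nat_on (?A v)) (?A v)" by (intro comp_inj_on) auto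
    have "0 \<notin> (Suc \<circ> to_nat_on (?A v)) ` ?A v" by auto
    then show ?thesis using False inj by (intro exI[of _ "Suc \<circ> to_nat_on (?A v)"]) simp
  qed
  then have "\<forall>v\<in>verts E - H. \<exists>h :: 'e \<times> nat \<Rightarrow> nat. inj_on h (?A v) \<and>
      (if regular_vertex E v \<or> v \<in> S then h ` ?A v = UNIV else 0 \<notin> h ` ?A v)" by blast
  from bchoice[OF this] obtain h :: "'v \<Rightarrow> 'e \<times> nat \<Rightarrow> nat" where
    h': "\<forall>v\<in>verts E - H. inj_on (h v) (?A v) \<and>
      (if regular_vertex E v \<or> v \<in> S then h v ` ?A v = UNIV else 0 \<notin> h v ` ?A v)" by (rule exE)
  have h: "inj_on (h v) (?A v)"
    "regular_vertex E v \<or> v \<in> S \<Longrightarrow> h v ` ?A v = UNIV"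
    "\<not> (regular_vertex E v \<or> v \<in> S) \<Longrightarrow> 0 \<notin> h v ` ?A v" if "v \<in> verts E - H" for v
    using bspec[OF h' that] by (simp_all split: if_splits)
  define g where "g e m = h (tail E e) (e, m)" for e and m :: nat
  show ?thesis
  proof (rule that[of g]; intro ballI impI allI)
    fix e f m n assume *: "e \<in> arcs E" "f \<in> arcs E" "tail E e = tail E f" "head E e \<notin> H" "head E f \<notin> H"
      "g e m = g f n"
    have "tail E e \<notin> H" using assms(2) * by (auto simp: hereditary_def)
    then have "inj_on (h (tail E e)) (?A (tail E e))" using h(1) * by auto
    moreover have "(e, m) \<in> ?A (tail E e)" "(f, n) \<in> ?A (tail E e)" using * by (auto simp: outside_def)
    ultimately show "e = f \<and> m = n" using * inj_onD[of "h (tail E e)" "?A (tail E e)" "(e, m)" "(f, n)"]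
      by (simp add: g_def)
  next
    fix v n assume v: "v \<in> verts E - H" "regular_vertex E v \<or> v \<in> S"
    then have "n \<in> h v ` ?A v" using h(2) by simp
    then obtain e m where "e \<in> outside H v" "n = h v (e, m)" by auto
    then show "\<exists>e\<in>outside H v. n \<in> range (g e)" using outside_arcs(2) by (auto simp: g_def)
  next
    fix v assume v: "v \<in> verts E - H" "\<not> (regular_vertex E v \<or> v \<in> S)"
    then have 0: "0 \<notin> h v ` ?A v" by (rule h(3))
    have "0 \<notin> range (g e)" if e: "e \<in> outside H v" for e
    proof
      assume "0 \<in> range (g e)"
      then obtain m where "0 = h v (e, m)" using outside_arcs(2)[OF e] by (auto simp: g_def)
      moreover have "h v (e, m) \<in> h v ` ?A v" using e by blast
      ultimately show False using 0 by simp
    qed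
    then show "\<exists>n. \<forall>e\<in>outside H v. n \<notin> range (g e)" by blast
  qed
qed

fun branch_op :: "'v set \<Rightarrow> ('e \<Rightarrow> nat \<Rightarrow> nat) \<Rightarrow> ('v, 'e) gen \<Rightarrow> ('v \<times> nat \<Rightarrow> 'r) \<Rightarrow> 'v \<times> nat \<Rightarrow> 'r" where
  "branch_op H g (Vertex v) \<phi> = (\<lambda>x. if fst x = v \<and> v \<notin> H then \<phi> x else 0)"
| "branch_op H g (Edge e) \<phi> = (\<lambda>x. if head E e \<notin> H \<and> fst x = tail E e \<and> snd x \<in> range (g e)
     then \<phi> (head E e, inv_into UNIV (g e) (snd x)) else 0)"
| "branch_op H g (Ghost e) \<phi> = (\<lambda>x. if head E e \<notin> H \<and> fst x = head E e
     then \<phi> (tail E e, g e (snd x)) else 0)"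

lemma gen_ops_branch_op: "gen_ops (branch_op H g)"
proof
  show "branch_op H g a (\<lambda>x. \<phi> x + \<psi> x) = (\<lambda>x. branch_op H g a \<phi> x + branch_op H g a \<psi> x)" for a \<phi> \<psi>
    by (cases a) auto
  show "branch_op H g a (\<lambda>x. c * \<phi> x) = (\<lambda>x. c * branch_op H g a \<phi> x)" for a c \<phi>
    by (cases a) auto
qed

text \<open>
  Vertices in \<open>H\<close> act by 0, and for \<open>v \<in> S\<close> the images of the edges that leave \<open>v\<close> to a vertex outside
  of \<open>H\<close> exhaust the domain of \<open>v\<close>, so that \<open>v\<^sup>H\<close> acts by 0 as well.
\<close>

lemma hs_ideal_representation:
  assumes "countable (arcs E)" "hereditary H" "saturated H" "S \<subseteq> breaking E H"
  obtains g where "\<forall>p\<in>hs_ideal H S. \<forall>\<phi> x. poly_op (branch_op H g) p \<phi> x = 0"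
    "\<forall>v\<in>verts E - H. \<not> (regular_vertex E v \<or> v \<in> S) \<longrightarrow> (\<exists>n. \<forall>e\<in>outside H v. n \<notin> range (g e))"
proof -
  obtain g :: "'e \<Rightarrow> nat \<Rightarrow> nat" where
    inj': "\<forall>e\<in>arcs E. \<forall>f\<in>arcs E. tail E e = tail E f \<longrightarrow> head E e \<notin> H \<longrightarrow> head E f \<notin> H \<longrightarrow>
       (\<forall>m n. g e m = g f n \<longrightarrow> e = f \<and> m = n)"
    and tight: "\<forall>v\<in>verts E - H. regular_vertex E v \<or> v \<in> S \<longrightarrow> (\<forall>n. \<exists>e\<in>outside H v. n \<in> range (g e))"
    and loose: "\<forall>v\<in>verts E - H. \<not> (regular_vertex E v \<or> v \<in> S) \<longrightarrow> (\<exists>n. \<forall>e\<in>outside H v. n \<notin> range (g e))"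
    by (rule branching_exists[OF assms])
  have inj: "e = f \<and> m = n" if "e \<in> arcs E" "f \<in> arcs E" "tail E e = tail E f" "head E e \<notin> H" "head E f \<notin> H"
    "g e m = g f n" for e f m n
    using inj' that by blast
  interpret gen_ops "branch_op H g" by (rule gen_ops_branch_op)
  let ?K = "{p \<in> aug E. \<forall>\<phi> x. poly_op (branch_op H g) p \<phi> x = 0}"
  have tailH: "tail E e \<notin> H" if "e \<in> arcs E" "head E e \<notin> H" for e
    using assms(2) that by (auto simp: hereditary_def)
  have inv_g: "inv_into UNIV (g e) (g e m) = m" if "e \<in> arcs E" "head E e \<notin> H" for e m
    using inj[of e e] that by (intro inv_into_f_f injI) blast+
  have disj: "g e m \<notin> range (g f)"
    if "e \<in> arcs E" "f \<in> arcs E" "tail E e = tail E f" "head E e \<notin> H" "head E f \<notin> H" "e \<noteq> f" for e f m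
    using inj[of e f] that by blast
  have eg: "branch_op H g (Edge e) (branch_op H g (Ghost e) \<phi>) x =
      (if head E e \<notin> H \<and> fst x = tail E e \<and> snd x \<in> range (g e) then \<phi> x else 0)" for e \<phi> x
    by (cases x) (auto simp: f_inv_into_f)
  have minus: "poly_op (branch_op H g) (vert_minus v F) \<phi> x = 0"
    if v: "v \<in> verts E" "regular_vertex E v \<or> v \<in> S" "v \<in> S \<Longrightarrow> v \<notin> H" and F: "finite F" "outside H v \<subseteq> F" "F \<subseteq> out_arcs E v"
    for v F \<phi> x
  proof (cases "fst x = v \<and> v \<notin> H")
    case False
    have "branch_op H g (Edge e) (branch_op H g (Ghost e) \<phi>) x = 0" if "e \<in> F" for e
      unfolding eg using that F False tailH[of e] by auto
    then show ?thesis using False by (auto simp: poly_op_vert_minus simp del: branch_op.simps(2,3))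
  next
    case True
    obtain e0 where e0: "e0 \<in> outside H v" "snd x \<in> range (g e0)"
      using tight v True by blast
    have "branch_op H g (Edge e) (branch_op H g (Ghost e) \<phi>) x = (if e = e0 then \<phi> x else 0)" if e: "e \<in> F" for e
    proof (cases "e = e0")
      case True
      then show ?thesis unfolding eg using e0 \<open>fst x = v \<and> v \<notin> H\<close> by (auto simp: outside_def)
    next
      case False
      have "e \<in> arcs E" "e0 \<in> arcs E" "tail E e0 = tail E e" "head E e0 \<notin> H"
        using e e0 F by (auto simp: outside_def)
      moreover obtain m where "snd x = g e0 m" using e0(2) by auto
      ultimately have "head E e \<notin> H \<Longrightarrow> snd x \<notin> range (g e)"
        using disj[of e0 e m] False by metis
      then show ?thesis unfolding eg using False by auto
    qed
    then have "(\<Sum>e\<in>F. branch_op H g (Edge e) (branch_op H g (Ghost e) \<phi>) x) = (\<Sum>e\<in>F. if e = e0 then \<phi> x else 0)"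
      by (intro sum.cong) auto
    also have "\<dots> = \<phi> x" using e0 F by (auto simp: sum.delta)
    finally show ?thesis using True by (simp add: poly_op_vert_minus del: branch_op.simps(2,3))
  qed
  have rel: "relators E \<subseteq> ?K"
  proof
    fix r :: "('v, 'e, 'r) ncpoly" assume r: "r \<in> relators E"
    then have ra: "r \<in> aug E" using relators_aug by blast
    note ops = poly_op_diff poly_op_mult poly_op_gen
    have "poly_op (branch_op H g) r \<phi> x = 0" for \<phi> x
      using r unfolding relators_def
    proof (elim UnE CollectE exE conjE)
      fix v w assume "r = vert v * vert w - (if v = w then vert v else 0)"
      then show ?thesis by (auto simp: ops)
    next
      fix e assume "r = vert (tail E e) * edge e - edge e" "e \<in> arcs E"
      then show ?thesis using tailH[of e] by (auto simp: ops)
    next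
      fix e assume "r = edge e * vert (head E e) - edge e" "e \<in> arcs E"
      then show ?thesis by (auto simp: ops)
    next
      fix e assume "r = vert (head E e) * ghost e - ghost e" "e \<in> arcs E"
      then show ?thesis by (auto simp: ops)
    next
      fix e assume "r = ghost e * vert (tail E e) - ghost e" "e \<in> arcs E"
      then show ?thesis using tailH[of e] by (auto simp: ops)
    next
      fix e f assume r: "r = ghost e * edge f - (if e = f then vert (head E e) else 0)" "e \<in> arcs E" "f \<in> arcs E"
      show ?thesis
      proof (cases "e = f")
        case True
        then show ?thesis using r inv_g[of e] by (cases x) (auto simp: ops)
      next
        case False
        then show ?thesis using r disj[of e f] by (cases x) (auto simp: ops)
      qed
    next
      fix v assume v: "r = vert_minus v (out_arcs E v)" "regular_vertex E v"
      show ?thesis unfolding v(1)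
        by (rule minus) (use v(2) assms(4) in \<open>auto simp: regular_vertex_def outside_def breaking_iff\<close>)
    qed
    then show "r \<in> ?K" using ra by simp
  qed
  have H: "vert ` H \<subseteq> ?K" using assms(2) by (auto simp: hereditary_def poly_op_gen)
  have S: "gap H ` S \<subseteq> ?K"
  proof
    fix p assume "p \<in> gap H ` S"
    then obtain v where v: "v \<in> S" "p = gap H v" by auto
    then have b: "v \<in> verts E" "v \<notin> H" "finite (outside H v)" using assms(4) by (auto simp: breaking_iff)
    have "poly_op (branch_op H g) p \<phi> x = 0" for \<phi> x
      unfolding v(2) gap_def by (rule minus) (use v b in \<open>auto simp: outside_def\<close>)
    then show "p \<in> ?K" using v b gap_aug by simp
  qed
  have "hs_ideal H S \<subseteq> ?K"
    unfolding hs_ideal_def by (rule ugen_subset[OF uideal_kernel]) (use rel H S in blast)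
  then have "\<forall>p\<in>hs_ideal H S. \<forall>\<phi> x. poly_op (branch_op H g) p \<phi> x = 0" by auto
  then show ?thesis using loose by (rule that)
qed

lemma const_vert_hs_ideal:
  assumes "countable (arcs E)" "hereditary H" "saturated H" "S \<subseteq> breaking E H"
    and w: "w \<in> verts E - H" "const c * vert w \<in> hs_ideal H S"
  shows "c = 0"
proof -
  obtain g where g: "\<forall>p\<in>hs_ideal H S. \<forall>\<phi> x. poly_op (branch_op H g) p \<phi> x = 0"
    "\<forall>v\<in>verts E - H. \<not> (regular_vertex E v \<or> v \<in> S) \<longrightarrow> (\<exists>n. \<forall>e\<in>outside H v. n \<notin> range (g e))"
    by (rule hs_ideal_representation[OF assms(1-4)])
  interpret gen_ops "branch_op H g" by (rule gen_ops_branch_op)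
  have "poly_op (branch_op H g) (const c * vert w) (\<lambda>x. 1) (w, 0) = 0" using g(1) w(2) by blast
  then show ?thesis using w(1) by (simp add: poly_op_const poly_op_gen)
qed

text \<open>
  Here the domain of \<open>w\<close> contains a point outside of the images of all edges, at which \<open>w\<^sup>H\<close> acts
  as the identity.
\<close>

lemma const_gap_hs_ideal:
  assumes "countable (arcs E)" "hereditary H" "saturated H" "S \<subseteq> breaking E H"
    and w: "w \<in> breaking E H - S" "const c * gap H w \<in> hs_ideal H S"
  shows "c = 0"
proof -
  obtain g where g: "\<forall>p\<in>hs_ideal H S. \<forall>\<phi> x. poly_op (branch_op H g) p \<phi> x = 0"
    "\<forall>v\<in>verts E - H. \<not> (regular_vertex E v \<or> v \<in> S) \<longrightarrow> (\<exists>n. \<forall>e\<in>outside H v. n \<notin> range (g e))"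
    by (rule hs_ideal_representation[OF assms(1-4)])
  interpret gen_ops "branch_op H g" by (rule gen_ops_branch_op)
  have wH: "w \<in> verts E - H" "\<not> (regular_vertex E w \<or> w \<in> S)"
    using w(1) by (auto simp: breaking_iff regular_vertex_def)
  obtain n where n: "\<forall>e\<in>outside H w. n \<notin> range (g e)" using g(2) wH by blast
  have "branch_op H g (Edge e) (branch_op H g (Ghost e) (\<lambda>x. 1)) (w, n) = 0" if "e \<in> outside H w" for e
    using n that by auto
  then have "poly_op (branch_op H g) (gap H w) (\<lambda>x. 1) (w, n) = 1"
    using wH(1) unfolding gap_def poly_op_vert_minus by (simp del: branch_op.simps(2,3))
  moreover have "poly_op (branch_op H g) (const c * gap H w) (\<lambda>x. 1) (w, n) = 0" using g(1) w(2) by blast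
  ultimately show ?thesis by (simp add: poly_op_const)
qed

end

context leavitt
begin

section \<open>Graded basic ideals\<close>

text \<open>
  The empty set \<open>F\<close> is admitted, so that the vertices need not be treated separately.
\<close>

definition basic_poly_ideal :: "('v, 'e, 'r) ncpoly set \<Rightarrow> bool" where
  "basic_poly_ideal J \<longleftrightarrow> (\<forall>v F c. v \<in> verts E \<longrightarrow> F \<subseteq> out_arcs E v \<longrightarrow> finite F \<longrightarrow> c \<noteq> 0 \<longrightarrow>
     const c * vert_minus v F \<in> J \<longrightarrow> vert_minus v F \<in> J)"

lemma vert_minus_empty [simp]: "vert_minus v {} = vert v"
  by (simp add: vert_minus_def)

lemma lift_ideal_iff: "x \<in> aug E \<Longrightarrow> x \<in> lift_ideal I \<longleftrightarrow> lpa_cls E x \<in> I"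
  by (simp add: lift_ideal_def)

lemma basic_ideal_iff:
  assumes I: "rng_ideal I (lpa E)"
  shows "basic_ideal E I \<longleftrightarrow> basic_poly_ideal (lift_ideal I)"
proof -
  let ?X = "{lpa_cls E (vert v :: ('v, 'e, 'r) ncpoly) | v. v \<in> verts E} \<union>
    {lpa_cls E (vert_minus v F) | v F. v \<in> verts E \<and> F \<subseteq> out_arcs E v \<and> finite F \<and> F \<noteq> {}}"
  let ?Y = "{lpa_cls E (vert_minus v F :: ('v, 'e, 'r) ncpoly) | v F. v \<in> verts E \<and> F \<subseteq> out_arcs E v \<and> finite F}"
  have vert_Y: "lpa_cls E (vert v) \<in> ?Y" if "v \<in> verts E" for v
    using that by (intro CollectI exI[of _ v] exI[of _ "{}"]) simp
  have "?X = ?Y"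
  proof
    show "?X \<subseteq> ?Y" using vert_Y by blast
    show "?Y \<subseteq> ?X"
    proof
      fix X assume "X \<in> ?Y"
      then obtain v F where "X = lpa_cls E (vert_minus v F)" "v \<in> verts E" "F \<subseteq> out_arcs E v" "finite F"
        by blast
      then show "X \<in> ?X" by (cases "F = {}") auto
    qed
  qed
  then have *: "basic_ideal E I \<longleftrightarrow> (\<forall>x\<in>?Y. \<forall>c. c \<noteq> 0 \<longrightarrow> c \<odot>\<^bsub>lpa E\<^esub> x \<in> I \<longrightarrow> x \<in> I)"
    unfolding basic_ideal_def using I by (simp only: True_implies_equals simp_thms)
  have lift: "(c \<odot>\<^bsub>lpa E\<^esub> lpa_cls E (vert_minus v F) \<in> I \<longrightarrow> lpa_cls E (vert_minus v F) \<in> I) \<longleftrightarrow>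
      (const c * vert_minus v F \<in> lift_ideal I \<longrightarrow> vert_minus v F \<in> lift_ideal I)"
    if "v \<in> verts E" "F \<subseteq> out_arcs E v" for v F c
  proof -
    have "F \<subseteq> arcs E" using that by auto
    then have "vert_minus v F \<in> (aug E :: ('v, 'e, 'r) ncpoly set)" using that by simp
    moreover from this have "const c * vert_minus v F \<in> aug E" by (intro aug_mult_left) auto
    ultimately show ?thesis by (simp add: lift_ideal_iff scale_conv_const)
  qed
  show ?thesis
  proof
    assume b: "basic_ideal E I"
    show "basic_poly_ideal (lift_ideal I)"
      unfolding basic_poly_ideal_def
    proof (intro allI impI)
      fix v F c
      assume v: "v \<in> verts E" "F \<subseteq> out_arcs E v" "finite F" and c: "(c :: 'r) \<noteq> 0"
        "const c * vert_minus v F \<in> lift_ideal I"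
      have "lpa_cls E (vert_minus v F) \<in> ?Y" using v by blast
      then have "c \<odot>\<^bsub>lpa E\<^esub> lpa_cls E (vert_minus v F) \<in> I \<longrightarrow> lpa_cls E (vert_minus v F) \<in> I"
        using b c(1) unfolding * by blast
      then show "vert_minus v F \<in> lift_ideal I" using lift[OF v(1,2)] c(2) by blast
    qed
  next
    assume b: "basic_poly_ideal (lift_ideal I)"
    show "basic_ideal E I"
      unfolding *
    proof (intro ballI allI impI)
      fix X :: "('v, 'e, 'r) lpa_elem" and c :: 'r
      assume X: "X \<in> ?Y" and c: "c \<noteq> 0" "c \<odot>\<^bsub>lpa E\<^esub> X \<in> I"
      obtain v F where v: "X = lpa_cls E (vert_minus v F)" "v \<in> verts E" "F \<subseteq> out_arcs E v" "finite F"
        using X by blast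
      have "const c * vert_minus v F \<in> lift_ideal I \<longrightarrow> vert_minus v F \<in> lift_ideal I"
        using b v c(1) unfolding basic_poly_ideal_def by blast
      then show "X \<in> I" using lift[OF v(2,3), of c] c(2) v(1) by blast
    qed
  qed
qed

lemma sum_hpart_mem:
  assumes "full_ideal J" "\<And>k. hpart k x \<in> J"
  shows "x \<in> J"
proof -
  have "(\<Sum>k\<in>wdeg ` Poly_Mapping.keys x. hpart k x) \<in> J"
    using assms(2) by (rule uideal_sum[OF full_idealD(1)[OF assms(1)]])
  then show ?thesis by (simp add: sum_hpart)
qed

definition hs_vertices :: "('v, 'e, 'r) ncpoly set \<Rightarrow> 'v set" where
  "hs_vertices J = {v \<in> verts E. vert v \<in> J}"

definition hs_gaps :: "('v, 'e, 'r) ncpoly set \<Rightarrow> 'v set" where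
  "hs_gaps J = {v \<in> breaking E (hs_vertices J). gap (hs_vertices J) v \<in> J}"

lemma hereditary_hs_vertices:
  assumes J: "full_ideal J"
  shows "hereditary (hs_vertices J)"
  unfolding hereditary_def
proof (intro conjI ballI impI)
  fix e assume e: "e \<in> arcs E" "tail E e \<in> hs_vertices J"
  have "awalk (tail E e) [e] (head E e)" using e by (simp add: awalk_def)
  from compresses_to_mem[OF J compresses_to_path[OF J this]] show "head E e \<in> hs_vertices J"
    using e by (auto simp: hs_vertices_def)
qed (auto simp: hs_vertices_def)

lemma saturated_hs_vertices:
  assumes J: "full_ideal J"
  shows "saturated (hs_vertices J)"
  unfolding saturated_def
proof (intro allI impI)
  fix v assume v: "regular_vertex E v" "head E ` out_arcs E v \<subseteq> hs_vertices J"
  have "epr (out_arcs E v) \<in> J"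
    using v(2) by (intro epr_in_ideal[OF J]) (auto simp: hs_vertices_def image_subset_iff)
  moreover have "vert v - epr (out_arcs E v) \<in> J"
    using full_idealD(2)[OF J regular_rel[OF v(1)]] by (simp add: vert_minus_epr)
  ultimately have "vert v \<in> J" using uideal_cong[OF full_idealD(1)[OF J]] by blast
  then show "v \<in> hs_vertices J" using v(1) by (simp add: hs_vertices_def regular_vertex_def)
qed

text \<open>
  A homogeneous element of \<open>J\<close> outside of \<open>I(H,S)\<close> would compress, modulo \<open>I(H,S)\<close>, to a multiple
  \<open>c p\<close> with \<open>p\<close> outside of \<open>I(H,S)\<close>.  As \<open>J\<close> is basic, it contains \<open>p\<close>, and then a vertex
  outside of \<open>H\<close> or a gap projection outside of \<open>S\<close>, against the choice of \<open>H\<close> and \<open>S\<close>.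
\<close>

theorem graded_basic_eq_hs_ideal:
  assumes J: "full_ideal J" and graded: "hpart_closed J" and basic: "basic_poly_ideal J"
  defines "H \<equiv> hs_vertices J" and "S \<equiv> hs_gaps J"
  shows "J = hs_ideal H S"
proof
  have HS: "H \<subseteq> verts E" "S \<subseteq> breaking E H"
    by (auto simp: H_def S_def hs_vertices_def hs_gaps_def)
  note hs = full_hs_ideal[OF HS]
  note J' = full_idealD(1)[OF J]
  have mem: "vert ` H \<subseteq> J" "gap H ` S \<subseteq> J"
    by (auto simp: H_def S_def hs_vertices_def hs_gaps_def)
  then show sub: "hs_ideal H S \<subseteq> J"
    unfolding hs_ideal_def using relators_rel full_idealD(2)[OF J]
    by (intro ugen_subset[OF J']) blast
  show "J \<subseteq> hs_ideal H S"
  proof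
    fix x assume x: "x \<in> J"
    show "x \<in> hs_ideal H S"
    proof (rule sum_hpart_mem[OF hs], rule ccontr)
      fix k assume notin: "hpart k x \<notin> hs_ideal H S"
      have xk: "hpart k x \<in> J" using graded x by (simp add: hpart_closed_def)
      obtain c u F where *: "c \<noteq> 0" "u \<in> verts E" "finite F" "F \<subseteq> out_arcs E u"
        "compresses_to (hs_ideal H S) (hpart k x) (const c * vert_minus u F)" "vert_minus u F \<notin> hs_ideal H S"
        by (rule homogeneous_compresses[OF hs hs_ideal_generators uideal_aug[OF J' xk] hom_deg_hpart notin])
      have "const c * vert_minus u F \<in> J"
        by (rule compresses_to_mem[OF J compresses_to_mono[OF sub *(5)] xk])
      then have p: "vert_minus u F \<in> J" using basic *(1-4) unfolding basic_poly_ideal_def by blast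
      have "(\<exists>w\<in>verts E - H. compresses_to (hs_ideal H S) (vert_minus u F) (vert w)) \<or>
          (\<exists>w\<in>breaking E H - S. compresses_to (hs_ideal H S) (vert_minus u F) (gap H w))"
        by (rule vert_minus_compresses[OF hs hs_ideal_generators *(2-4,6)])
      then show False
      proof (elim disjE bexE)
        fix w assume w: "w \<in> verts E - H" "compresses_to (hs_ideal H S) (vert_minus u F) (vert w)"
        have "vert w \<in> J" by (rule compresses_to_mem[OF J compresses_to_mono[OF sub w(2)] p])
        then show False using w(1) by (simp add: H_def hs_vertices_def)
      next
        fix w assume w: "w \<in> breaking E H - S" "compresses_to (hs_ideal H S) (vert_minus u F) (gap H w)"
        have "gap H w \<in> J" by (rule compresses_to_mem[OF J compresses_to_mono[OF sub w(2)] p])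
        then show False using w(1) by (simp add: H_def S_def hs_gaps_def)
      qed
    qed
  qed
qed

lemma basic_hs_ideal:
  assumes "countable (arcs E)" "hereditary H" "saturated H" "S \<subseteq> breaking E H"
  shows "basic_poly_ideal (hs_ideal H S)"
  unfolding basic_poly_ideal_def
proof (intro allI impI, rule ccontr)
  fix u F c assume u: "u \<in> verts E" "F \<subseteq> out_arcs E u" "finite F" and c: "c \<noteq> 0"
    "const c * vert_minus u F \<in> hs_ideal H S" and notin: "vert_minus u F \<notin> hs_ideal H S"
  have hs: "full_ideal (hs_ideal H S)"
    using assms by (intro full_hs_ideal) (auto simp: hereditary_def)
  have "(\<exists>w\<in>verts E - H. compresses_to (hs_ideal H S) (vert_minus u F) (vert w)) \<or>
      (\<exists>w\<in>breaking E H - S. compresses_to (hs_ideal H S) (vert_minus u F) (gap H w))"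
    by (rule vert_minus_compresses[OF hs hs_ideal_generators u(1,3,2) notin])
  then show False
  proof (elim disjE bexE)
    fix w assume w: "w \<in> verts E - H" "compresses_to (hs_ideal H S) (vert_minus u F) (vert w)"
    have "const c * vert w \<in> hs_ideal H S"
      by (rule compresses_to_mem[OF hs compresses_to_const[OF hs w(2)] c(2)])
    then show False using const_vert_hs_ideal[OF assms w(1)] c(1) by blast
  next
    fix w assume w: "w \<in> breaking E H - S" "compresses_to (hs_ideal H S) (vert_minus u F) (gap H w)"
    have "const c * gap H w \<in> hs_ideal H S"
      by (rule compresses_to_mem[OF hs compresses_to_const[OF hs w(2)] c(2)])
    then show False using const_gap_hs_ideal[OF assms w(1)] c(1) by blast
  qed
qed

section \<open>Prime ideals\<close>

definition prime_poly_ideal :: "('v, 'e, 'r) ncpoly set \<Rightarrow> bool" where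
  "prime_poly_ideal J \<longleftrightarrow> J \<noteq> aug E \<and> (\<forall>J1 J2. full_ideal J1 \<longrightarrow> full_ideal J2 \<longrightarrow>
     (\<forall>x\<in>J1. \<forall>y\<in>J2. x * y \<in> J) \<longrightarrow> J1 \<subseteq> J \<or> J2 \<subseteq> J)"

text \<open>
  The ideals behind this are the left annihilator modulo \<open>J\<close> of all \<open>a y\<close>, which contains \<open>x\<close>, and
  its right annihilator, which contains \<open>y\<close>.
\<close>

lemma prime_elements:
  assumes J: "full_ideal J" and prime: "prime_poly_ideal J"
    and x: "x \<in> aug E" "x \<notin> J" and y: "y \<in> aug E" "y \<notin> J"
  shows "\<exists>a\<in>uni_alg E. x * a * y \<notin> J"
proof (rule ccontr)
  assume "\<not> ?thesis"
  then have xy: "x * a * y \<in> J" if "a \<in> uni_alg E" for a using that by blast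
  note J' = full_idealD(1)[OF J]
  \<comment> \<open>\<open>a\<close> ranges over the unital algebra, so \<open>a = 1\<close> gives \<open>z y \<in> J\<close>\<close>
  define J1 where "J1 = {z \<in> aug E. \<forall>a\<in>uni_alg E. z * a * y \<in> J}"
  define J2 where "J2 = {t \<in> aug E. \<forall>z\<in>J1. z * t \<in> J}"
  have JJ1: "z \<in> J1" if "z \<in> J" for z
    using that y(1) uideal_aug[OF J'] unfolding J1_def
    by (auto intro!: uideal_mult_right[OF J'])
  have U1: "uideal E J1"
  proof (rule uidealI)
    fix z a :: "('v, 'e, 'r) ncpoly" assume z: "z \<in> J1" and a: "a \<in> uni_alg E"
    have "a * (z * b * y) \<in> J" "z * (a * b) * y \<in> J" if b: "b \<in> uni_alg E" for b
      using uideal_mult_left[OF J' _ a, of "z * b * y"] z a b by (auto simp: J1_def)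
    then show "a * z \<in> J1" "z * a \<in> J1"
      using z a by (auto simp: J1_def mult.assoc)
  qed (use uideal_0[OF J'] uideal_add[OF J'] in \<open>auto simp: J1_def distrib_right\<close>)
  have U2: "uideal E J2"
  proof (rule uidealI)
    fix t a :: "('v, 'e, 'r) ncpoly" assume t: "t \<in> J2" and a: "a \<in> uni_alg E"
    have "z * t * a \<in> J" "(z * a) * t \<in> J" if z: "z \<in> J1" for z
      using uideal_mult_right[OF J' _ a, of "z * t"] uideal_mult_right[OF U1 z a] t z
      by (auto simp: J2_def)
    then show "a * t \<in> J2" "t * a \<in> J2"
      using t a by (auto simp: J2_def mult.assoc)
  qed (use uideal_0[OF J'] uideal_add[OF J'] in \<open>auto simp: J2_def distrib_left\<close>)
  have JJ2: "t \<in> J2" if "t \<in> J" for t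
    using that uideal_aug[OF J'] uideal_aug[OF U1] unfolding J2_def
    by (auto intro!: uideal_mult_left[OF J'])
  have "full_ideal J1" "full_ideal J2"
    using U1 U2 JJ1 JJ2 full_idealD(2)[OF J] by (auto simp: full_ideal_def)
  moreover have "\<forall>z\<in>J1. \<forall>t\<in>J2. z * t \<in> J" by (auto simp: J2_def)
  ultimately have "J1 \<subseteq> J \<or> J2 \<subseteq> J" using prime unfolding prime_poly_ideal_def by blast
  moreover have "x \<in> J1" using x xy by (simp add: J1_def)
  moreover have "y \<in> J2"
    using y unfolding J2_def J1_def by (auto dest: bspec[of _ _ 1])
  ultimately show False using x(2) y(2) by blast
qed

text \<open>
  Components of \<open>x\<close> that lie in \<open>J\<close> are removed from the top until one is met that does not.
\<close>

lemma top_component: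
  assumes J: "full_ideal J" and x: "x \<in> aug E" "x \<notin> J"
  obtains m x' where "x' \<in> aug E" "x - x' \<in> J" "deg_le m x'" "hpart m x' \<notin> J"
proof -
  note J' = full_idealD(1)[OF J]
  let ?A = "wdeg ` Poly_Mapping.keys x"
  define K where "K = {k \<in> ?A. hpart k x \<notin> J}"
  have K: "finite K" by (simp add: K_def)
  have "K \<noteq> {}"
  proof
    assume "K = {}"
    then have "(\<Sum>k\<in>?A. hpart k x) \<in> J" unfolding K_def by (intro uideal_sum[OF J']) blast
    then show False using x(2) by (simp add: sum_hpart)
  qed
  define m where "m = Max K"
  have m: "m \<in> K" "\<And>k. k \<in> K \<Longrightarrow> k \<le> m" using K \<open>K \<noteq> {}\<close> by (auto simp: m_def)
  define x' where "x' = (\<Sum>k\<in>{k\<in>?A. k \<le> m}. hpart k x)"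
  have "x = (\<Sum>k\<in>?A. hpart k x)" by (simp add: sum_hpart)
  also have "\<dots> = (\<Sum>k\<in>?A - {k\<in>?A. k \<le> m}. hpart k x) + x'"
    unfolding x'_def by (rule sum.subset_diff) auto
  finally have "x - x' = (\<Sum>k\<in>?A - {k\<in>?A. k \<le> m}. hpart k x)" by (simp add: algebra_simps)
  also have "\<dots> \<in> J"
    using m(2) by (intro uideal_sum[OF J']) (auto simp: K_def)
  finally have 1: "x - x' \<in> J" .
  have 2: "x' \<in> aug E" unfolding x'_def using x(1) by (intro aug_sum) simp
  have 3: "deg_le m x'"
    unfolding deg_le_def
  proof
    fix w assume "w \<in> Poly_Mapping.keys x'"
    then have "Poly_Mapping.lookup x' w \<noteq> 0" by (simp add: in_keys_iff)
    then obtain k where "k \<le> m" "Poly_Mapping.lookup (hpart k x) w \<noteq> 0"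
      unfolding x'_def lookup_sum by (auto elim: sum.not_neutral_contains_not_neutral)
    then show "wdeg w \<le> m" by (auto simp: lookup_hpart when_def split: if_splits)
  qed
  have "hpart m x' = (\<Sum>k\<in>{k\<in>?A. k \<le> m}. if k = m then hpart m x else 0)"
    unfolding x'_def hpart_sum by (intro sum.cong refl) (simp add: hpart_hom_deg[OF hom_deg_hpart])
  also have "\<dots> = hpart m x" using m(1) by (auto simp: sum.delta K_def)
  finally have 4: "hpart m x' \<notin> J" using m(1) by (simp add: K_def)
  show ?thesis by (rule that[OF 2 1 3 4])
qed

text \<open>
  If \<open>x a y \<in> J\<close> for all \<open>a\<close>, then for homogeneous \<open>a\<close> the top component of \<open>x a y\<close> gives the same for
  the top components of \<open>x\<close> and \<open>y\<close> outside of \<open>J\<close>.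
\<close>

lemma prime_if_graded_prime:
  assumes J: "full_ideal J" and graded: "hpart_closed J" and proper: "J \<noteq> aug E"
    and hom: "\<And>x y k l. x \<in> aug E \<Longrightarrow> y \<in> aug E \<Longrightarrow> hom_deg k x \<Longrightarrow> hom_deg l y \<Longrightarrow> x \<notin> J \<Longrightarrow> y \<notin> J
      \<Longrightarrow> \<exists>a\<in>uni_alg E. x * a * y \<notin> J"
  shows "prime_poly_ideal J"
  unfolding prime_poly_ideal_def
proof (intro conjI allI impI, rule proper, rule ccontr)
  fix J1 J2 assume J1: "full_ideal J1" and J2: "full_ideal J2" and prod: "\<forall>x\<in>J1. \<forall>y\<in>J2. x * y \<in> J"
    and "\<not> (J1 \<subseteq> J \<or> J2 \<subseteq> J)"
  then obtain x y where xy: "x \<in> J1" "x \<notin> J" "y \<in> J2" "y \<notin> J" by blast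
  note J' = full_idealD(1)[OF J] and J1' = full_idealD(1)[OF J1] and J2' = full_idealD(1)[OF J2]
  have aug: "x \<in> aug E" "y \<in> aug E" using xy uideal_aug[OF J1'] uideal_aug[OF J2'] by auto
  obtain m x' where x': "x' \<in> aug E" "x - x' \<in> J" "deg_le m x'" "hpart m x' \<notin> J"
    by (rule top_component[OF J aug(1) xy(2)])
  obtain n y' where y': "y' \<in> aug E" "y - y' \<in> J" "deg_le n y'" "hpart n y' \<notin> J"
    by (rule top_component[OF J aug(2) xy(4)])
  have prod': "x' * a * y' \<in> J" if a: "a \<in> uni_alg E" for a
  proof -
    have 1: "(x * a) * y \<in> J" using prod xy uideal_mult_right[OF J1' xy(1) a] by blast
    have "(x - x') * a \<in> J" by (rule uideal_mult_right[OF J' x'(2) a])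
    then have "x * a - x' * a \<in> J" by (simp add: left_diff_distrib)
    from uideal_cong_mult[OF J' this y'(2)] have "x * a * y - x' * a * y' \<in> J"
      using x' a aug by auto
    then show ?thesis using 1 uideal_cong[OF J'] by blast
  qed
  have hom_top: "hpart m x' * a * hpart n y' \<in> J" if a: "a \<in> uni_alg E" "hom_deg d a" for a d
  proof -
    have da: "deg_le d a" using a(2) by (auto simp: deg_le_def hom_deg_def)
    have "deg_le (m + d) (x' * a)"
      using x'(3) da by (fastforce simp: deg_le_def dest!: keys_mult_letters intro: add_mono)
    then have "hpart (m + d + n) (x' * a * y') = hpart (m + d) (x' * a) * hpart n y'"
      using y'(3) by (rule hpart_mult_top)
    also have "hpart (m + d) (x' * a) = hpart m x' * a"
      using hpart_mult_top[OF x'(3) da] hpart_hom_deg[OF a(2), of d] by simp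
    finally show ?thesis using prod'[OF a(1)] graded unfolding hpart_closed_def by metis
  qed
  have all_top: "hpart m x' * a * hpart n y' \<in> J" if a: "a \<in> uni_alg E" for a
  proof -
    have hp: "hpart k a \<in> uni_alg E" for k
      using a by (auto simp: uni_alg_def keys_hpart)
    have "a = (\<Sum>k\<in>wdeg ` Poly_Mapping.keys a. hpart k a)" by (simp add: sum_hpart)
    then have "hpart m x' * a * hpart n y' =
        (\<Sum>k\<in>wdeg ` Poly_Mapping.keys a. hpart m x' * hpart k a * hpart n y')"
      by (metis sum_distrib_left sum_distrib_right)
    also have "\<dots> \<in> J" using hp hom_deg_hpart by (intro uideal_sum[OF J'] hom_top)
    finally show ?thesis .
  qed
  show False
    using hom[OF hpart_aug[OF x'(1)] hpart_aug[OF y'(1)] hom_deg_hpart hom_deg_hpart x'(4) y'(4)] all_top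
    by blast
qed

lemma compresses_to_product:
  assumes J: "full_ideal J" and x: "compresses_to J x z" and y: "compresses_to J y z'"
    and aug: "x \<in> aug E" "y \<in> aug E" "z \<in> aug E" and notin: "z * z' \<notin> J"
  shows "\<exists>a\<in>uni_alg E. x * a * y \<notin> J"
proof (rule ccontr)
  assume *: "\<not> ?thesis"
  note J' = full_idealD(1)[OF J]
  obtain a b where ab: "a \<in> uni_alg E" "b \<in> uni_alg E" "a * x * b - z \<in> J"
    using x unfolding compresses_to_def by blast
  obtain c d where cd: "c \<in> uni_alg E" "d \<in> uni_alg E" "c * y * d - z' \<in> J"
    using y unfolding compresses_to_def by blast
  have "x * (b * c) * y \<in> J" using * ab cd by blast
  then have "a * (x * (b * c) * y) * d \<in> J"
    using uideal_mult_right[OF J' uideal_mult_left[OF J' _ ab(1)] cd(2)] by blast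
  then have "(a * x * b) * (c * y * d) \<in> J" by (simp add: mult.assoc)
  moreover have "(a * x * b) * (c * y * d) - z * z' \<in> J"
    using ab cd aug by (intro uideal_cong_mult[OF J']) auto
  ultimately show False using notin uideal_cong[OF J'] by blast
qed

text \<open>
  Both halves of the reduction in one: a homogeneous element outside of \<open>I(H,S)\<close> leads to a vertex
  or to a gap projection that is not among the generators.
\<close>

lemma homogeneous_compresses_hs:
  assumes "H \<subseteq> verts E" "S \<subseteq> breaking E H"
    and x: "x \<in> aug E" "hom_deg k x" "x \<notin> hs_ideal H S"
  obtains c w where "c \<noteq> 0" "w \<in> verts E - H" "compresses_to (hs_ideal H S) x (const c * vert w)"
  | c w where "c \<noteq> 0" "w \<in> breaking E H - S" "compresses_to (hs_ideal H S) x (const c * gap H w)"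
proof -
  note hs = full_hs_ideal[OF assms(1,2)]
  obtain c u F where *: "c \<noteq> 0" "u \<in> verts E" "finite F" "F \<subseteq> out_arcs E u"
    "compresses_to (hs_ideal H S) x (const c * vert_minus u F)" "vert_minus u F \<notin> hs_ideal H S"
    by (rule homogeneous_compresses[OF hs hs_ideal_generators x])
  have "(\<exists>w\<in>verts E - H. compresses_to (hs_ideal H S) (vert_minus u F) (vert w)) \<or>
      (\<exists>w\<in>breaking E H - S. compresses_to (hs_ideal H S) (vert_minus u F) (gap H w))"
    by (rule vert_minus_compresses[OF hs hs_ideal_generators *(2-4,6)])
  then show ?thesis
  proof (elim disjE bexE)
    fix w assume w: "w \<in> verts E - H" "compresses_to (hs_ideal H S) (vert_minus u F) (vert w)"
    show ?thesis
      by (rule that(1)[OF *(1) w(1) compresses_to_trans[OF hs *(5) compresses_to_const[OF hs w(2)]]])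
  next
    fix w assume w: "w \<in> breaking E H - S" "compresses_to (hs_ideal H S) (vert_minus u F) (gap H w)"
    show ?thesis
      by (rule that(2)[OF *(1) w(1) compresses_to_trans[OF hs *(5) compresses_to_const[OF hs w(2)]]])
  qed
qed

lemma compresses_to_reachable:
  assumes J: "full_ideal J" and "w \<rightarrow>\<^sup>*\<^bsub>E\<^esub> y"
  shows "compresses_to J (const c * vert w) (const c * vert y)"
proof -
  obtain p where "awalk w p y" using assms(2) reachable_awalk by blast
  then show ?thesis by (intro compresses_to_const[OF J] compresses_to_path[OF J])
qed

lemma reachable_hereditary:
  assumes "hereditary H" "v \<rightarrow>\<^sup>*\<^bsub>E\<^esub> w" "v \<in> H"
  shows "w \<in> H"
proof -
  obtain p where "awalk v p w" using assms(2) reachable_awalk by blast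
  then show ?thesis using assms(3)
  proof (induction p arbitrary: v)
    case Nil
    then show ?case by (simp add: awalk_def)
  next
    case (Cons e p)
    then show ?case using awalk_ConsD[OF Cons.prems(1)] assms(1) by (auto simp: hereditary_def)
  qed
qed

lemma edge_reachable: "e \<in> arcs E \<Longrightarrow> head E e \<rightarrow>\<^sup>*\<^bsub>E\<^esub> w \<Longrightarrow> tail E e \<rightarrow>\<^sup>*\<^bsub>E\<^esub> w"
  using reachable_awalk awalk_Cons_iff by metis

lemma Omega_maximal_tail:
  assumes M: "M \<in> maximal_tails E"
  shows "hereditary (Omega E M)" "saturated (Omega E M)" "verts E - Omega E M = M"
proof -
  have MT: "M \<subseteq> verts E" "\<And>v w. v \<in> verts E \<Longrightarrow> w \<in> M \<Longrightarrow> v \<rightarrow>\<^sup>*\<^bsub>E\<^esub> w \<Longrightarrow> v \<in> M"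
    "\<And>v. v \<in> M \<Longrightarrow> regular_vertex E v \<Longrightarrow> \<exists>e\<in>arcs E. tail E e = v \<and> head E e \<in> M"
    using M unfolding maximal_tails_def by blast+
  have \<Omega>: "Omega E M = verts E - M" using MT(2) by (auto simp: Omega_def)
  show "verts E - Omega E M = M" using MT(1) \<Omega> by auto
  show "hereditary (Omega E M)"
    unfolding hereditary_def \<Omega>
  proof (intro conjI ballI impI)
    fix e assume e: "e \<in> arcs E" "tail E e \<in> verts E - M"
    then have "tail E e \<rightarrow>\<^sup>*\<^bsub>E\<^esub> head E e" by (intro edge_reachable) auto
    then show "head E e \<in> verts E - M" using MT(2) e by auto
  qed auto
  show "saturated (Omega E M)"
    unfolding saturated_def \<Omega>
  proof (intro allI impI)
    fix v assume v: "regular_vertex E v" "head E ` out_arcs E v \<subseteq> verts E - M"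
    have "v \<notin> M"
    proof
      assume "v \<in> M"
      then obtain e where "e \<in> arcs E" "tail E e = v" "head E e \<in> M" using MT(3) v(1) by blast
      then show False using v(2) by (auto simp: image_subset_iff)
    qed
    then show "v \<in> verts E - M" using v(1) by (simp add: regular_vertex_def)
  qed
qed

lemma Omega_vertex:
  assumes v: "infinite (out_arcs E v)"
  shows "hereditary (Omega E {v})" "saturated (Omega E {v})"
    and "w \<in> verts E - Omega E {v} \<Longrightarrow> v \<in> verts E \<Longrightarrow> w \<rightarrow>\<^sup>*\<^bsub>E\<^esub> v"
proof -
  have \<Omega>: "w \<in> Omega E {v} \<longleftrightarrow> w \<in> verts E \<and> w \<noteq> v \<and> \<not> w \<rightarrow>\<^sup>*\<^bsub>E\<^esub> v" for w
    by (auto simp: Omega_def)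
  show "w \<rightarrow>\<^sup>*\<^bsub>E\<^esub> v" if "w \<in> verts E - Omega E {v}" "v \<in> verts E"
    using that \<Omega>[of w] by auto
  show "hereditary (Omega E {v})"
    unfolding hereditary_def
  proof (intro conjI ballI impI)
    fix e assume e: "e \<in> arcs E" "tail E e \<in> Omega E {v}"
    then have "\<not> head E e \<rightarrow>\<^sup>*\<^bsub>E\<^esub> v" using edge_reachable \<Omega> by blast
    then show "head E e \<in> Omega E {v}" using e \<Omega> by (metis head_in_verts reachable_refl)
  qed (auto simp: \<Omega>)
  show "saturated (Omega E {v})"
    unfolding saturated_def
  proof (intro allI impI)
    fix w assume w: "regular_vertex E w" "head E ` out_arcs E w \<subseteq> Omega E {v}"
    have wv: "w \<noteq> v" using w(1) v by (auto simp: regular_vertex_def)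
    have "\<not> w \<rightarrow>\<^sup>*\<^bsub>E\<^esub> v"
    proof
      assume "w \<rightarrow>\<^sup>*\<^bsub>E\<^esub> v"
      then obtain p where p: "awalk w p v" using reachable_awalk by blast
      show False
      proof (cases p)
        case Nil
        then show False using p wv by (simp add: awalk_def)
      next
        case (Cons e q)
        then have "e \<in> out_arcs E w" "awalk (head E e) q v" using p awalk_ConsD[of w e q v] by auto
        then have "head E e \<in> Omega E {v}" "head E e \<rightarrow>\<^sup>*\<^bsub>E\<^esub> v" using w(2) reachable_awalk by blast+
        then show False using \<Omega> by blast
      qed
    qed
    then show "w \<in> Omega E {v}" using w(1) wv \<Omega> by (simp add: regular_vertex_def)
  qed
qed

lemma gap_idempotent: "v \<in> verts E \<Longrightarrow> finite (outside H v) \<Longrightarrow> gap H v * gap H v \<approx> gap H v"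
proof -
  assume v: "v \<in> verts E" "finite (outside H v)"
  have K: "outside H v \<subseteq> out_arcs E v" "outside H v \<subseteq> arcs E" by (auto simp: outside_def)
  have "epr (outside H v) * gap H v \<approx> epr {e \<in> outside H v. tail E e = v} - epr (outside H v)"
    unfolding gap_def vert_minus_epr right_diff_distrib
    using v K by (intro eqv_diff vert_epr epr_mult_subset) auto
  then have 1: "epr (outside H v) * gap H v \<approx> 0" by (simp add: outside_arcs(2) cong: conj_cong)
  have 2: "vert v * gap H v \<approx> gap H v" unfolding gap_def by (rule vert_vert_minus(1)[OF v K(1)])
  have "(vert v - epr (outside H v)) * gap H v \<approx> gap H v - 0"
    unfolding left_diff_distrib using 1 2 by (rule eqv_diff[rotated])
  then show ?thesis by (simp add: gap_def vert_minus_epr)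
qed

lemma const_mult_const: "const c * x * (const d * y) = const (c * d) * (x * y)"
proof -
  have "x * (const d * y) = const d * (x * y)"
    using const_commute[of d x] by (metis mult.assoc)
  then show ?thesis by (simp add: const_simps mult.assoc)
qed

text \<open>
  All gap projections belong to the ideal, so that homogeneous elements compress to multiples of
  vertices in \<open>M\<close>, and further along paths to multiples of a common vertex.
\<close>

lemma prime_hs_tail:
  assumes dom: "\<And>c d :: 'r. c \<noteq> 0 \<Longrightarrow> d \<noteq> 0 \<Longrightarrow> c * d \<noteq> 0"
    and "countable (arcs E)" and M: "M \<in> maximal_tails E"
  defines "H \<equiv> Omega E M"
  shows "prime_poly_ideal (hs_ideal H (breaking E H))"
proof -
  note \<Omega> = Omega_maximal_tail[OF M, folded H_def]
  have H: "H \<subseteq> verts E" using \<Omega>(1) by (simp add: hereditary_def)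
  let ?J = "hs_ideal H (breaking E H)"
  note J = full_hs_ideal[OF H subset_refl]
  note vert_notin = const_vert_hs_ideal[OF assms(2) \<Omega>(1,2) subset_refl]
  have red: "\<exists>c w. c \<noteq> 0 \<and> w \<in> M \<and> compresses_to ?J x (const c * vert w)"
    if x: "x \<in> aug E" "hom_deg k x" "x \<notin> ?J" for x k
  proof -
    from H subset_refl x show ?thesis
    proof (cases rule: homogeneous_compresses_hs)
      case (1 c w)
      then show ?thesis using \<Omega>(3) by blast
    qed simp
  qed
  show ?thesis
  proof (rule prime_if_graded_prime[OF J hpart_closed_hs_ideal[OF H subset_refl]])
    obtain v where v: "v \<in> M" using M by (auto simp: maximal_tails_def)
    then have "v \<in> verts E - H" using \<Omega>(3) by simp
    then have "vert v \<notin> ?J" "vert v \<in> aug E" using vert_notin[of v 1] by (auto simp: const_simps)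
    then show "?J \<noteq> aug E" by blast
  next
    fix x y k l
    assume x: "x \<in> aug E" and y: "y \<in> aug E" and hom: "hom_deg k x" "hom_deg l y" and notin: "x \<notin> ?J" "y \<notin> ?J"
    obtain c w where c: "c \<noteq> 0" "w \<in> M" "compresses_to ?J x (const c * vert w)"
      using red[OF x hom(1) notin(1)] by blast
    obtain d w' where d: "d \<noteq> 0" "w' \<in> M" "compresses_to ?J y (const d * vert w')"
      using red[OF y hom(2) notin(2)] by blast
    obtain z where z: "z \<in> M" "w \<rightarrow>\<^sup>*\<^bsub>E\<^esub> z" "w' \<rightarrow>\<^sup>*\<^bsub>E\<^esub> z"
      using M c(2) d(2) unfolding maximal_tails_def by blast
    have zH: "z \<in> verts E - H" using z \<Omega>(3) by simp
    have cz: "const c * vert z \<in> aug E" using zH by (intro aug_mult_left) auto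
    show "\<exists>a\<in>uni_alg E. x * a * y \<notin> ?J"
    proof (rule compresses_to_product[OF J _ _ x y cz])
      show "compresses_to ?J x (const c * vert z)" "compresses_to ?J y (const d * vert z)"
        by (rule compresses_to_trans[OF J c(3) compresses_to_reachable[OF J z(2)]],
            rule compresses_to_trans[OF J d(3) compresses_to_reachable[OF J z(3)]])
      have "const c * vert z * (const d * vert z) = const (c * d) * (vert z * vert z)"
        by (rule const_mult_const)
      also have "\<dots> \<approx> const (c * d) * vert z"
        using vert_vert[of z z] zH by (intro eqv_mult_left) auto
      finally have "const c * vert z * (const d * vert z) \<approx> const (c * d) * vert z" .
      from eqv_full_ideal[OF J this] show "const c * vert z * (const d * vert z) \<notin> ?J"
        using vert_notin[OF zH, of "c * d"] dom[OF c(1) d(1)] by blast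
    qed
  qed
qed

text \<open>
  Every vertex outside of \<open>\<Omega>(v)\<close> connects to \<open>v\<close> and \<open>v v\<^sup>H = v\<^sup>H\<close>, so every homogeneous element
  outside of the ideal compresses to a multiple of \<open>v\<^sup>H\<close>.
\<close>

lemma prime_hs_breaking:
  assumes dom: "\<And>c d :: 'r. c \<noteq> 0 \<Longrightarrow> d \<noteq> 0 \<Longrightarrow> c * d \<noteq> 0"
    and "countable (arcs E)" and v: "v \<in> BV E"
  defines "H \<equiv> Omega E {v}"
  shows "prime_poly_ideal (hs_ideal H (breaking E H - {v}))"
proof -
  have inf: "infinite (out_arcs E v)" and vE: "v \<in> verts E" using v by (auto simp: BV_def infinite_emitter_def)
  note \<Omega> = Omega_vertex[OF inf, folded H_def]
  have H: "H \<subseteq> verts E" using \<Omega>(1) by (simp add: hereditary_def)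
  have vb: "v \<in> breaking E H" using v by (auto simp: BV_def breaking_iff infinite_emitter_def outside_def H_def Omega_def)
  then have vH: "v \<in> verts E - H" and fin: "finite (outside H v)" by (auto simp: breaking_iff)
  let ?S = "breaking E H - {v}"
  let ?J = "hs_ideal H ?S"
  have S: "?S \<subseteq> breaking E H" by blast
  note J = full_hs_ideal[OF H S]
  have gap_notin: "const c * gap H v \<notin> ?J" if "c \<noteq> 0" for c
    using const_gap_hs_ideal[OF assms(2) \<Omega>(1,2) S, of v c] vb that by blast
  have K: "outside H v \<subseteq> out_arcs E v" by (auto simp: outside_def)
  have vert_gap: "compresses_to ?J (vert v) (gap H v)"
  proof (rule compresses_toI[where a = 1 and b = "gap H v"])
    have "vert v * gap H v \<approx> gap H v" unfolding gap_def by (rule vert_vert_minus(1)[OF vE fin K])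
    then show "1 * vert v * gap H v - gap H v \<in> ?J" using eqv_full_ideal_diff[OF J] by simp
  qed (use gap_aug[OF vE] in auto)
  have red: "\<exists>c. c \<noteq> 0 \<and> compresses_to ?J x (const c * gap H v)"
    if x: "x \<in> aug E" "hom_deg k x" "x \<notin> ?J" for x k
  proof -
    from H S x show ?thesis
    proof (cases rule: homogeneous_compresses_hs)
      case (1 c w)
      have "w \<rightarrow>\<^sup>*\<^bsub>E\<^esub> v" using \<Omega>(3)[OF 1(2) vE] .
      from compresses_to_trans[OF J compresses_to_reachable[OF J this] compresses_to_const[OF J vert_gap]]
      have "compresses_to ?J (const c * vert w) (const c * gap H v)" .
      from compresses_to_trans[OF J 1(3) this] show ?thesis using 1(1) by blast
    next
      case (2 c w)
      then show ?thesis by auto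
    qed
  qed
  show ?thesis
  proof (rule prime_if_graded_prime[OF J hpart_closed_hs_ideal[OF H S]])
    have "gap H v \<notin> ?J" using gap_notin[of 1] by (simp add: const_simps)
    then show "?J \<noteq> aug E" using gap_aug[OF vE] by blast
  next
    fix x y k l
    assume x: "x \<in> aug E" and y: "y \<in> aug E" and hom: "hom_deg k x" "hom_deg l y" and notin: "x \<notin> ?J" "y \<notin> ?J"
    obtain c where c: "c \<noteq> 0" "compresses_to ?J x (const c * gap H v)"
      using red[OF x hom(1) notin(1)] by blast
    obtain d where d: "d \<noteq> 0" "compresses_to ?J y (const d * gap H v)"
      using red[OF y hom(2) notin(2)] by blast
    have cz: "const c * gap H v \<in> aug E" using gap_aug[OF vE] by (intro aug_mult_left) auto
    show "\<exists>a\<in>uni_alg E. x * a * y \<notin> ?J"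
    proof (rule compresses_to_product[OF J c(2) d(2) x y cz])
      have "const c * gap H v * (const d * gap H v) = const (c * d) * (gap H v * gap H v)"
        by (rule const_mult_const)
      also have "\<dots> \<approx> const (c * d) * gap H v"
        by (intro eqv_mult_left gap_idempotent vE fin) simp
      finally have "const c * gap H v * (const d * gap H v) \<approx> const (c * d) * gap H v" .
      from eqv_full_ideal[OF J this] show "const c * gap H v * (const d * gap H v) \<notin> ?J"
        using gap_notin[OF dom[OF c(1) d(1)]] by blast
    qed
  qed
qed

section \<open>From prime ideals to maximal tails and breaking vertices\<close>

lemma monomial_witness:
  assumes J: "full_ideal J" and a: "a \<in> aug E" and xy: "x \<in> uni_alg E" "y \<in> uni_alg E" and notin: "x * a * y \<notin> J"
  obtains u p u' q w where "awalk u p w" "awalk u' q w" "x * (path_elem u p * path_star u' q) * y \<notin> J"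
proof -
  note J' = full_idealD(1)[OF J]
  have "\<exists>k. x * hpart k a * y \<notin> J"
  proof (rule ccontr)
    assume *: "\<not> ?thesis"
    have "x * (\<Sum>k\<in>wdeg ` Poly_Mapping.keys a. hpart k a) * y \<in> J"
      unfolding sum_distrib_left sum_distrib_right using * by (intro uideal_sum[OF J']) blast
    then show False using notin by (simp add: sum_hpart)
  qed
  then obtain k where k: "x * hpart k a * y \<notin> J" by blast
  obtain c T where T: "finite T" "T \<subseteq> deg_monomials E k" "hpart k a \<approx> (\<Sum>m\<in>T. const (c m) * m)"
    by (rule lspan_sumE[OF hom_deg_lspan[OF hpart_aug[OF a] hom_deg_hpart]])
  have "x * hpart k a * y \<approx> x * (\<Sum>m\<in>T. const (c m) * m) * y"
    using xy T(3) by (intro eqv_mult_right eqv_mult_left)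
  also have "\<dots> = (\<Sum>m\<in>T. const (c m) * (x * m * y))"
    by (simp add: sum_distrib_left sum_distrib_right const_commute[of _ x] flip: mult.assoc)
  finally have "x * hpart k a * y \<approx> \<dots>" .
  from eqv_full_ideal[OF J this] have "(\<Sum>m\<in>T. const (c m) * (x * m * y)) \<notin> J" using k by blast
  then obtain m where m: "m \<in> T" "const (c m) * (x * m * y) \<notin> J"
    using uideal_sum[OF J', of T "\<lambda>m. const (c m) * (x * m * y)"] by blast
  then have "x * m * y \<notin> J" using uideal_mult_left[OF J' _ uni_alg_const] by blast
  moreover obtain u p u' q w where "m = path_elem u p * path_star u' q" "awalk u p w" "awalk u' q w"
    using m(1) T(2) by (auto simp: deg_monomials_def)
  ultimately show ?thesis using that by blast
qed

lemma prime_monomial: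
  assumes J: "full_ideal J" and prime: "prime_poly_ideal J"
    and x: "x \<in> aug E" "x \<notin> J" "x * vert v \<approx> x" "v \<in> verts E" and y: "y \<in> aug E" "y \<notin> J"
  obtains u p u' q w where "awalk u p w" "awalk u' q w" "x * (path_elem u p * path_star u' q) * y \<notin> J"
proof -
  obtain a where a: "a \<in> uni_alg E" "x * a * y \<notin> J" using prime_elements[OF J prime x(1,2) y] by blast
  have "x * vert v * (a * y) \<approx> x * (a * y)" using x a y by (intro eqv_mult_right) auto
  then have "x * (vert v * a) * y \<approx> x * a * y" by (simp add: mult.assoc)
  from eqv_full_ideal[OF J this] a(2) have notin: "x * (vert v * a) * y \<notin> J" by blast
  have va: "vert v * a \<in> aug E" using a(1) x(4) by (intro aug_mult_right) auto
  show ?thesis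
    by (rule monomial_witness[OF J va _ _ notin]) (use x y that in auto)
qed

text \<open>
  The range of \<open>\<alpha>\<close> can be inserted between \<open>\<alpha>\<close> and \<open>\<beta>\<^sup>*\<close>.
\<close>

lemma monomial_range_notin:
  assumes J: "full_ideal J" and p: "awalk u p w" and q: "awalk u' q w" and xy: "x \<in> uni_alg E" "y \<in> uni_alg E"
    and notin: "x * (path_elem u p * path_star u' q) * y \<notin> J"
  shows "vert w \<notin> J"
proof
  assume w: "vert w \<in> J"
  note J' = full_idealD(1)[OF J] and aug = path_aug[OF p] path_aug[OF q]
  have "path_elem u p * vert w * path_star u' q \<approx> path_elem u p * path_star u' q"
    using path_elem_vert[OF p] aug by (intro eqv_mult_right) auto
  moreover have "path_elem u p * vert w * path_star u' q \<in> J"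
    by (rule uideal_mult_right[OF J'], rule uideal_mult_left[OF J' w]) (use aug in auto)
  ultimately have "path_elem u p * path_star u' q \<in> J" using eqv_full_ideal[OF J] by blast
  then have "x * (path_elem u p * path_star u' q) * y \<in> J"
    using uideal_mult_right[OF J' uideal_mult_left[OF J' _ xy(1)] xy(2)] by blast
  then show False using notin by blast
qed

text \<open>
  If \<open>e\<close> starts at \<open>v\<close> and ends outside of \<open>H\<close>, then \<open>v\<^sup>H e = e - e e\<^sup>* e = 0\<close>; if it ends in \<open>H\<close>, then
  \<open>v\<^sup>H e = e = e r(e)\<close> lies in \<open>J\<close>.
\<close>

lemma gap_edge:
  assumes J: "full_ideal J" and H: "\<And>w. w \<in> H \<Longrightarrow> vert w \<in> J" and v: "v \<in> verts E" "finite (outside H v)"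
    and e: "e \<in> arcs E"
  shows "gap H v * edge e \<in> J" "ghost e * gap H v \<in> J"
proof -
  note J' = full_idealD(1)[OF J]
  let ?K = "outside H v"
  have K: "?K \<subseteq> arcs E" by (rule outside_arcs)
  have "gap H v * edge e \<approx> (if v = tail E e then edge e else 0) - (if e \<in> ?K then edge e else 0)"
    unfolding gap_def vert_minus_epr left_diff_distrib
    using v e K by (intro eqv_diff vert_edge epr_edge) auto
  moreover have "ghost e * gap H v \<approx> (if v = tail E e then ghost e else 0) - (if e \<in> ?K then ghost e else 0)"
    unfolding gap_def vert_minus_epr right_diff_distrib
    using v e K by (intro eqv_diff ghost_vert ghost_epr) auto
  moreover have "(if v = tail E e then edge e else 0) - (if e \<in> ?K then edge e else 0) \<in> J \<and>
      (if v = tail E e then ghost e else 0) - (if e \<in> ?K then ghost e else 0) \<in> J"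
  proof (cases "v = tail E e \<and> head E e \<in> H")
    case True
    have "edge e * vert (head E e) \<in> J" "vert (head E e) * ghost e \<in> J"
      by (rule uideal_mult_left[OF J'] uideal_mult_right[OF J']; use H True e in simp)+
    then have "edge e \<in> J" "ghost e \<in> J"
      using eqv_full_ideal[OF J edge_head[OF e]] eqv_full_ideal[OF J head_ghost[OF e]] by auto
    then show ?thesis using True by (simp add: outside_def)
  next
    case False
    then show ?thesis using e uideal_0[OF J'] by (auto simp: outside_def)
  qed
  ultimately show "gap H v * edge e \<in> J" "ghost e * gap H v \<in> J"
    using eqv_full_ideal[OF J] by blast+
qed

lemma gap_path:
  assumes J: "full_ideal J" and H: "\<And>w. w \<in> H \<Longrightarrow> vert w \<in> J" and v: "v \<in> verts E" "finite (outside H v)"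
    and p: "awalk u p w"
  shows "gap H v * path_elem u p \<notin> J \<Longrightarrow> p = [] \<and> w = v" "path_star u p * gap H v \<notin> J \<Longrightarrow> p = [] \<and> w = v"
proof -
  note J' = full_idealD(1)[OF J]
  have K: "outside H v \<subseteq> out_arcs E v" by (auto simp: outside_def)
  have vg: "vert v * gap H v \<approx> gap H v" "gap H v * vert v \<approx> gap H v"
    unfolding gap_def by (rule vert_vert_minus[OF v K])+
  have g: "gap H v \<in> uni_alg E" using gap_aug[OF v(1)] by auto
  have empty: "gap H v * vert w \<in> J \<and> vert w * gap H v \<in> J" if "w \<noteq> v" "w \<in> verts E" for w
  proof -
    have "gap H v * vert w \<approx> gap H v * vert v * vert w"
      using vg that by (intro eqv_mult_right eqv_sym[OF vg(2)]) auto
    also have "\<dots> \<approx> gap H v * 0"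
      unfolding mult.assoc using vert_vert[of v w] v that g by (intro eqv_mult_left) auto
    finally have 1: "gap H v * vert w \<approx> 0" by simp
    have "vert w * gap H v \<approx> vert w * (vert v * gap H v)"
      using vg that by (intro eqv_mult_left eqv_sym[OF vg(1)]) auto
    also have "\<dots> \<approx> 0 * gap H v"
      unfolding mult.assoc[symmetric] using vert_vert[of w v] v that g by (intro eqv_mult_right) auto
    finally have 2: "vert w * gap H v \<approx> 0" by simp
    show ?thesis using eqv_full_ideal[OF J 1] eqv_full_ideal[OF J 2] uideal_0[OF J'] by blast
  qed
  have w: "w \<in> verts E" using p by auto
  show "gap H v * path_elem u p \<notin> J \<Longrightarrow> p = [] \<and> w = v"
  proof (cases p)
    case Nil
    then have "u = w" using p by (simp add: awalk_def)
    then show "gap H v * path_elem u p \<notin> J \<Longrightarrow> p = [] \<and> w = v" using empty[of w] w Nil by auto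
  next
    case (Cons e q)
    then have "gap H v * edge e * prod_list (map edge q) \<in> J"
      using p by (intro uideal_mult_right[OF J' gap_edge(1)[OF J H v]] prod_edges_uni) (auto simp: awalk_def)
    then show "gap H v * path_elem u p \<notin> J \<Longrightarrow> p = [] \<and> w = v"
      using Cons by (simp add: path_elem_Cons mult.assoc)
  qed
  show "path_star u p * gap H v \<notin> J \<Longrightarrow> p = [] \<and> w = v"
  proof (cases p)
    case Nil
    then have "u = w" using p by (simp add: awalk_def)
    then show "path_star u p * gap H v \<notin> J \<Longrightarrow> p = [] \<and> w = v" using empty[of w] w Nil by auto
  next
    case (Cons e q)
    then have "prod_list (map ghost (rev q)) * (ghost e * gap H v) \<in> J"
      using p by (intro uideal_mult_left[OF J' gap_edge(2)[OF J H v]] prod_ghosts_uni) (auto simp: awalk_def)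
    then show "path_star u p * gap H v \<notin> J \<Longrightarrow> p = [] \<and> w = v"
      using Cons by (simp add: path_star_Cons mult.assoc)
  qed
qed

lemma path_star_vert_notin:
  assumes J: "full_ideal J" and q: "awalk u q w" and v: "v \<in> verts E" and notin: "path_star u q * vert v \<notin> J"
  shows "u = v"
  using notin eqv_full_ideal[OF J path_star_vert[OF q v]] uideal_0[OF full_idealD(1)[OF J]]
  by (auto split: if_splits)

lemma vert_path_elem_notin:
  assumes J: "full_ideal J" and q: "awalk u q w" and v: "v \<in> verts E" and notin: "vert v * path_elem u q \<notin> J"
  shows "u = v"
  using notin eqv_full_ideal[OF J vert_path_elem[OF q v]] uideal_0[OF full_idealD(1)[OF J]]
  by (auto split: if_splits)

lemma mult_notinD:
  assumes J: "full_ideal J" and "x \<in> uni_alg E" "y \<in> uni_alg E" "x * (a * b) * y \<notin> J" 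
    "a \<in> uni_alg E" "b \<in> uni_alg E"
  shows "x * a \<notin> J" "b * y \<notin> J"
proof -
  note J' = full_idealD(1)[OF J]
  show "x * a \<notin> J"
  proof
    assume "x * a \<in> J"
    from uideal_mult_right[OF J' this, of "b * y"] have "(x * a) * (b * y) \<in> J" using assms by simp
    then show False using assms by (simp add: mult.assoc)
  qed
  show "b * y \<notin> J"
  proof
    assume "b * y \<in> J"
    from uideal_mult_left[OF J' this, of "x * a"] have "(x * a) * (b * y) \<in> J" using assms by simp
    then show False using assms by (simp add: mult.assoc)
  qed
qed

lemma prime_downward_directed:
  assumes J: "full_ideal J" and prime: "prime_poly_ideal J"
    and v: "v \<in> verts E - hs_vertices J" and w: "w \<in> verts E - hs_vertices J"
  shows "\<exists>y\<in>verts E - hs_vertices J. v \<rightarrow>\<^sup>*\<^bsub>E\<^esub> y \<and> w \<rightarrow>\<^sup>*\<^bsub>E\<^esub> y"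
proof -
  have vw: "vert v \<in> aug E" "vert v \<notin> J" "v \<in> verts E" "vert w \<in> aug E" "vert w \<notin> J" "w \<in> verts E"
    using v w by (auto simp: hs_vertices_def)
  have vv: "vert v * vert v \<approx> vert v" using vert_vert[of v v] vw by simp
  obtain u p u' q y where p: "awalk u p y" and q: "awalk u' q y"
    and notin: "vert v * (path_elem u p * path_star u' q) * vert w \<notin> J"
    by (rule prime_monomial[OF J prime vw(1,2) vv vw(3,4,5)])
  have "vert y \<notin> J" by (rule monomial_range_notin[OF J p q _ _ notin]) (use vw in auto)
  moreover have "u = v"
    by (rule vert_path_elem_notin[OF J p vw(3) mult_notinD(1)[OF J _ _ notin]])
      (use vw path_aug[OF p] path_aug[OF q] in auto)
  moreover have "u' = w"
    by (rule path_star_vert_notin[OF J q vw(6) mult_notinD(2)[OF J _ _ notin]])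
      (use vw path_aug[OF p] path_aug[OF q] in auto)
  ultimately show ?thesis using p q reachable_awalk by (auto simp: hs_vertices_def)
qed

text \<open>
  In \<open>v\<^sup>H \<alpha> \<beta>\<^sup>* w \<notin> J\<close> the path \<open>\<alpha>\<close> has to be the vertex \<open>v\<close>, so \<open>\<beta>\<close> leads from \<open>w\<close> to \<open>v\<close>.  In
  \<open>v\<^sup>H \<alpha> \<beta>\<^sup>* w\<^sup>H \<notin> J\<close> the path \<open>\<beta>\<close> is trivial too.
\<close>

lemma prime_gap:
  assumes J: "full_ideal J" and prime: "prime_poly_ideal J"
    and v: "v \<in> breaking E (hs_vertices J) - hs_gaps J"
  shows "w \<in> verts E - hs_vertices J \<Longrightarrow> w \<rightarrow>\<^sup>*\<^bsub>E\<^esub> v"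
    and "w \<in> breaking E (hs_vertices J) - hs_gaps J \<Longrightarrow> w = v"
proof -
  let ?H = "hs_vertices J"
  have H: "\<And>w. w \<in> ?H \<Longrightarrow> vert w \<in> J" by (simp add: hs_vertices_def)
  have g: "gap ?H w \<in> aug E" "gap ?H w \<notin> J" "w \<in> verts E" "finite (outside ?H w)"
    "gap ?H w * vert w \<approx> gap ?H w"
    if w: "w \<in> breaking E ?H - hs_gaps J" for w
  proof -
    have K: "outside ?H w \<subseteq> out_arcs E w" by (auto simp: outside_def)
    show 1: "w \<in> verts E" "finite (outside ?H w)" using w by (auto simp: breaking_iff)
    show "gap ?H w \<in> aug E" using gap_aug[OF 1(1)] .
    show "gap ?H w \<notin> J" using w by (auto simp: hs_gaps_def)
    show "gap ?H w * vert w \<approx> gap ?H w" unfolding gap_def by (rule vert_vert_minus(2)[OF 1 K])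
  qed
  note gv = g[OF v]
  show "w \<rightarrow>\<^sup>*\<^bsub>E\<^esub> v" if "w \<in> verts E - ?H"
  proof -
    have w: "vert w \<in> aug E" "vert w \<notin> J" "w \<in> verts E" using that by (auto simp: hs_vertices_def)
    obtain u p u' q y where p: "awalk u p y" and q: "awalk u' q y"
      and notin: "gap ?H v * (path_elem u p * path_star u' q) * vert w \<notin> J"
      by (rule prime_monomial[OF J prime gv(1,2,5,3) w(1,2)])
    have "gap ?H v * path_elem u p \<notin> J" "path_star u' q * vert w \<notin> J"
      using mult_notinD[OF J _ _ notin] gv(1) w path_aug[OF p] path_aug[OF q] by auto
    then have "y = v" "u' = w"
      using gap_path(1)[OF J H gv(3,4) p] path_star_vert_notin[OF J q w(3)] by auto
    then show ?thesis using q reachable_awalk by auto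
  qed
  show "w = v" if "w \<in> breaking E ?H - hs_gaps J"
  proof -
    note gw = g[OF that]
    obtain u p u' q y where p: "awalk u p y" and q: "awalk u' q y"
      and notin: "gap ?H v * (path_elem u p * path_star u' q) * gap ?H w \<notin> J"
      by (rule prime_monomial[OF J prime gv(1,2,5,3) gw(1,2)])
    have "gap ?H v * path_elem u p \<notin> J" "path_star u' q * gap ?H w \<notin> J"
      using mult_notinD[OF J _ _ notin] gv(1) gw(1) path_aug[OF p] path_aug[OF q] by auto
    then show ?thesis
      using gap_path(1)[OF J H gv(3,4) p] gap_path(2)[OF J H gw(3,4) q] by auto
  qed
qed

lemma prime_maximal_tail:
  assumes J: "full_ideal J" and prime: "prime_poly_ideal J"
  shows "verts E - hs_vertices J \<in> maximal_tails E" "Omega E (verts E - hs_vertices J) = hs_vertices J"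
proof -
  let ?H = "hs_vertices J" and ?M = "verts E - hs_vertices J"
  note H = hereditary_hs_vertices[OF J]
  have up: "v \<in> ?M" if "v \<in> verts E" "w \<in> ?M" "v \<rightarrow>\<^sup>*\<^bsub>E\<^esub> w" for v w
    using that reachable_hereditary[OF H that(3)] by auto
  have "?M \<noteq> {}"
  proof
    assume M: "?M = {}"
    have "x \<in> J" if x: "x \<in> aug E" for x
    proof (rule ccontr)
      assume "x \<notin> J"
      from prime_elements[OF J prime x this x this] obtain a where a: "a \<in> uni_alg E" "x * a * x \<notin> J" by blast
      have xa: "x * a \<in> aug E" using x a by (intro aug_mult_right)
      have "1 * (x * a) * x \<notin> J" using a by simp
      obtain u p u' q w where
        *: "awalk u p w" "awalk u' q w" "1 * (path_elem u p * path_star u' q) * x \<notin> J"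
        by (rule monomial_witness[OF J xa uni_alg_1 aug_uni[OF x] \<open>1 * (x * a) * x \<notin> J\<close>])
      have "vert w \<notin> J" by (rule monomial_range_notin[OF J *(1,2) _ _ *(3)]) (use x in auto)
      then have "w \<in> ?M" using *(1) by (auto simp: hs_vertices_def)
      then show False using M by blast
    qed
    then show False using prime uideal_aug[OF full_idealD(1)[OF J]] by (auto simp: prime_poly_ideal_def)
  qed
  moreover have "\<exists>e\<in>arcs E. tail E e = v \<and> head E e \<in> ?M" if v: "v \<in> ?M" "regular_vertex E v" for v
  proof (rule ccontr)
    assume "\<not> ?thesis"
    then have "head E ` out_arcs E v \<subseteq> ?H" by (auto simp: image_subset_iff)
    then show False using saturated_hs_vertices[OF J] v by (auto simp: saturated_def)
  qed
  ultimately show "?M \<in> maximal_tails E"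
    unfolding maximal_tails_def using up prime_downward_directed[OF J prime] by blast
  show "Omega E ?M = ?H"
  proof
    show "Omega E ?M \<subseteq> ?H" by (auto simp: Omega_def)
    show "?H \<subseteq> Omega E ?M"
      using reachable_hereditary[OF H] by (auto simp: Omega_def hs_vertices_def)
  qed
qed

theorem prime_graded_basic_classification:
  assumes J: "full_ideal J" and prime: "prime_poly_ideal J" and graded: "hpart_closed J" and basic: "basic_poly_ideal J"
  shows "(\<exists>M\<in>maximal_tails E. J = hs_ideal (Omega E M) (breaking E (Omega E M))) \<or>
    (\<exists>v\<in>BV E. J = hs_ideal (Omega E {v}) (breaking E (Omega E {v}) - {v}))"
proof -
  let ?H = "hs_vertices J" and ?S = "hs_gaps J"
  have eq: "J = hs_ideal ?H ?S" by (rule graded_basic_eq_hs_ideal[OF J graded basic])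
  have S: "?S \<subseteq> breaking E ?H" by (auto simp: hs_gaps_def)
  show ?thesis
  proof (cases "breaking E ?H - ?S = {}")
    case True
    then have "?S = breaking E ?H" using S by blast
    then show ?thesis using eq prime_maximal_tail[OF J prime] by metis
  next
    case False
    then obtain v where v: "v \<in> breaking E ?H - ?S" by blast
    then have vH: "v \<in> verts E" "v \<notin> ?H" by (auto simp: breaking_iff)
    have Sv: "?S = breaking E ?H - {v}" using prime_gap(2)[OF J prime v] v S by blast
    have "?H \<subseteq> Omega E {v}"
    proof
      fix w assume w: "w \<in> ?H"
      then have "\<not> w \<rightarrow>\<^sup>*\<^bsub>E\<^esub> v" using reachable_hereditary[OF hereditary_hs_vertices[OF J]] vH by blast
      then show "w \<in> Omega E {v}" using w vH by (auto simp: Omega_def hs_vertices_def)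
    qed
    moreover have "Omega E {v} \<subseteq> ?H"
      using prime_gap(1)[OF J prime v] by (auto simp: Omega_def)
    ultimately have H: "?H = Omega E {v}" by blast
    have "v \<in> BV E" using v unfolding H BV_def breaking_def by auto
    then show ?thesis using eq unfolding Sv unfolding H by blast
  qed
qed

end

theorem theorem4p11:
  fixes E :: "('v, 'e) pre_digraph"
  assumes "wf_digraph E" and "countable (verts E)" and "countable (arcs E)"
  shows "{I :: ('v, 'e, 'r::idom) lpa_elem set.
            rng_prime_ideal I (lpa E) \<and> graded_ideal E I \<and> basic_ideal E I} =
         {ideal_HS E (Omega E M) (breaking E (Omega E M)) | M. M \<in> maximal_tails E} \<union>
         {ideal_HS E (Omega E {v}) (breaking E (Omega E {v}) - {v}) | v. v \<in> BV E}"
    (is "?L = ?R1 \<union> ?R2")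
proof -
  interpret leavitt E "TYPE('r)" using assms(1) by (simp add: leavitt_def)
  have props: "rng_prime_ideal I (lpa E) \<longleftrightarrow> prime_poly_ideal (lift_ideal I)"
    "graded_ideal E I \<longleftrightarrow> hpart_closed (lift_ideal I)" "basic_ideal E I \<longleftrightarrow> basic_poly_ideal (lift_ideal I)"
    if "rng_ideal I (lpa E)" for I :: "('v, 'e, 'r) lpa_elem set"
    using rng_prime_ideal_iff[OF that] graded_ideal_iff[OF that] basic_ideal_iff[OF that] by (simp_all add: prime_poly_ideal_def)
  have dom: "c * d \<noteq> 0" if "c \<noteq> 0" "d \<noteq> 0" for c d :: 'r using that by simp
  have good: "rng_ideal (ideal_HS E H S :: ('v, 'e, 'r) lpa_elem set) (lpa E)"
    "lift_ideal (ideal_HS E H S) = hs_ideal H S" "full_ideal (hs_ideal H S)"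
    "hpart_closed (hs_ideal H S)" "basic_poly_ideal (hs_ideal H S)"
    if "hereditary H" "saturated H" "S \<subseteq> breaking E H" for H S
    using that lift_ideal_HS[of H S] full_hs_ideal[of H S] hpart_closed_hs_ideal[of H S] basic_hs_ideal[OF assms(3) that]
    by (auto simp: hereditary_def)
  have tail: "hereditary (Omega E M)" "saturated (Omega E M)" if "M \<in> maximal_tails E" for M
    using Omega_maximal_tail[OF that] by auto
  have bv: "hereditary (Omega E {v})" "saturated (Omega E {v})" if "v \<in> BV E" for v
    using Omega_vertex[of v] that by (auto simp: BV_def infinite_emitter_def)
  show ?thesis
  proof
    show "?L \<subseteq> ?R1 \<union> ?R2"
    proof
      fix I assume "I \<in> ?L"
      then have I: "rng_prime_ideal I (lpa E)" "graded_ideal E I" "basic_ideal E I" by auto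
      then have rI: "rng_ideal I (lpa E)" by (simp add: rng_prime_ideal_def)
      have eqI: "I = ideal_HS E H S"
        if "lift_ideal I = hs_ideal H S" "hereditary H" "saturated H" "S \<subseteq> breaking E H" for H S
        using image_lift_ideal[OF rI] image_lift_ideal[OF good(1)[OF that(2-4)]] good(2)[OF that(2-4)] that(1) by simp
      have "(\<exists>M\<in>maximal_tails E. lift_ideal I = hs_ideal (Omega E M) (breaking E (Omega E M))) \<or>
        (\<exists>v\<in>BV E. lift_ideal I = hs_ideal (Omega E {v}) (breaking E (Omega E {v}) - {v}))"
        using I props[OF rI] by (intro prime_graded_basic_classification full_lift_ideal rI) auto
      then show "I \<in> ?R1 \<union> ?R2"
      proof (elim disjE bexE)
        fix M assume M: "M \<in> maximal_tails E" "lift_ideal I = hs_ideal (Omega E M) (breaking E (Omega E M))"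
        from eqI[OF M(2) tail[OF M(1)] subset_refl] show ?thesis using M(1) by blast
      next
        fix v assume v: "v \<in> BV E" "lift_ideal I = hs_ideal (Omega E {v}) (breaking E (Omega E {v}) - {v})"
        from eqI[OF v(2) bv[OF v(1)] Diff_subset] show ?thesis using v(1) by blast
      qed
    qed
    have in_L: "ideal_HS E H S \<in> ?L"
      if "hereditary H" "saturated H" "S \<subseteq> breaking E H" "prime_poly_ideal (hs_ideal H S)" for H S
      using props[OF good(1)[OF that(1-3)]] good(2,4,5)[OF that(1-3)] that(4) by simp
    show "?R1 \<union> ?R2 \<subseteq> ?L"
    proof
      fix I :: "('v, 'e, 'r) lpa_elem set" assume "I \<in> ?R1 \<union> ?R2"
      then show "I \<in> ?L"
      proof (elim UnE CollectE exE conjE)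
        fix M assume M: "I = ideal_HS E (Omega E M) (breaking E (Omega E M))" "M \<in> maximal_tails E"
        show ?thesis unfolding M(1)
          by (rule in_L[OF tail[OF M(2)] subset_refl prime_hs_tail[OF dom assms(3) M(2)]])
      next
        fix v assume v: "I = ideal_HS E (Omega E {v}) (breaking E (Omega E {v}) - {v})" "v \<in> BV E"
        show ?thesis unfolding v(1)
          by (rule in_L[OF bv[OF v(2)] Diff_subset prime_hs_breaking[OF dom assms(3) v(2)]])
      qed
    qed
  qed
qed

end
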